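(* Let $\mathbb{T}^2=\mathbb{R}^2/\mathbb{Z}^2$ be the square flat torus. The maximum, over all sets of $8$ points of $\mathbb{T}^2$, of the minimal pairwise distance between the points equals $$d=\frac{1}{1+\sqrt3}\approx 0.3660 ,$$ and the optimal arrangement is unique up to isometry of $\mathbb{T}^2$: a set of $8$ points has minimal pairwise distance $d$ if and only if it is the image under an isometry of $\mathbb{T}^2$ of the set (coordinates modulo $\mathbb{Z}^2$) $$\Big\{\big(\pm\tfrac d2,0\big),\ \big(0,\tfrac12\pm\tfrac d2\big),\ \big(\tfrac12\pm\tfrac d2,\tfrac12\big),\ \big(\tfrac12,\pm\tfrac d2\big)\Big\}.$$
   Context: $\mathbb{T}^2=\mathbb{R}^2/\mathbb{Z}^2$ carries the flat metric induced from $\mathbb{R}^2$: $\mathrm{dist}(p,q)=\min_{z\in\mathbb{Z}^2}|\tilde p-\tilde q+z|$ for lifts $\tilde p,\tilde q\in\mathbb{R}^2$. The minimal pairwise distance of a finite set $X\subset\mathbb{T}^2$ is $\min_{u\ne v\in X}\mathrm{dist}(u,v)$. *)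

theory Defs
  imports "HOL-Analysis.Analysis"
begin

text \<open>The type \<^typ>\<open>real \<times> real\<close> carries the Euclidean norm.\<close>

abbreviation lattice :: "(real \<times> real) set" where
  "lattice \<equiv> \<int> \<times> \<int>"

lemma lattice_diff: "p \<in> lattice \<Longrightarrow> q \<in> lattice \<Longrightarrow> p - q \<in> lattice"
  by (cases p; cases q) auto

lemma lattice_add: "p \<in> lattice \<Longrightarrow> q \<in> lattice \<Longrightarrow> p + q \<in> lattice"
  by (cases p; cases q) auto

lemma lattice_minus: "p \<in> lattice \<Longrightarrow> - p \<in> lattice"
  by (cases p) auto

lemma lattice_zero: "0 \<in> lattice"
  by (simp add: zero_prod_def)

quotient_type torus = "real \<times> real" / "\<lambda>p q. p - q \<in> lattice"
  morphisms rep_torus to_torus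
proof (rule equivpI)
  show "reflp (\<lambda>p q. p - q \<in> lattice)"
    by (rule reflpI) (simp only: diff_self lattice_zero)
  show "symp (\<lambda>p q. p - q \<in> lattice)"
  proof (rule sympI)
    fix p q :: "real \<times> real"
    assume "p - q \<in> lattice"
    from lattice_minus[OF this] show "q - p \<in> lattice"
      by (simp only: minus_diff_eq)
  qed
  show "transp (\<lambda>p q. p - q \<in> lattice)"
  proof (rule transpI)
    fix p q r :: "real \<times> real"
    assume "p - q \<in> lattice" "q - r \<in> lattice"
    then have "(p - q) + (q - r) \<in> lattice"
      by (rule lattice_add)
    then show "p - r \<in> lattice"
      by (simp only: diff_add_cancel add_diff_eq)
  qed
qed

text \<open>The distance between the classes of two points of the plane. The infimum is attained, see
  \<open>plane_dist_attained\<close>.\<close>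

definition plane_dist :: "real \<times> real \<Rightarrow> real \<times> real \<Rightarrow> real" where
  "plane_dist p q = (INF z\<in>lattice. norm (p - q + z))"

lemma plane_dist_attained: "\<exists>z\<in>lattice. plane_dist p q = norm (p - q + z)"
proof -
  have cl: "closed lattice"
    by (intro closed_Times closed_Ints)
  have ne: "lattice \<noteq> {}"
    using lattice_zero by blast
  have "plane_dist p q = infdist (q - p) lattice"
    using ne by (simp add: plane_dist_def infdist_notempty dist_norm norm_minus_commute algebra_simps)
  moreover obtain z where "z \<in> lattice" "infdist (q - p) lattice = dist (q - p) z"
    using infdist_attains_inf[OF cl ne] by blast
  moreover have "dist (q - p) z = norm (p - q + z)"
    by (simp add: dist_norm norm_minus_commute algebra_simps)
  ultimately show ?thesis by auto
qed

lemma plane_dist_le: "z \<in> lattice \<Longrightarrow> plane_dist p q \<le> norm (p - q + z)"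
  unfolding plane_dist_def by (rule cINF_lower) (auto intro: bdd_belowI[of _ 0])

lemma plane_dist_mono:
  assumes "p - p' \<in> lattice" "q - q' \<in> lattice"
  shows "plane_dist p q \<le> plane_dist p' q'"
proof -
  obtain z where z: "z \<in> lattice" "plane_dist p' q' = norm (p' - q' + z)"
    using plane_dist_attained by blast
  have "z - (p - p') + (q - q') \<in> lattice"
    by (intro lattice_add lattice_diff z assms)
  from plane_dist_le[OF this, of p q] show ?thesis
    by (simp add: z algebra_simps)
qed

instantiation torus :: metric_space
begin

lift_definition dist_torus :: "torus \<Rightarrow> torus \<Rightarrow> real" is plane_dist
proof -
  fix p p' q q' :: "real \<times> real"
  assume "p - p' \<in> lattice" "q - q' \<in> lattice"
  moreover from this have "p' - p \<in> lattice" "q' - q \<in> lattice"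
    using lattice_minus[of "p - p'"] lattice_minus[of "q - q'"] by (simp_all only: minus_diff_eq)
  ultimately show "plane_dist p q = plane_dist p' q'"
    by (intro antisym plane_dist_mono)
qed

definition uniformity_torus :: "(torus \<times> torus) filter" where
  "uniformity_torus = (INF e\<in>{0<..}. principal {(x, y). dist x y < e})"

definition open_torus :: "torus set \<Rightarrow> bool" where
  "open_torus U = (\<forall>x\<in>U. \<forall>\<^sub>F (x', y) in uniformity. x' = x \<longrightarrow> y \<in> U)"

instance
proof
  show "uniformity = (INF e\<in>{0<..}. principal {(x, y::torus). dist x y < e})"
    by (rule uniformity_torus_def)
  show "open U = (\<forall>x\<in>U. \<forall>\<^sub>F (x', y) in uniformity. x' = x \<longrightarrow> y \<in> U)" for U :: "torus set"
    by (rule open_torus_def)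
  show "(dist x y = 0) = (x = y)" for x y :: torus
  proof transfer
    fix p q :: "real \<times> real"
    show "(plane_dist p q = 0) = (p - q \<in> lattice)"
    proof
      assume "plane_dist p q = 0"
      then obtain z where z: "z \<in> lattice" "norm (p - q + z) = 0"
        using plane_dist_attained[of p q] by metis
      then have "p - q = - z"
        by (simp only: norm_eq_zero eq_neg_iff_add_eq_0)
      then show "p - q \<in> lattice"
        using lattice_minus[OF z(1)] by (simp only:)
    next
      assume "p - q \<in> lattice"
      from plane_dist_le[OF lattice_minus[OF this], of p q] have "plane_dist p q \<le> 0"
        by (simp only: add.right_inverse norm_zero)
      moreover obtain z where "plane_dist p q = norm (p - q + z)"
        using plane_dist_attained by blast
      ultimately show "plane_dist p q = 0"
        by simp
    qed
  qed
  show "dist x y \<le> dist x z + dist y z" for x y z :: torus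
  proof transfer
    fix p q r :: "real \<times> real"
    obtain u where u: "u \<in> lattice" "plane_dist p r = norm (p - r + u)"
      using plane_dist_attained by blast
    obtain v where v: "v \<in> lattice" "plane_dist q r = norm (q - r + v)"
      using plane_dist_attained by blast
    have "plane_dist p q \<le> norm (p - q + (u - v))"
      by (intro plane_dist_le lattice_diff u v)
    also have "p - q + (u - v) = (p - r + u) - (q - r + v)"
      by simp
    also have "norm \<dots> \<le> norm (p - r + u) + norm (q - r + v)"
      by (rule norm_triangle_ineq4)
    finally show "plane_dist p q \<le> plane_dist p r + plane_dist q r"
      by (simp add: u v)
  qed
qed

end

definition isometry :: "('a::metric_space \<Rightarrow> 'a) \<Rightarrow> bool" where
  "isometry f \<longleftrightarrow> bij f \<and> (\<forall>x y. dist (f x) (f y) = dist x y)"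

text \<open>Only meaningful for finite sets with at least two points.\<close>

definition min_dist :: "'a::metric_space set \<Rightarrow> real" where
  "min_dist X = Min {dist u v | u v. u \<in> X \<and> v \<in> X \<and> u \<noteq> v}"

definition optimal_config :: "real \<Rightarrow> torus set" where
  "optimal_config d = to_torus `
     {(d/2, 0), (-d/2, 0),
      (0, 1/2 + d/2), (0, 1/2 - d/2),
      (1/2 + d/2, 1/2), (1/2 - d/2, 1/2),
      (1/2, d/2), (1/2, -d/2)}"

end

theory Submission
  imports Defs
begin

text \<open>
  Let \<open>P\<close> be the set of all lifts to the plane of a set of eight points with mutual distances at least \<open>d\<close>. Two points of \<open>P\<close>
  differ by a vector that is either steep or flat, so they are comparable for one of the two orders
  "above, by a steep vector" and "to the right, by a flat vector". A steep step rises by at least \<open>d / \<surd>2 > 1/4\<close>, so a chain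
  that closes up after one vertical period has at most three steps. Hence there are three levels per period in
  both directions, and \<open>P\<close> is a distorted \<open>3 \<times> 3\<close> grid with one vacancy.

  Given this combinatorial structure, bounds on the directions of the differences between neighbours
  turn \<open>|u| \<ge> d\<close> into linear inequalities. A branch and bound over these directions, with refutations by linear
  programming duality, leaves up to the symmetries of the square only a neighbourhood of the optimal configuration.

  There the eight points form four pairs whose connecting vectors are the short diagonals of four rhombi with sides of length at
  least \<open>d\<close>. The long diagonal of each rhombus and the short diagonal of the next one add up to a period.
  Lengthening one short diagonal shortens a long one, which lengthens another short diagonal by more; going round the cycle
  shows that nothing can be lengthened at all.
\<close>

subsection \<open>Refutation of direction constraints\<close>

text \<open>The optimum is a snub square tiling: its 20 contacts bound eight equilateral triangles,
  which pair into four rhombi, and four squares. Height \<open>1/2 - d/2\<close> and half base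
  \<open>d/2\<close> of a triangle yield \<open>d\<^sup>2 = 1/2 - d\<close>. The number eight enters
  twice. Nine consecutive points of a long chain include two congruent ones, so the chain can be cut
  there; and eight classes of points fill all but one of the nine pairs of residues modulo 3. Linear
  certificates cannot finish the proof. At the optimum all contacts are tight, so a refutation by a
  strict inequality is impossible in any neighbourhood of it. The nonlinear argument used there
  lives on the slope sqrt 3 > 1 at which the half base of an equilateral triangle grows when its
  height shrinks while the sides keep their length. What exceeds 1 pays for the tilt of the
  diagonals. Only distances at least \<open>d\<close> are assumed throughout, never equality. So the
  bound and the uniqueness have one common proof: every such set is a copy of the optimal
  one.\<close>

type_synonym vec = "int \<times> int"
type_synonym edge = "int \<times> int \<times> vec"
type_synonym cone = "vec \<times> vec"

text \<open>An \<^emph>\<open>edge\<close> \<open>(i, j, z)\<close> stands for the vector \<open>u\<close> from the point \<open>i\<close> to the translate by \<open>z\<close> of the point \<open>j\<close>; it is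
  confined to the cone between two directions. If \<open>A\<close>, \<open>B\<close> are points of the boundary rays at distance at most \<open>d\<close>
  from the origin, then a vector of the cone of length at least \<open>d\<close> lies beyond the chord \<open>AB\<close>, so that
  \<open>w \<bullet> u\<close> is at least the smaller of \<open>w \<bullet> A\<close> and \<open>w \<bullet> B\<close> if these are nonnegative. A leaf lists triples
  \<open>l, x, y\<close>: a force \<open>w = (x, y)\<close> on the edge number \<open>l\<close>. If the forces are in equilibrium at each vertex, then
  the sum of the \<open>w \<bullet> u\<close> is a sum of the known \<open>w \<bullet> z\<close>; the leaf is refuted if that is too small. A split
  cuts the cone of an edge by a direction.

  All vectors but the \<open>z\<close> are multiplied by 908, as \<open>908 d / \<surd>2\<close> is only slightly larger than the integer 235.\<close>

datatype tree = Split int int int tree tree | Leaf "int list" | Opt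

fun cross :: "vec \<Rightarrow> vec \<Rightarrow> int" where
  "cross (a, b) (c, e) = a * e - b * c"

fun dotp :: "vec \<Rightarrow> vec \<Rightarrow> int" where
  "dotp (a, b) (c, e) = a * c + b * e"

text \<open>\<open>acc\<close> collects \<open>908 w \<bullet> z\<close> minus the lower bound from
  the cone, so a negative total is the contradiction. \<open>nz\<close> keeps the loaded edges for
  the test of equilibrium. The triples have to follow the order of the edges: one that is left over
  at the end gives \<open>None\<close>. The test \<open>0 < cross A B\<close> rejects cones that are
  still half-planes, where the chord would pass through the origin.\<close>

fun tension :: "int \<Rightarrow> edge list \<Rightarrow> cone list \<Rightarrow> int list \<Rightarrow> int \<Rightarrow> edge list
    \<Rightarrow> (int \<times> edge list) option" where
  "tension k ((i, j, z) # es) ((A, B) # cs) (l # x # y # fs) acc nz =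
    (if k = l then
       let w = (x, y); p = dotp w A; q = dotp w B
       in if 0 < cross A B \<and> 0 \<le> p \<and> 0 \<le> q
          then tension (k + 1) es cs fs (acc + 908 * dotp w z - (if p \<le> q then p else q)) ((i, j, w) # nz)
          else None
     else tension (k + 1) es cs (l # x # y # fs) acc nz)"
| "tension k es cs [] acc nz = Some (acc, nz)"
| "tension k es cs fs acc nz = None"

fun balanced :: "int \<Rightarrow> edge list \<Rightarrow> int \<Rightarrow> int \<Rightarrow> bool" where
  "balanced v [] x y = (x = 0 \<and> y = 0)"
| "balanced v ((i, j, a, b) # r) x y =
    (if i = v then balanced v r (x + a) (y + b)
     else if j = v then balanced v r (x - a) (y - b) else balanced v r x y)"

definition "verts = [0, 1, 2, 3, 4, 5, 6, 7 :: int]"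

fun set_lo :: "int \<Rightarrow> vec \<Rightarrow> cone list \<Rightarrow> cone list" where
  "set_lo k C [] = []"
| "set_lo k C ((A, B) # cs) = (if k = 0 then (C, B) # cs else (A, B) # set_lo (k - 1) C cs)"

fun set_hi :: "int \<Rightarrow> vec \<Rightarrow> cone list \<Rightarrow> cone list" where
  "set_hi k C [] = []"
| "set_hi k C ((A, B) # cs) = (if k = 0 then (A, C) # cs else (A, B) # set_hi (k - 1) C cs)"

text \<open>A target with two zero vectors means no restriction. Otherwise the boundary rays
  suffice, since all vectors of the inner cone are nonnegative combinations of them.\<close>

fun subcone :: "cone \<Rightarrow> cone \<Rightarrow> bool" where
  "subcone (A, B) (A', B') \<longleftrightarrow> A' = (0, 0) \<and> B' = (0, 0) \<or>
     0 < cross A B \<and> 0 \<le> cross A' A \<and> 0 \<le> cross A' B \<and> 0 \<le> cross A B' \<and> 0 \<le> cross B B'"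

text \<open>The bound is the integer part of \<open>(908 * d0)\<^sup>2\<close>.\<close>

definition short :: "vec \<Rightarrow> bool" where
  "short A \<longleftrightarrow> dotp A A \<le> 110457"

text \<open>A \<open>Leaf\<close> is a Farkas certificate. With \<open>E = []\<close> no
  \<open>Opt\<close> is accepted, so the same function serves for pure refutations and for
  confinement to the cones \<open>E\<close>.\<close>

fun check :: "edge list \<Rightarrow> cone list \<Rightarrow> cone list \<Rightarrow> tree \<Rightarrow> bool" where
  "check es E cs (Leaf fs) = (case tension 0 es cs fs 0 [] of None \<Rightarrow> False
      | Some (s, nz) \<Rightarrow> s < 0 \<and> list_all (\<lambda>v. balanced v nz 0 0) verts)"
| "check es E cs (Split k x y l r) =
     (short (x, y) \<and> check es E (set_hi k (x, y) cs) l \<and> check es E (set_lo k (x, y) cs) r)"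
| "check es E cs Opt = (E \<noteq> [] \<and> list_all2 subcone cs E)"

definition wf_edges :: "edge list \<Rightarrow> bool" where
  "wf_edges es = list_all (\<lambda>(i, j, z). i \<noteq> j \<and> i \<in> set verts \<and> j \<in> set verts) es"

definition crossr :: "real \<times> real \<Rightarrow> real \<times> real \<Rightarrow> real" where
  "crossr u v = fst u * snd v - snd u * fst v"

definition rv :: "vec \<Rightarrow> real \<times> real" where
  "rv v = (of_int (fst v), of_int (snd v))"

text \<open>The weak inequalities put a splitting direction into both parts. Opposite boundary
  vectors make the two conditions coincide, which describes a half-plane.\<close>

definition in_cone :: "cone \<Rightarrow> real \<times> real \<Rightarrow> bool" where
  "in_cone c u \<longleftrightarrow> 0 \<le> crossr (rv (fst c)) u \<and> 0 \<le> crossr u (rv (snd c))"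

definition edge_vec :: "(int \<Rightarrow> real \<times> real) \<Rightarrow> edge \<Rightarrow> real \<times> real" where
  "edge_vec p e = p (fst (snd e)) + rv (snd (snd e)) - p (fst e)"

definition holds :: "(int \<Rightarrow> real \<times> real) \<Rightarrow> edge list \<Rightarrow> cone list \<Rightarrow> bool" where
  "holds p es cs = list_all2 (\<lambda>e c. in_cone c (edge_vec p e)) es cs"

section \<open>The distance d and rational bounds for it\<close>

definition d0 :: real where "d0 = 1 / (1 + sqrt 3)"

lemma d0_eq: "d0 = (sqrt 3 - 1) / 2"
proof -
  have "(sqrt 3 - 1) * (1 + sqrt 3) = 2"
    by (simp add: algebra_simps)
  moreover have "1 + sqrt 3 > 0"
    by (simp add: add_pos_pos)
  ultimately show ?thesis
    unfolding d0_def by (simp add: divide_eq_eq)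
qed

lemma d0_sq: "d0\<^sup>2 = 1 - sqrt 3 / 2"
proof -
  have "d0\<^sup>2 = ((sqrt 3)\<^sup>2 - 2 * sqrt 3 + 1) / 4"
    by (simp only: d0_eq power_divide power2_diff) simp
  then show ?thesis by simp
qed

lemma sqrt3_bounds: "1.7320508 < sqrt 3" "sqrt 3 < 1.7320509"
proof -
  show "1.7320508 < sqrt 3"
    by (rule real_less_rsqrt) (simp add: power2_eq_square)
  show "sqrt 3 < 1.7320509"
    by (rule real_less_lsqrt) (simp_all add: power2_eq_square)
qed

lemma d0_bounds: "0.3660254 < d0" "d0 < 0.36602545"
  using sqrt3_bounds by (simp_all add: d0_eq)

lemma d0_pos: "d0 > 0"
  using d0_bounds by simp

text \<open>Cramer's rule writes \<open>908 u\<close> as \<open>x A + y B\<close>, with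
  \<open>x\<close> and \<open>y\<close> nonnegative because \<open>u\<close> is in the cone. As
  \<open>A\<close> and \<open>B\<close> have length at most \<open>908 * d0\<close>, the triangle
  inequality forces \<open>x + y \<ge> 1\<close>. This is where the nonconvex condition on the norm
  turns into a linear one.\<close>

lemma cone_bound:
  assumes c: "0 < cross A B" and A: "short A" and B: "short B"
    and u: "in_cone (A, B) u" and n: "norm u \<ge> d0"
    and p: "0 \<le> dotp w A" and q: "0 \<le> dotp w B"
  shows "of_int (min (dotp w A) (dotp w B)) \<le> 908 * (rv w \<bullet> u)"
proof -
  obtain a1 a2 b1 b2 w1 w2 u1 u2 where e: "A = (a1, a2)" "B = (b1, b2)" "w = (w1, w2)" "u = (u1, u2)"
    by (cases A; cases B; cases w; cases u)
  define c :: real where "c = of_int (cross A B)"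
  define x where "x = 908 * crossr u (rv B) / c"
  define y where "y = 908 * crossr (rv A) u / c"
  have c0: "c > 0" using assms(1) by (simp add: c_def)
  have x0: "x \<ge> 0" and y0: "y \<ge> 0"
    using u c0 by (auto simp: x_def y_def in_cone_def)
  have cc: "c = of_int a1 * of_int b2 - of_int a2 * of_int b1" by (simp add: c_def e)
  have xc: "x * c = 908 * (u1 * b2 - u2 * b1)" "y * c = 908 * (a1 * u2 - a2 * u1)"
    using c0 by (auto simp: x_def y_def e crossr_def rv_def)
  have "(x * a1 + y * b1) * c = (x * c) * a1 + (y * c) * b1" by (simp add: algebra_simps)
  also have "\<dots> = 908 * u1 * c" unfolding xc by (simp add: cc algebra_simps)
  finally have u1: "908 * u1 = x * a1 + y * b1" using c0 by simp
  have "(x * a2 + y * b2) * c = (x * c) * a2 + (y * c) * b2" by (simp add: algebra_simps)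
  also have "\<dots> = 908 * u2 * c" unfolding xc by (simp add: cc algebra_simps)
  finally have u2: "908 * u2 = x * a2 + y * b2" using c0 by simp
  have uu: "908 *\<^sub>R u = x *\<^sub>R rv A + y *\<^sub>R rv B"
    using u1 u2 by (simp add: e rv_def)
  have R: "110457 \<le> (908 * d0)\<^sup>2"
    using sqrt3_bounds by (simp add: power_mult_distrib d0_sq)
  have nA: "norm (rv A) \<le> 908 * d0" if "short A" for A
  proof -
    have "(norm (rv A))\<^sup>2 = of_int (dotp A A)"
      by (cases A) (simp add: rv_def norm_Pair power2_eq_square)
    also have "\<dots> \<le> 110457" using that by (simp add: short_def)
    finally have "(norm (rv A))\<^sup>2 \<le> (908 * d0)\<^sup>2" using R by linarith
    then show ?thesis using d0_pos by (intro power2_le_imp_le[of "norm (rv A)"]) auto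
  qed
  have "908 * d0 \<le> norm (908 *\<^sub>R u)" using n by simp
  also have "\<dots> \<le> x * norm (rv A) + y * norm (rv B)"
    unfolding uu using norm_triangle_ineq[of "x *\<^sub>R rv A" "y *\<^sub>R rv B"] x0 y0 by simp
  also have "\<dots> \<le> x * (908 * d0) + y * (908 * d0)"
    using nA[OF A] nA[OF B] x0 y0 by (intro add_mono mult_left_mono) auto
  finally have "(908 * d0) * 1 \<le> (908 * d0) * (x + y)" by (simp add: algebra_simps)
  then have xy: "1 \<le> x + y" using d0_pos by simp
  define m where "m = min (dotp w A) (dotp w B)"
  have m0: "0 \<le> m" and mA: "m \<le> dotp w A" and mB: "m \<le> dotp w B" using p q by (auto simp: m_def)
  have "real_of_int m * 1 \<le> of_int m * (x + y)"
    using m0 xy by (intro mult_left_mono) auto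
  also have "\<dots> = x * of_int m + y * of_int m" by (simp add: algebra_simps)
  also have "\<dots> \<le> x * of_int (dotp w A) + y * of_int (dotp w B)"
    using mA mB x0 y0 by (intro add_mono mult_left_mono) auto
  also have "\<dots> = rv w \<bullet> (908 *\<^sub>R u)"
    unfolding uu inner_add_right inner_scaleR_right by (simp add: e rv_def)
  finally show ?thesis by (simp add: m_def)
qed

section \<open>Equilibrium of forces and soundness of the checker\<close>

definition flow :: "edge list \<Rightarrow> int \<Rightarrow> vec" where
  "flow nz v = (\<Sum>(i, j, a)\<leftarrow>nz. if i = v then a else if j = v then - a else 0)"

lemma flow_Nil: "flow [] v = 0"
  and flow_Cons: "flow ((i, j, a) # nz) v = (if i = v then a else if j = v then - a else 0) + flow nz v"
  by (simp_all add: flow_def)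

lemma balanced_flow: "balanced v nz x y \<longleftrightarrow> (x, y) + flow nz v = 0"
proof (induction v nz x y rule: balanced.induct)
  case (1 v x y)
  show ?case by (simp add: flow_Nil prod_eq_iff)
next
  case (2 v i j a b r x y)
  then show ?case by (simp add: flow_Cons add.assoc[symmetric])
qed

lemma rv_add: "rv (a + b) = rv a + rv b" and rv_minus: "rv (- a) = - rv a" and rv_0: "rv 0 = 0"
  by (simp_all add: rv_def prod_eq_iff)

text \<open>Summation by parts: grouped by vertices, the position \<open>p v\<close> is multiplied
  by minus the net force at \<open>v\<close>.\<close>

lemma flow_zero_sum:
  assumes "wf_edges nz" "\<And>v. v \<in> set verts \<Longrightarrow> flow nz v = 0"
  shows "(\<Sum>(i, j, a)\<leftarrow>nz. rv a \<bullet> (p j - p i)) = 0"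
proof -
  have "(\<Sum>(i, j, a)\<leftarrow>nz. rv a \<bullet> (p j - p i)) = - (\<Sum>v\<in>set verts. rv (flow nz v) \<bullet> p v)"
    using assms(1)
  proof (induction nz)
    case Nil
    then show ?case by (simp add: flow_Nil rv_0)
  next
    case (Cons e nz)
    obtain i j a where e: "e = (i, j, a)" by (cases e)
    have ij: "i \<noteq> j" "i \<in> set verts" "j \<in> set verts" and wf: "wf_edges nz"
      using Cons.prems by (auto simp: wf_edges_def e)
    have "(\<Sum>v\<in>set verts. rv (flow (e # nz) v) \<bullet> p v) =
      (\<Sum>v\<in>set verts. (if i = v then rv a \<bullet> p v else 0) + (if j = v then - (rv a \<bullet> p v) else 0)
         + rv (flow nz v) \<bullet> p v)"
      using ij(1) by (intro sum.cong refl) (simp add: e flow_Cons rv_add rv_minus rv_0 inner_add_left)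
    also have "\<dots> = rv a \<bullet> p i - rv a \<bullet> p j + (\<Sum>v\<in>set verts. rv (flow nz v) \<bullet> p v)"
      using ij by (simp add: sum.distrib)
    finally show ?case using Cons.IH[OF wf] by (simp add: e inner_diff_right)
  qed
  then show ?thesis using assms(2) by (simp add: rv_0)
qed

definition "short_cones cs = list_all (\<lambda>(A, B). short A \<and> short B) cs"

text \<open>The stated difference can only grow during the recursion: loading an edge adds
  \<open>908 (w \<bullet> u)\<close> minus its lower bound from \<open>cone_bound\<close>. It starts
  at 0, so in equilibrium, where the sum vanishes, \<open>s\<close> itself is nonnegative.\<close>

lemma tension_sound:
  assumes "tension k es cs fs acc nz = Some (s, nz')" "holds p es cs" "short_cones cs" "wf_edges es" "wf_edges nz"
    and "\<And>e. e \<in> set es \<Longrightarrow> norm (edge_vec p e) \<ge> d0"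
  shows "wf_edges nz' \<and> of_int s - 908 * (\<Sum>(i, j, a)\<leftarrow>nz'. rv a \<bullet> (p i - p j))
      \<ge> of_int acc - 908 * (\<Sum>(i, j, a)\<leftarrow>nz. rv a \<bullet> (p i - p j))"
  using assms
proof (induction k es cs fs acc nz rule: tension.induct)
  case (1 k i j z es A B cs l x y fs acc nz)
  define w where "w = (x, y)"
  have wf: "wf_edges ((i, j, w) # nz)" "wf_edges es"
    using "1.prems"(4,5) by (auto simp: wf_edges_def)
  have h: "in_cone (A, B) (edge_vec p (i, j, z))" "holds p es cs"
    using "1.prems"(2) by (auto simp: holds_def)
  have sh: "short A" "short B" "short_cones cs"
    using "1.prems"(3) by (auto simp: short_cones_def)
  show ?case
  proof (cases "k = l")
    case False
    then show ?thesis
      using "1.IH"(2) "1.prems" h sh wf by simp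
  next
    case True
    define m where "m = min (dotp w A) (dotp w B)"
    have g: "0 < cross A B" "0 \<le> dotp w A" "0 \<le> dotp w B"
      and t: "tension (k + 1) es cs fs (acc + 908 * dotp w z - m) ((i, j, w) # nz) = Some (s, nz')"
      using "1.prems"(1) True by (auto simp: Let_def w_def m_def min_def split: if_splits)
    have IH: "wf_edges nz' \<and> of_int s - 908 * (\<Sum>(i, j, a)\<leftarrow>nz'. rv a \<bullet> (p i - p j))
        \<ge> of_int (acc + 908 * dotp w z - m) - 908 * (\<Sum>(i, j, a)\<leftarrow>(i, j, w) # nz. rv a \<bullet> (p i - p j))"
      using "1.IH"(1)[OF True refl refl refl] t g h sh wf "1.prems"(6)
      by (simp add: w_def m_def min_def)
    have "of_int m \<le> 908 * (rv w \<bullet> edge_vec p (i, j, z))"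
      unfolding m_def using g h(1) sh "1.prems"(6) by (intro cone_bound) auto
    also have "rv w \<bullet> edge_vec p (i, j, z) = of_int (dotp w z) - rv w \<bullet> (p i - p j)"
      by (cases z; cases w) (simp add: edge_vec_def inner_diff_right inner_add_right rv_def algebra_simps)
    finally show ?thesis using IH by (auto simp: algebra_simps)
  qed
qed auto

text \<open>The cross products of \<open>u\<close> with \<open>C\<close> in the two orders are
  opposite numbers, so one of them is nonnegative.\<close>

lemma holds_split:
  assumes "holds p es cs"
  shows "holds p es (set_hi k C cs) \<or> holds p es (set_lo k C cs)"
  using assms
proof (induction k C cs arbitrary: es rule: set_hi.induct)
  case (2 k C A B cs)
  then obtain e es' where e: "es = e # es'" by (auto simp: holds_def list_all2_Cons2)
  have "0 \<le> crossr (edge_vec p e) (rv C) \<or> 0 \<le> crossr (rv C) (edge_vec p e)"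
    by (auto simp: crossr_def algebra_simps)
  then show ?case using 2 by (auto simp: e holds_def in_cone_def)
qed auto

lemma short_cones_set:
  "short_cones cs \<Longrightarrow> short C \<Longrightarrow> short_cones (set_hi k C cs)"
  "short_cones cs \<Longrightarrow> short C \<Longrightarrow> short_cones (set_lo k C cs)"
  by (induction k C cs rule: set_hi.induct) (auto simp: short_cones_def)

lemma subcone_in:
  assumes "subcone c c'" "in_cone c u"
  shows "in_cone c' u"
proof -
  obtain A B A' B' where e: "c = (A, B)" "c' = (A', B')" by (cases c; cases c')
  show ?thesis
  proof (cases "A' = (0, 0) \<and> B' = (0, 0)")
    case True
    then show ?thesis by (simp add: e in_cone_def crossr_def rv_def)
  next
    case False
    then have h: "0 < cross A B" "0 \<le> cross A' A" "0 \<le> cross A' B" "0 \<le> cross A B'" "0 \<le> cross B B'"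
      using assms(1) by (auto simp: e)
    have ci: "of_int (cross v w) = crossr (rv v) (rv w)" for v w
      by (cases v; cases w) (simp add: crossr_def rv_def)
    have r: "0 < crossr (rv A) (rv B)" "0 \<le> crossr (rv A') (rv A)" "0 \<le> crossr (rv A') (rv B)"
      "0 \<le> crossr (rv A) (rv B')" "0 \<le> crossr (rv B) (rv B')"
      unfolding ci[symmetric] using h by auto
    \<comment> \<open>Cramer's rule cleared of its denominator: \<open>u\<close> as a combination of
      \<open>A\<close> and \<open>B\<close>, paired with \<open>v\<close>.\<close>
    have k: "crossr v u * crossr (rv A) (rv B) = crossr u (rv B) * crossr v (rv A) + crossr (rv A) u * crossr v (rv B)" for v
      by (simp add: crossr_def algebra_simps)
    have i: "0 \<le> crossr (rv A) u" "0 \<le> crossr u (rv B)" using assms(2) by (auto simp: e in_cone_def)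
    have "0 \<le> crossr (rv A') u * crossr (rv A) (rv B)"
      unfolding k using i r by simp
    moreover have "0 \<le> crossr u (rv B') * crossr (rv A) (rv B)"
    proof -
      have "crossr u (rv B') * crossr (rv A) (rv B) =
          crossr u (rv B) * crossr (rv A) (rv B') + crossr (rv A) u * crossr (rv B) (rv B')"
        by (simp add: crossr_def algebra_simps)
      then show ?thesis using i r by simp
    qed
    ultimately show ?thesis using r(1) by (simp add: e in_cone_def zero_le_mult_iff)
  qed
qed

text \<open>For \<open>E = []\<close> the conclusion is absurd, and this is how the refuting trees
  are used.\<close>

lemma check_sound:
  assumes "check es E cs t" "holds p es cs" "short_cones cs" "wf_edges es"
    and sep: "\<And>e. e \<in> set es \<Longrightarrow> norm (edge_vec p e) \<ge> d0"
  shows "E \<noteq> [] \<and> holds p es E"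
  using assms(1-3)
proof (induction t arbitrary: cs)
  case (Split k x y l r)
  then show ?case
    using holds_split[of p es cs k "(x, y)"] short_cones_set[of cs "(x, y)" k] by auto
next
  case (Leaf fs)
  then obtain s nz where t: "tension 0 es cs fs 0 [] = Some (s, nz)" "s < 0"
    and b: "\<And>v. v \<in> set verts \<Longrightarrow> balanced v nz 0 0"
    by (auto split: option.splits simp: list_all_iff)
  have f: "flow nz v = 0" if "v \<in> set verts" for v
    using b[OF that] by (simp add: balanced_flow prod_eq_iff)
  have s: "wf_edges nz" "of_int s - 908 * (\<Sum>(i, j, a)\<leftarrow>nz. rv a \<bullet> (p i - p j)) \<ge> 0"
    using tension_sound[OF t(1) Leaf.prems(2,3) \<open>wf_edges es\<close> _ sep] by (auto simp: wf_edges_def)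
  have "(\<Sum>(i, j, a)\<leftarrow>nz. rv a \<bullet> (p i - p j)) = 0"
    using flow_zero_sum[OF s(1) f, of "\<lambda>v. - p v"] by (simp add: algebra_simps)
  then show ?case using s(2) t(2) by auto
next
  case Opt
  then show ?case
    unfolding holds_def by (simp add: list_all2_conv_all_nth) (metis subcone_in)
qed

subsection \<open>Chains of steep steps\<close>

locale packing =
  fixes P :: "(real \<times> real) set"
  assumes shift: "p \<in> P \<Longrightarrow> p + rv z \<in> P"
    and sep: "p \<in> P \<Longrightarrow> q \<in> P \<Longrightarrow> p \<noteq> q \<Longrightarrow> d0 \<le> norm (q - p)"
begin

definition up :: "real \<times> real \<Rightarrow> real \<times> real \<Rightarrow> bool" where
  "up p q \<longleftrightarrow> p \<in> P \<and> q \<in> P \<and> p \<noteq> q \<and> \<bar>fst q - fst p\<bar> \<le> snd q - snd p"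

text \<open>The vertical part of a steep vector is at least its length divided by sqrt 2, and 0.2588
  lies just below \<open>d0\<close> / sqrt 2.\<close>

lemma up_height: "up p q \<Longrightarrow> (2588/10000) < snd q - snd p"
proof -
  assume u: "up p q"
  then have "d0 \<le> norm (q - p)" and a: "\<bar>fst (q - p)\<bar> \<le> snd (q - p)"
    using sep by (auto simp: up_def)
  then have "d0\<^sup>2 \<le> (fst (q - p))\<^sup>2 + (snd (q - p))\<^sup>2"
    using d0_pos power_mono[of d0 "norm (q - p)" 2] by (simp add: norm_prod_def)
  moreover have "(fst (q - p))\<^sup>2 \<le> (snd (q - p))\<^sup>2"
    using a power_mono[of "\<bar>fst (q - p)\<bar>" "snd (q - p)" 2] by simp
  ultimately have "(2588/10000)\<^sup>2 < (snd (q - p))\<^sup>2"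
    using d0_sq sqrt3_bounds by (simp add: power2_eq_square)
  moreover have "0 \<le> snd (q - p)" using a by linarith
  ultimately show ?thesis using power_less_imp_less_base[of "(2588/10000)" 2 "snd (q - p)"] by simp
qed

lemma up_shift: "up p q \<Longrightarrow> up (p + rv z) (q + rv z)"
  using shift by (auto simp: up_def)

lemma chain_shift: "(up ^^ n) p q \<Longrightarrow> (up ^^ n) (p + rv z) (q + rv z)"
proof (induction n arbitrary: q)
  case (Suc n)
  then show ?case by (auto intro: up_shift elim!: relcomppE intro!: relcomppI)
qed simp

lemma chain_height: "(up ^^ n) p q \<Longrightarrow> real n * (2588/10000) \<le> snd q - snd p"
proof (induction n arbitrary: q)
  case (Suc n)
  then obtain r where "(up ^^ n) p r" "up r q" by auto
  then show ?case using Suc.IH[of r] up_height[of r q] by (simp add: field_simps)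
qed simp

end

lemma rv_Pair: "rv (a, b) = (of_int a, of_int b)"
  by (simp add: rv_def)

text \<open>A chain of upward steps that rises by \<open>m\<close> has at most \<open>3.86 m\<close> steps. The potential below needs at most
  \<open>3 m\<close> steps, and 7 steps for \<open>m = 2\<close> are the only case that this estimate leaves open.\<close>

lemma no_seven_chain_real:
  fixes x y :: "nat \<Rightarrow> real" and k :: int
  assumes per: "\<And>n. x (n + 7) = x n + of_int k" "\<And>n. y (n + 7) = y n + 2"
    and up: "\<And>n. (2588/10000) < y (Suc n) - y n" "\<And>n. \<bar>x (Suc n) - x n\<bar> \<le> y (Suc n) - y n"
    and sep: "\<And>n j. (1339/10000) \<le> (x (n + 4) - x n - of_int j)\<^sup>2 + (y (n + 4) - y n - 1)\<^sup>2"
  obtains "k = 1 \<or> k = - 1"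
    "\<And>n. (2896/10000) \<le> of_int k * (x (n + 4) - x n) \<and> of_int k * (x (n + 4) - x n) \<le> (7104/10000)"
    "\<And>n. (10352/10000) \<le> y (n + 4) - y n \<and> y (n + 4) - y n \<le> (12236/10000)"
    "\<And>n. (1294/1000) \<le> y (n + 5) - y n"
proof -
  define T where "T n = x (n + 4) - x n" for n
  have u: "(2588/10000) < y (m + 1) - y m" "\<bar>x (m + 1) - x m\<bar> \<le> y (m + 1) - y m" for m using up[of m] by auto
  have four: "(10352/10000) \<le> y (n + 4) - y n" "\<bar>T n\<bar> \<le> y (n + 4) - y n"
    and three: "(7764/10000) \<le> y (n + 3) - y n" "\<bar>x (n + 3) - x n\<bar> \<le> y (n + 3) - y n"
    and five: "(1294/1000) \<le> y (n + 5) - y n" for n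
    using u[of n] u[of "n+1"] u[of "n+2"] u[of "n+3"] u[of "n+4"]
    by (simp_all add: T_def add.commute numeral_eq_Suc)
  have p3: "y (n + 4 + 3) = y n + 2" "x (n + 4 + 3) = x n + of_int k" for n
    using per[of n] by (simp_all add: add.commute)
  have p4: "y (n + 3 + 4) = y n + 2" "x (n + 3 + 4) = x n + of_int k" for n
    using per[of n] by (simp_all add: add.commute)
  \<comment> \<open>Four and three consecutive steps together rise by exactly 2, so the lower bound
    for one part is an upper bound for the other.\<close>
  have four': "y (n + 4) - y n \<le> (12236/10000)" for n
    using three(1)[of "n + 4"] p3[of n] by simp
  have three': "y (n + 3) - y n \<le> (9648/10000)" for n
    using four(1)[of "n + 3"] p4[of n] by simp
  \<comment> \<open>Lowered by 1, the point \<open>n + 4\<close> is between 0.0352 and 0.2236 higher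
    than the point \<open>n\<close>. Its horizontal distance from every horizontal translate of that
    point is therefore at least the root of 0.1339 - 0.2236^2, which exceeds 0.2896.\<close>
  have gap: "(2896/10000) \<le> \<bar>T n - of_int j\<bar>" for n j
  proof (rule ccontr)
    assume "\<not> (2896/10000) \<le> \<bar>T n - of_int j\<bar>"
    then have "\<bar>T n - of_int j\<bar>\<^sup>2 < (2896/10000)\<^sup>2"
      by (intro power_strict_mono) auto
    moreover have "(y (n + 4) - y n - 1)\<^sup>2 \<le> (2236/10000)\<^sup>2"
      using four(1)[of n] four'[of n] by (intro power_mono) auto
    ultimately show False using sep[of n j] by (simp add: T_def power2_eq_square)
  qed
  have T: "(2896/10000) \<le> \<bar>T n\<bar>" for n
    using gap[of n 0] by simp
  have T': "\<bar>T n\<bar> \<le> (7104/10000)" for n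
  proof -
    have "(2896/10000) \<le> \<bar>T n - 1\<bar>" "(2896/10000) \<le> \<bar>T n + 1\<bar>"
      using gap[of n 1] gap[of n "-1"] by simp_all
    then show ?thesis using four(2)[of n] four'[of n] by linarith
  qed
  have S: "x (n + 3) - x n = of_int k - T (n + 3)" for n
    using p4[of n] by (simp add: T_def)
  \<comment> \<open>\<open>k - T n\<close> is the displacement of the complementary three steps. It
    is below 1 in absolute value and keeps the same gap from all integers.\<close>
  have S': "\<bar>of_int k - T n\<bar> \<le> (7104/10000)" for n
  proof -
    have "x (n + 4 + 3) - x (n + 4) = of_int k - T n" using p3[of n] by (simp add: T_def)
    moreover have "\<bar>x (n + 4 + 3) - x (n + 4)\<bar> \<le> (9648/10000)"
      using three(2)[of "n + 4"] three'[of "n + 4"] by simp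
    ultimately show ?thesis using gap[of n k] gap[of n "k + 1"] gap[of n "k - 1"]
      by (simp only: of_int_add of_int_diff of_int_1)
  qed
  have kb: "\<bar>of_int k :: real\<bar> < 2" using T'[of 0] S'[of 0] by linarith
  then have "k \<in> {-1, 0, 1}" by auto
  moreover have "k \<noteq> 0"
  proof
    assume k0: "k = 0"
    \<comment> \<open>The sum of the two displacements covers eight steps, which is one step more
      than a period. A single step rises by at most 2 - 6 * 0.2588 = 0.4472, less than twice 0.2896,
      so the two cannot have the same sign.\<close>
    have alt: "T (n + 4) < 0 \<longleftrightarrow> 0 < T n" for n
    proof -
      have "T n + T (n + 4) = x (n + 1) - x n"
        using per(1)[of "n + 1"] k0 by (simp add: T_def add.commute)
      moreover have "y (n + 1) - y n \<le> (4472/10000)"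
        using u(1)[of "n+1"] u(1)[of "n+2"] u(1)[of "n+3"] u(1)[of "n+4"] u(1)[of "n+5"] u(1)[of "n+6"] per(2)[of n]
        by (simp add: numeral_eq_Suc)
      ultimately have "\<bar>T n + T (n + 4)\<bar> \<le> (4472/10000)" using u(2)[of n] by simp
      then show ?thesis using T[of n] T[of "n + 4"] by linarith
    qed
    have tp: "T (n + 7) = T n" for n
      using per(1)[of n] per(1)[of "n + 4"] by (simp add: T_def add.commute add.left_commute)
    \<comment> \<open>28 is both four periods of 7 and seven strides of 4. Seven sign changes, an
      odd number, would have to restore the sign.\<close>
    have "T 28 = T 0" using tp[of 0] tp[of 7] tp[of 14] tp[of 21] by simp
    moreover have nz: "T n \<noteq> 0" for n using T[of n] by auto
    moreover have "0 < T (n + 8) \<longleftrightarrow> 0 < T n" for n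
    proof -
      have "n + 4 + 4 = n + 8" by simp
      with alt[of "n + 4"] have "T (n + 8) < 0 \<longleftrightarrow> 0 < T (n + 4)" by metis
      then show ?thesis using alt[of n] nz[of "n + 8"] nz[of "n + 4"] by linarith
    qed
    from this[of 0] this[of 8] this[of 16] have "0 < T 24 \<longleftrightarrow> 0 < T 0" by simp
    ultimately show False
      using alt[of 24] nz[of 0] by auto
  qed
  ultimately have k: "k = 1 \<or> k = - 1" by auto
  show thesis
  proof (rule that)
    show "k = 1 \<or> k = - 1" by (rule k)
    show "(2896/10000) \<le> of_int k * (x (n + 4) - x n) \<and> of_int k * (x (n + 4) - x n) \<le> (7104/10000)" for n
      using k T[of n] T'[of n] S'[of n] unfolding T_def[symmetric] by (elim disjE) (auto simp: abs_if split: if_splits)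
    show "(10352/10000) \<le> y (n + 4) - y n \<and> y (n + 4) - y n \<le> (12236/10000)" for n
      using four(1)[of n] four'[of n] by simp
    show "(1294/1000) \<le> y (n + 5) - y n" for n by (rule five)
  qed
qed

text \<open>An entry consists of the starting point, the number of steps, a translation and a cone,
  for a chain closed by \<open>(1, 2)\<close>. Single steps are steep. Four steps less one vertical
  period are flat and point right, or left after subtracting a horizontal period too. Of five steps
  less a period it is only used that they point upwards.\<close>

definition spec7 :: "(nat \<times> nat \<times> vec \<times> cone) list" where
  "spec7 = [(i, s, z, c). (s, z, c) \<leftarrow>
     [(1, (0, 0), ((235, 235), (-235, 235))),
      (4, (0, -1), ((332, 0), (235, 235))),
      (4, (-1, -1), ((-235, 235), (-332, 0))),
      (5, (0, -1), ((332, 0), (-332, 0))),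
      (5, (-1, -1), ((332, 0), (-332, 0)))], i \<leftarrow> [0, 1, 2, 3, 4, 5, 6]]"

text \<open>Each wrap of the index modulo 7 contributes the translation \<open>(1, 2)\<close> of the
  whole chain.\<close>

definition edge7 :: "nat \<Rightarrow> nat \<Rightarrow> vec \<Rightarrow> edge" where
  "edge7 i s z = (int (i mod 7), int ((i + s) mod 7), fst z + int ((i + s) div 7), snd z + 2 * int ((i + s) div 7))"

definition "edges7 = map (\<lambda>(i, s, z, c). edge7 i s z) spec7"
definition "cones7 = map (\<lambda>(i, s, z, c). c) spec7"

definition tree7 :: tree where
  "tree7 =
Split 3 86 321 (Split 4 0 332 (Split 5 164 289 (Split 13 289 164 (Split 2 0 332 (Split 6 (-164)
289 (Split 6 86 321 (Split 17 (-289) 164 (Split 1 (-164) 289 (Split 0 (-164) 289 (Leaf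
[0,1,6,1,1,6,2,1,6,17,1,6]) (Split 0 (-203) 263 (Leaf
[0,-3,5,1,-3,5,2,-3,5,3,1,2,4,1,2,5,1,2,6,1,2,17,-4,3]) (Leaf [0,-3,3,1,-3,3,2,-3,3,17,-3,3])))
(Leaf [0,-5,7,1,-5,7,2,-5,7,3,1,2,4,1,2,5,1,2,6,1,2,17,-6,5])) (Leaf
[3,3,5,4,3,5,5,3,5,6,3,5,17,-3,-5])) (Leaf
[0,0,14,1,0,14,2,5,12,3,6,11,4,5,12,5,5,12,6,-1,15,13,1,-1,14,-1,1,16,-5,2])) (Split 16 (-289) 164
(Split 3 203 263 (Leaf [3,3,-1,6,-3,1,13,3,-1,14,-3,1]) (Leaf
[0,-7,11,1,-7,11,2,2,4,3,2,4,4,1,4,5,1,4,6,-8,11,14,-1,0,16,-9,7])) (Leaf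
[0,0,1,1,0,1,2,3,5,3,3,5,4,2,5,5,2,5,6,-1,1,14,-1,0,16,-3,-4]))) (Split 6 0 332 (Split 2 (-164)
289 (Leaf [0,0,6,1,0,6,2,-2,7,3,2,6,4,2,6,5,4,5,6,2,5,13,2,0,17,-2,1,19,-2,1]) (Leaf
[0,0,6,1,0,6,2,-7,9,3,4,10,4,4,10,5,11,7,6,2,5,13,9,2,17,-2,1,19,-7,3])) (Split 4 86 321 (Split 6
(-164) 289 (Leaf [0,-2,7,1,-2,7,2,-3,7,3,5,9,4,5,9,5,6,9,6,-2,7,13,8,2,19,-1,0]) (Leaf
[0,-2,3,1,-2,3,2,-2,3,3,2,4,4,2,4,5,2,4,6,-2,3,13,4,1])) (Leaf
[0,0,2,1,0,2,2,-1,2,3,-1,2,4,-2,2,5,-1,2,6,-1,2,14,-1,0,19,-1,0])))) (Split 4 164 289 (Leaf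
[3,2,4,4,2,4,5,2,4,13,2,4]) (Leaf [3,1,3,4,1,3,5,1,3,13,1,3]))) (Split 0 0 332 (Split 1 86 321
(Split 5 0 332 (Split 6 0 332 (Split 2 (-164) 289 (Leaf
[0,1,3,1,1,3,2,1,3,3,1,3,4,1,3,5,1,3,6,1,3]) (Split 17 (-289) 164 (Split 6 164 289 (Leaf
[0,-5,8,1,-5,8,2,-6,8,3,1,3,4,1,3,5,1,3,6,2,3,9,1,0,17,-7,5]) (Leaf
[0,-6,8,1,-6,8,2,-6,8,3,1,3,4,1,3,5,1,3,6,1,3,17,-7,5])) (Split 6 164 289 (Leaf
[0,0,1,1,0,1,2,-1,1,3,1,3,4,1,3,5,2,3,6,2,3,17,-2,-2,19,-1,0]) (Leaf
[0,-1,1,1,-1,1,2,-1,1,3,1,4,4,1,4,5,1,4,6,1,4,17,-2,-3])))) (Split 2 (-86) 321 (Leaf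
[0,1,4,1,1,4,2,1,4,3,1,4,4,-2,5,5,-2,5,6,-2,5,14,-3,1]) (Split 13 289 164 (Leaf
[0,-2,3,1,-2,3,2,-2,3,3,1,4,4,1,4,5,1,4,6,-2,3,13,3,1]) (Leaf [3,1,3,4,1,3,5,1,3,13,1,3]))))
(Split 6 86 321 (Split 0 86 321 (Split 9 289 164 (Split 5 (-164) 289 (Split 2 0 332 (Leaf
[0,2,4,1,2,4,2,2,4,3,2,4,4,2,4,5,2,4,6,2,4]) (Split 2 (-164) 289 (Leaf
[0,1,2,1,1,2,2,-2,6,3,-2,6,4,-2,6,5,-2,6,6,1,2,9,3,-4]) (Leaf
[0,2,4,1,2,4,2,-2,3,3,-2,3,4,-2,3,5,-2,3,6,2,4,9,4,1]))) (Split 2 0 332 (Split 20 (-289) 164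
(Split 1 203 263 (Leaf [1,3,-1,2,1,2,3,1,2,4,1,2,5,-2,3,9,2,-3,15,-3,1]) (Leaf
[0,1,2,1,1,2,2,1,2,3,-4,6,4,-4,6,5,-4,6,6,1,2,20,-5,4])) (Leaf
[0,3,5,1,3,5,2,3,5,6,3,5,20,-3,-5])) (Leaf
[0,2,4,1,2,4,2,-2,3,3,-2,3,4,-2,3,5,-2,3,6,2,4,9,4,1]))) (Leaf [0,2,4,1,2,4,6,2,4,9,2,4])) (Leaf
[0,-3,4,1,0,3,2,0,3,3,1,3,4,1,3,5,-2,4,6,-2,4,15,-3,1,17,-1,0])) (Leaf
[0,-2,4,1,0,3,2,0,3,3,0,3,4,0,3,5,-2,4,6,-2,4,15,-2,1]))) (Split 5 (-164) 289 (Split 6 86 321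
(Split 2 86 321 (Split 5 0 332 (Split 1 (-164) 289 (Leaf
[0,1,3,1,1,3,2,1,3,3,1,3,4,1,3,5,1,3,6,1,3]) (Split 18 (-289) 164 (Split 4 164 289 (Leaf
[0,1,3,1,-6,8,2,-5,8,3,-5,8,4,2,3,5,1,3,6,1,3,12,1,0,18,-7,5]) (Leaf
[0,1,3,1,-6,8,2,-6,8,3,-6,8,4,1,3,5,1,3,6,1,3,18,-7,5])) (Split 4 164 289 (Leaf
[0,1,3,1,-1,1,2,0,1,3,0,1,4,2,3,5,2,3,6,1,3,16,-1,0,18,-2,-2]) (Leaf
[0,1,4,1,-1,1,2,-1,1,3,-1,1,4,1,4,5,1,4,6,1,4,18,-2,-3])))) (Split 4 86 321 (Split 12 289 164
(Split 1 (-164) 289 (Split 1 0 332 (Leaf [0,1,4,1,1,4,2,2,3,3,2,3,4,2,3,5,1,4,6,1,4,12,1,-1])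
(Leaf [0,-2,6,1,-2,6,2,1,2,3,1,2,4,1,2,5,-2,6,6,-2,6,12,3,-4])) (Leaf
[0,-2,3,1,-2,3,2,2,4,3,2,4,4,2,4,5,-2,3,6,-2,3,12,4,1])) (Leaf [2,2,4,3,2,4,4,2,4,12,2,4])) (Leaf
[0,-1,3,1,-1,3,2,-1,3,3,-1,3,4,-1,3,5,-1,3,6,-1,3]))) (Leaf
[0,0,3,1,-1,4,2,-1,4,3,-1,4,4,0,3,5,0,3,6,0,3,18,-1,1])) (Leaf
[0,-1,4,1,-1,4,2,0,3,3,0,3,4,0,3,5,0,3,6,-1,4,16,-1,1])) (Split 2 86 321 (Split 12 289 164 (Split
1 0 332 (Split 14 (-289) 164 (Leaf
[0,1,6,1,1,6,2,4,7,3,4,7,4,-7,16,5,-10,15,6,-10,15,12,3,1,14,-11,9]) (Leaf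
[0,2,6,1,2,6,2,3,5,3,3,5,5,-1,1,6,-1,1,12,1,-1,14,-3,-5])) (Leaf
[0,-2,4,1,-2,4,2,3,5,3,2,5,4,2,5,5,-3,4,6,-2,4,12,5,1,20,-1,0])) (Leaf
[2,7,12,3,5,13,4,5,13,5,-2,1,12,7,12,20,-2,1])) (Leaf
[0,-2,3,1,-2,3,2,-2,3,3,-2,3,4,-2,3,5,-2,3,6,-2,3])))) (Leaf
[0,-3,6,1,0,5,2,0,5,3,2,4,4,2,4,5,-1,5,6,-1,5,15,-3,1,17,-2,1]))) (Split 0 164 289 (Split 6 86 321
(Split 5 86 321 (Split 1 86 321 (Leaf
[0,3,2,1,3,2,2,0,3,3,0,3,4,-2,4,5,1,3,6,1,3,14,-2,1,19,-3,1]) (Split 8 289 164 (Split 1 (-164) 289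
(Split 4 (-164) 289 (Leaf [0,7,10,1,-1,8,2,-1,8,3,-1,8,4,-2,9,5,6,11,6,6,11,8,8,2,14,-1,1]) (Leaf
[0,10,8,1,-1,5,2,-1,5,3,-1,5,4,-6,7,5,5,10,6,5,10,8,11,3,14,-5,2])) (Leaf
[0,2,4,1,-2,3,2,-2,3,3,-2,3,4,-2,3,5,2,4,6,2,4,8,4,1])) (Leaf [0,2,4,5,2,4,6,2,4,8,2,4]))) (Leaf
[0,0,3,1,0,3,2,0,3,3,-2,4,4,-2,4,5,-2,4,6,0,3,20,-2,1])) (Leaf
[0,0,3,1,0,3,2,0,3,3,0,3,4,-2,4,5,-2,4,6,-2,4,14,-2,1])) (Split 1 86 321 (Split 2 86 321 (Split 11
289 164 (Split 4 (-164) 289 (Split 0 0 332 (Leaf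
[0,1,5,1,2,4,2,2,4,3,2,4,4,0,5,5,0,5,6,0,5,11,1,-1,14,-1,0]) (Split 0 (-164) 289 (Leaf
[0,-2,6,1,1,2,2,1,2,3,1,2,4,-2,6,5,-2,6,6,-2,6,11,3,-4]) (Leaf
[0,-2,3,1,2,4,2,2,4,3,2,4,4,-2,3,5,-2,3,6,-2,3,11,4,1]))) (Split 0 0 332 (Split 14 (-289) 164
(Split 0 47 329 (Leaf [0,1,2,1,1,2,2,1,2,3,1,2,4,-4,5,5,-4,5,6,-4,5,14,-5,3]) (Leaf
[0,0,2,1,1,2,2,1,2,3,1,2,4,-4,5,5,-4,5,6,-4,5,11,1,0,14,-4,3])) (Leaf
[0,3,5,1,3,5,2,3,5,3,3,5,14,-3,-5])) (Leaf
[0,-2,3,1,2,4,2,2,4,3,2,4,4,-2,3,5,-2,3,6,-2,3,11,4,1]))) (Leaf [1,2,4,2,2,4,3,2,4,11,2,4])) (Leaf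
[0,0,3,1,0,3,2,-2,4,3,-2,4,4,-2,4,5,0,3,6,0,3,19,-2,1])) (Split 0 86 321 (Split 1 (-86) 321 (Split
8 289 164 (Split 4 (-164) 289 (Leaf [0,0,4,1,0,4,2,0,4,3,0,4,4,0,4,5,0,4,6,0,4]) (Split 14 (-289)
164 (Leaf [0,1,2,1,0,2,2,0,2,3,0,2,4,-3,4,5,-2,4,6,-2,4,8,1,0,14,-3,2]) (Leaf
[0,1,3,1,0,3,2,0,3,3,0,3,4,-1,2,5,0,2,6,0,2,8,1,0,14,-1,-1]))) (Leaf [0,0,3,5,0,3,6,0,3,8,0,3]))
(Leaf [0,-3,5,1,-3,5,2,-3,5,3,-2,5,4,-2,5,5,-2,5,6,-2,5,17,-1,0])) (Leaf
[0,-1,3,1,-1,3,2,-1,3,3,-1,3,4,-1,3,5,-1,3,6,-1,3]))))) (Split 0 164 289 (Split 1 0 332 (Split 2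
86 321 (Split 6 (-86) 321 (Split 6 86 321 (Leaf
[0,4,5,1,2,6,2,2,6,3,-2,8,4,0,7,5,0,7,6,4,5,18,-2,1,20,-4,2]) (Split 3 (-86) 321 (Leaf
[0,1,3,1,1,3,2,1,3,3,0,3,4,0,3,5,0,3,6,0,3,10,1,0]) (Split 10 289 164 (Split 3 (-164) 289 (Leaf
[0,2,3,1,1,3,2,1,3,3,-1,3,4,0,3,5,0,3,6,0,3,10,2,0,18,-1,0]) (Leaf
[0,5,4,1,2,5,2,2,5,3,-3,4,4,0,3,5,0,3,6,0,3,10,5,1,18,-3,1])) (Leaf
[0,5,7,1,3,8,2,3,8,3,-2,4,4,0,3,5,0,3,6,0,3,10,5,4,18,-2,1])))) (Split 10 321 86 (Leaf
[3,-1,3,4,-1,3,5,-1,3,6,-1,3,10,1,-3]) (Split 1 86 321 (Split 10 289 164 (Split 3 0 332 (Split 14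
(-289) 164 (Split 6 (-203) 263 (Leaf
[0,3,5,1,3,5,2,3,5,3,1,4,4,-3,7,5,-3,7,6,-3,7,10,2,1,14,-4,3]) (Leaf
[0,1,2,1,1,2,2,1,2,3,0,1,4,-5,5,5,-5,5,6,-5,5,10,1,1,14,-5,4])) (Leaf
[0,3,5,1,3,5,2,3,5,3,3,5,14,-3,-5])) (Leaf
[0,6,11,1,6,11,2,6,11,3,-4,7,4,-4,7,5,-4,7,6,-4,7,10,10,4])) (Leaf [0,2,4,1,2,4,2,2,4,10,2,4]))
(Leaf [0,-2,2,1,-2,2,2,0,1,3,0,1,4,0,1,5,0,1,6,-2,2,16,-2,1])))) (Split 6 (-86) 321 (Split 2 0 332
(Leaf [0,2,8,1,-1,9,2,-1,9,3,-3,10,4,0,9,5,0,9,6,2,8,18,-3,1,20,-2,1]) (Leaf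
[0,0,2,1,-2,3,2,-2,3,3,-2,3,4,0,2,5,0,2,6,0,2,18,-2,1])) (Leaf
[0,-2,3,1,-2,3,2,-2,3,3,-2,3,4,-2,3,5,-2,3,6,-2,3]))) (Leaf
[0,0,3,1,-2,4,2,-2,4,3,-2,4,4,0,3,5,0,3,6,0,3,18,-2,1])) (Split 5 0 332 (Split 6 164 289 (Split 0
(-164) 289 (Split 4 86 321 (Split 5 86 321 (Split 7 289 164 (Split 0 86 321 (Leaf
[0,5,4,1,0,6,2,0,6,3,-2,7,4,3,5,5,3,5,6,5,4,18,-5,2,20,-2,1]) (Split 3 (-164) 289 (Split 3 (-86)
321 (Leaf [0,0,5,1,0,5,2,0,5,3,0,5,4,3,6,5,3,6,6,3,6,7,3,1]) (Leaf
[0,-1,6,1,-1,6,2,-1,6,3,-2,6,4,4,7,5,4,7,6,5,7,7,6,1,20,-1,0])) (Leaf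
[0,-1,5,1,-1,5,2,-1,5,3,-6,7,4,5,10,5,5,10,6,10,8,7,11,3,20,-5,2]))) (Leaf
[4,2,4,5,2,4,6,2,4,7,2,4])) (Leaf [0,0,4,1,0,4,2,0,4,3,-1,5,4,-1,5,5,-1,5,6,0,4,20,-1,1])) (Leaf
[0,0,4,1,0,4,2,0,4,3,-1,4,4,-1,4,5,-1,4,6,0,4,20,-1,0])) (Split 4 86 321 (Split 7 289 164 (Split 3
0 332 (Split 15 (-289) 164 (Split 0 (-203) 263 (Leaf
[0,-3,5,1,0,2,2,0,2,3,0,2,4,1,2,5,-2,5,6,-2,5,7,1,0,15,-3,3]) (Leaf
[0,-3,3,5,-3,3,6,-3,3,15,-3,3])) (Leaf
[0,-2,3,1,0,5,2,0,5,3,1,5,4,3,5,5,1,3,6,1,3,7,2,0,15,-2,-2,17,-1,0])) (Leaf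
[0,-3,4,1,-2,4,2,-2,4,3,-2,4,4,3,5,5,2,5,6,2,5,7,5,1,15,-1,0])) (Leaf
[0,-2,1,4,7,12,5,5,13,6,5,13,7,7,12,15,-2,1])) (Leaf
[0,-3,4,1,-3,4,2,-3,4,3,-3,4,4,-3,4,5,-3,4,6,-3,4]))) (Split 4 (-86) 321 (Split 10 289 164 (Split
3 (-164) 289 (Split 6 (-86) 321 (Split 0 (-86) 321 (Leaf
[0,1,8,1,0,8,2,0,8,3,0,8,4,1,8,5,1,8,6,1,8,18,-1,0]) (Leaf
[0,-2,3,1,0,2,2,0,2,3,0,2,4,0,2,5,-2,3,6,-2,3,15,-2,1])) (Leaf
[0,-2,3,1,0,2,2,0,2,3,0,2,4,0,2,5,-2,3,6,-2,3,15,-2,1])) (Split 6 0 332 (Split 7 289 164 (Split 0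
0 332 (Split 18 (-289) 164 (Leaf [0,1,4,1,-7,10,2,-7,10,3,-7,10,4,1,4,5,1,4,6,1,4,18,-8,6]) (Leaf
[0,1,4,1,-1,1,2,-1,1,3,-1,1,4,1,4,5,1,4,6,1,4,18,-2,-3])) (Leaf
[0,-2,3,1,-2,3,2,-2,3,3,-2,3,4,1,4,5,1,4,6,1,4,7,3,1])) (Leaf [4,1,4,5,1,4,6,1,4,7,1,4])) (Leaf
[0,-1,4,1,-1,4,2,-1,4,3,-3,4,4,-3,4,5,-3,4,6,-3,4,10,2,0]))) (Leaf
[0,-1,3,1,-1,3,2,-1,3,10,-1,3])) (Leaf
[0,0,1,1,0,1,2,-2,2,3,-4,3,4,-4,3,5,-2,2,6,0,1,19,-2,1,20,-2,1]))) (Leaf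
[0,-1,3,1,0,3,2,0,3,3,-1,4,4,-1,4,5,-2,4,6,-1,3,15,-1,0,20,-1,1])))"

lemma check7: "check edges7 [] cones7 tree7"
  by code_simp


lemma in_cone_iff:
  "in_cone ((a, b), (c, e)) (u, v) \<longleftrightarrow>
     0 \<le> of_int a * v - of_int b * u \<and> 0 \<le> u * of_int e - v * of_int c"
  by (simp add: in_cone_def crossr_def rv_def)

context packing
begin

text \<open>The real estimates leave horizontal offset 1 or -1 and confine the differences of the
  points to the cones of \<open>spec7\<close>, which the tree refutes.\<close>

lemma no_seven_chain: "\<not> (up ^^ 7) p (p + rv (k, 2))"
proof
  assume "(up ^^ 7) p (p + rv (k, 2))"
  then obtain f where f: "f 0 = p" "f 7 = p + rv (k, 2)" "\<And>i. i < 7 \<Longrightarrow> up (f i) (f (Suc i))"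
    unfolding relpowp_fun_conv by auto
  \<comment> \<open>Periodic continuation to all indices, so that each estimate holds for every
    cyclic shift of the chain.\<close>
  define q where "q n = f (n mod 7) + rv (k * int (n div 7), 2 * int (n div 7))" for n
  have per: "q (n + 7) = q n + rv (k, 2)" for n
    by (simp add: q_def rv_Pair algebra_simps)
  have step: "up (q n) (q (Suc n))" for n
  proof -
    have "up (f (n mod 7)) (f (Suc (n mod 7)))" by (rule f(3)) simp
    then have u: "up (q n) (f (Suc (n mod 7)) + rv (k * int (n div 7), 2 * int (n div 7)))"
      unfolding q_def by (rule up_shift)
    have "q (Suc n) = f (Suc (n mod 7)) + rv (k * int (n div 7), 2 * int (n div 7))"
    proof (cases "Suc (n mod 7) = 7")
      case True
      then have "Suc n mod 7 = 0" "Suc n div 7 = Suc (n div 7)" by (auto simp: mod_Suc div_Suc)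
      then show ?thesis using True f(1,2) by (simp add: q_def rv_Pair algebra_simps)
    next
      case False
      then have "Suc n mod 7 = Suc (n mod 7)" "Suc n div 7 = n div 7" by (auto simp: mod_Suc div_Suc)
      then show ?thesis by (simp add: q_def)
    qed
    then show ?thesis using u by simp
  qed
  have qP: "q n \<in> P" for n using step[of n] by (simp add: up_def)
  define x y where "x n = fst (q n)" and "y n = snd (q n)" for n
  have perx: "x (n + 7) = x n + of_int k" and pery: "y (n + 7) = y n + 2" for n
    by (simp_all add: x_def y_def per rv_Pair)
  have upx: "(2588/10000) < y (Suc n) - y n" "\<bar>x (Suc n) - x n\<bar> \<le> y (Suc n) - y n" for n
    using step[of n] up_height[OF step[of n]] by (auto simp: up_def x_def y_def)
  have far: "d0 \<le> norm (x m - x n - of_int a, y m - y n - of_int b)" if "y m \<noteq> y n + of_int b" for m n a b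
  proof -
    have "q m \<noteq> q n + rv (a, b)" using that by (auto simp: y_def rv_Pair)
    from sep[OF shift[OF qP] qP this[symmetric]] show ?thesis
      by (simp add: x_def y_def rv_Pair norm_prod_def algebra_simps)
  qed
  have y4: "y n + 1 < y (n + 4)" for n
    using upx(1)[of n] upx(1)[of "n+1"] upx(1)[of "n+2"] upx(1)[of "n+3"] by (simp add: numeral_eq_Suc)
  have sep4: "(1339/10000) \<le> (x (n + 4) - x n - of_int j)\<^sup>2 + (y (n + 4) - y n - 1)\<^sup>2" for n j
  proof -
    have "d0 \<le> norm (x (n + 4) - x n - of_int j, y (n + 4) - y n - of_int 1)"
      using y4[of n] by (intro far) auto
    then have "d0\<^sup>2 \<le> (x (n + 4) - x n - of_int j)\<^sup>2 + (y (n + 4) - y n - 1)\<^sup>2"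
      using d0_pos power_mono[of d0 "norm (x (n + 4) - x n - of_int j, y (n + 4) - y n - of_int 1)" 2]
      by (simp add: norm_prod_def)
    then show ?thesis using d0_sq sqrt3_bounds by simp
  qed
  obtain k1: "k = 1 \<or> k = - 1"
    and T: "\<And>n. (2896/10000) \<le> of_int k * (x (n + 4) - x n) \<and> of_int k * (x (n + 4) - x n) \<le> (7104/10000)"
    and four: "\<And>n. (10352/10000) \<le> y (n + 4) - y n \<and> y (n + 4) - y n \<le> (12236/10000)"
    and five: "\<And>n. (1294/1000) \<le> y (n + 5) - y n"
    using no_seven_chain_real[of x k y, OF perx pery upx sep4] by blast
  \<comment> \<open>Mirroring for \<open>k = -1\<close> turns the total translation into
    \<open>(1, 2)\<close>, so one tree serves both signs.\<close>
  define c where "c v = (of_int k * x (nat v), y (nat v))" for v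
  have kk: "real_of_int k * of_int k = 1" using k1 by auto
  have ev: "edge_vec c (edge7 i s z) = (of_int k * (x (i + s) - x i) + of_int (fst z), y (i + s) - y i + of_int (snd z))"
    if "i < 7" "s < 7" for i s z
  proof -
    have xy: "x (i + s) = x ((i + s) mod 7) + of_int k * real ((i + s) div 7) \<and>
      y (i + s) = y ((i + s) mod 7) + 2 * real ((i + s) div 7)"
    proof (cases "i + s < 7")
      case False
      then have "i + s = (i + s - 7) + 7" "(i + s) mod 7 = i + s - 7" "(i + s) div 7 = 1"
        using that by (auto simp: mod_if div_if)
      then show ?thesis
        using perx[of "i + s - 7"] pery[of "i + s - 7"] by simp
    qed simp
    have "of_int k * x (i + s) = of_int k * x ((i + s) mod 7) + real ((i + s) div 7)"
      "y (i + s) = y ((i + s) mod 7) + 2 * real ((i + s) div 7)"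
      by (simp_all add: xy distrib_left kk mult.assoc[symmetric])
    then show ?thesis
      using that by (simp add: edge_vec_def edge7_def c_def rv_def algebra_simps nat_int_add[symmetric] del: of_nat_add)
  qed
  have normk: "norm (of_int k * a, b) = norm (a, b)" for a b :: real
    using k1 by (auto simp: norm_prod_def)
  have sp: "\<exists>i s z. e = (i, s, z, w) \<and> i < 7 \<and> s < 7 \<and> in_cone w (edge_vec c (edge7 i s z)) \<and>
      d0 \<le> norm (edge_vec c (edge7 i s z))" if "(i, s, z, w) \<in> set spec7" "e = (i, s, z, w)" for e i s z w
  proof -
    have cs: "i < 7" "(s, z, w) \<in> {(1, (0, 0), ((235, 235), (-235, 235))),
      (4, (0, -1), ((332, 0), (235, 235))),
      (4, (-1, -1), ((-235, 235), (-332, 0))),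
      (5, (0, -1), ((332, 0), (-332, 0))),
      (5, (-1, -1), ((332, 0), (-332, 0)))}"
      using that(1) by (auto simp: spec7_def)
    then have s7: "s < 7" by auto
    have yb: "y (i + s) - y i + of_int (snd z) > 0"
      using cs(2) upx(1)[of i] four[of i] five[of i] by auto
    have "d0 \<le> norm (x (i + s) - x i + of_int k * of_int (fst z), y (i + s) - y i + of_int (snd z))"
      using far[of "i + s" i "- snd z" "- (k * fst z)"] yb by simp
    also have "\<dots> = norm (of_int k * (x (i + s) - x i + of_int k * of_int (fst z)), y (i + s) - y i + of_int (snd z))"
      by (rule normk[symmetric])
    also have "of_int k * (x (i + s) - x i + of_int k * of_int (fst z)) = of_int k * (x (i + s) - x i) + of_int (fst z)"
      by (simp add: distrib_left mult.assoc[symmetric] kk)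
    finally have n: "d0 \<le> norm (edge_vec c (edge7 i s z))" unfolding ev[OF cs(1) s7] .
    have ks: "\<bar>of_int k * (x (Suc i) - x i)\<bar> \<le> y (Suc i) - y i"
      using upx(2)[of i] k1 by auto
    have "in_cone w (edge_vec c (edge7 i s z))"
      unfolding ev[OF cs(1) s7] using cs(2) ks T[of i] four[of i] five[of i]
      by (elim insertE emptyE) (simp_all add: in_cone_iff, linarith+)
    then show ?thesis using n cs(1) s7 that(2) by blast
  qed
  have "holds c edges7 cones7"
    unfolding holds_def edges7_def cones7_def list.rel_map
    by (rule list.rel_refl_strong) (use sp in fastforce)
  moreover have "\<And>e. e \<in> set edges7 \<Longrightarrow> d0 \<le> norm (edge_vec c e)"
    unfolding edges7_def using sp by fastforce
  moreover have "short_cones cones7" "wf_edges edges7"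
    by code_simp+
  ultimately show False using check_sound[OF check7] by blast
qed

end

subsection \<open>The grid with a vacancy\<close>

lemma int_set_has_max:
  fixes S :: "int set"
  assumes "S \<noteq> {}" "\<And>x. x \<in> S \<Longrightarrow> x \<le> u"
  shows "\<exists>m\<in>S. \<forall>x\<in>S. x \<le> m"
proof -
  obtain x0 where x0: "x0 \<in> S" using assms(1) by blast
  define T where "T = S \<inter> {x0..u}"
  have T: "finite T" "T \<noteq> {}" using x0 assms(2) by (auto simp: T_def)
  have "Max T \<in> S" using Max_in[OF T] by (simp add: T_def)
  moreover have "x \<le> Max T" if "x \<in> S" for x
  proof (cases "x0 \<le> x")
    case True
    then show ?thesis using that assms(2) T by (intro Max_ge) (auto simp: T_def)
  next
    case False
    then show ?thesis using Max_in[OF T] by (auto simp: T_def)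
  qed
  ultimately show ?thesis by blast
qed

text \<open>\<open>B\<close> contains one representative of each of the eight classes modulo the
  lattice.\<close>

locale packing8 = packing +
  fixes B :: "(real \<times> real) set"
  assumes card_B: "card B = 8" and B_sub: "B \<subseteq> P"
    and cover: "p \<in> P \<Longrightarrow> \<exists>b\<in>B. \<exists>z. p = b + rv z"
    and B_inj: "b \<in> B \<Longrightarrow> b' \<in> B \<Longrightarrow> b = b' + rv z \<Longrightarrow> b = b'"
begin

text \<open>A chain with more than eight steps meets some class twice among its first nine points.
  Cutting out the part between the two leaves two shorter chains, each closed up to a translation,
  and their bounds add up. Chains with at most eight steps are settled by their height and
  \<open>no_seven_chain\<close>.\<close>

lemma cycle_length:
  "(up ^^ n) p (p + rv (k, m)) \<Longrightarrow> p \<in> P \<Longrightarrow> int n \<le> 3 * m"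
proof (induction n arbitrary: p k m rule: less_induct)
  case (less n)
  have h: "real n * (2588/10000) \<le> of_int m"
    using chain_height[OF less.prems(1)] by (simp add: rv_Pair)
  show ?case
  proof (cases "n \<le> 8")
    case True
    show ?thesis
    proof (rule ccontr)
      assume "\<not> int n \<le> 3 * m"
      then have "3 * m + 1 \<le> int n" by simp
      \<comment> \<open>647/2500 is the minimal rise 0.2588 of a step. Over the integers, with
        \<open>n\<close> at most 8, this and \<open>n > 3 * m\<close> are compatible only for
        \<open>n = 7\<close>, \<open>m = 2\<close>.\<close>
      have "real_of_int (647 * int n) \<le> of_int (2500 * m)" using h by simp
      then have hm: "647 * int n \<le> 2500 * m" by (simp only: of_int_le_iff)
      have "m \<le> 2" "0 \<le> m" using hm \<open>3 * m + 1 \<le> int n\<close> True by linarith+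
      then have "m = 0 \<or> m = 1 \<or> m = 2" by auto
      then have "n = 7 \<and> m = 2"
        using hm \<open>3 * m + 1 \<le> int n\<close> True by (elim disjE) simp_all
      then show False using less.prems(1) no_seven_chain by simp
    qed
  next
    case False
    obtain f where f: "f 0 = p" "f n = p + rv (k, m)" "\<And>i. i < n \<Longrightarrow> up (f i) (f (Suc i))"
      using less.prems(1) unfolding relpowp_fun_conv by auto
    have sub: "(up ^^ (j - i)) (f i) (f j)" if "i \<le> j" "j \<le> n" for i j
      unfolding relpowp_fun_conv using that f(3) by (intro exI[of _ "\<lambda>l. f (i + l)"]) auto
    have fP: "f i \<in> P" if "i < n" for i using f(3)[OF that] by (simp add: up_def)
    define r where "r i = (SOME b. b \<in> B \<and> (\<exists>z. f i = b + rv z))" for i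
    have r: "r i \<in> B \<and> (\<exists>z. f i = r i + rv z)" if "i < n" for i
    proof -
      have "\<exists>b. b \<in> B \<and> (\<exists>z. f i = b + rv z)" using cover[OF fP[OF that]] by blast
      from someI_ex[OF this] show ?thesis unfolding r_def .
    qed
    have "finite B" using card_B by (simp add: card_ge_0_finite)
    have "\<not> inj_on r {..8}"
    proof
      assume "inj_on r {..8}"
      then have "card {..8::nat} \<le> card B"
        using r False \<open>finite B\<close> by (intro card_inj_on_le[of r]) auto
      then show False by (simp add: card_B)
    qed
    then obtain i' j' where i': "i' \<le> 8" "j' \<le> 8" "i' \<noteq> j'" "r i' = r j'"
      by (auto simp: inj_on_def)
    define i j where "i = min i' j'" and "j = max i' j'"
    have ij: "i < j" "j \<le> 8" "r i = r j"
      using i' by (auto simp: i_def j_def min_def max_def)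
    have "i < n" "j < n" using ij False by auto
    then obtain z z' where "f i = r i + rv z" "f j = r j + rv z'"
      using r by blast
    then have "f j = f i + rv (z' - z)"
      using ij(3) by (simp add: rv_def prod_eq_iff)
    then obtain a b where ab: "f j = f i + rv (a, b)" by (cases "z' - z") auto
    have 1: "int (j - i) \<le> 3 * b"
      using sub[of i j] ij False fP[of i] by (intro less.IH[of "j - i" "f i" a b]) (auto simp: ab)
    \<comment> \<open>Moved back by \<open>(a, b)\<close>, the rest of the chain continues the part
      before the cut.\<close>
    have "(up ^^ (n - j)) (f j + rv (- a, - b)) (f n + rv (- a, - b))"
      using sub[of j n] ij False by (intro chain_shift) auto
    moreover have "f j + rv (- a, - b) = f i" "f n + rv (- a, - b) = p + rv (k - a, m - b)"
      by (simp_all add: ab f(2) rv_Pair prod_eq_iff)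
    ultimately have "(up ^^ (n - j)) (f i) (p + rv (k - a, m - b))" by simp
    moreover have "(up ^^ i) p (f i)" using sub[of 0 i] ij False f(1) by simp
    ultimately have "(up ^^ (i + (n - j))) p (p + rv (k - a, m - b))"
      by (auto simp: relpowp_add intro: relcomppI)
    then have 2: "int (i + (n - j)) \<le> 3 * (m - b)"
      using ij False less.prems(2) by (intro less.IH[of "i + (n - j)" p "k - a"]) auto
    show ?thesis using 1 2 ij False by (simp add: of_nat_diff)
  qed
qed

text \<open>\<open>h p\<close> is the length of a longest chain that ends in \<open>p\<close>, where a vertical period counts for three steps.\<close>

lemma potential:
  obtains h :: "real \<times> real \<Rightarrow> int"
  where "\<And>p q. up p q \<Longrightarrow> h p < h q" "\<And>p a b. p \<in> P \<Longrightarrow> h (p + rv (a, b)) = h p + 3 * b"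
proof -
  have "B \<noteq> {}" using card_B by auto
  then obtain o' where o': "o' \<in> P" using B_sub by blast
  define S where "S p = {int n + 3 * m | n k m. (up ^^ n) (o' + rv (k, m)) p}" for p
  have "\<exists>m\<in>S p. \<forall>x\<in>S p. x \<le> m" if p: "p \<in> P" for p
  proof (rule int_set_has_max)
    have near: "\<exists>k. \<bar>fst q + of_int k - fst r\<bar> \<le> 1" for q r :: "real \<times> real"
      by (rule exI[of _ "- \<lfloor>fst q - fst r\<rfloor>"]) (simp, linarith)
    show "S p \<noteq> {}"
    proof -
      obtain k where k: "\<bar>fst o' + of_int k - fst p\<bar> \<le> 1" using near by blast
      \<comment> \<open>Two units of height against at most one unit of width make the connecting
        vector steep.\<close>
      define m where "m = - \<lceil>snd o' - snd p\<rceil> - 2"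
      have "snd o' + of_int m \<le> snd p - 2" unfolding m_def by simp linarith
      then have "up (o' + rv (k, m)) p"
        using k shift[OF o'] p by (auto simp: up_def rv_Pair)
      then have "(up ^^ 1) (o' + rv (k, m)) p" by (simp only: relpowp_1)
      then show ?thesis unfolding S_def by blast
    qed
    fix x assume "x \<in> S p"
    then obtain n k m where x: "x = int n + 3 * m" and c: "(up ^^ n) (o' + rv (k, m)) p"
      unfolding S_def by blast
    obtain k' where k': "\<bar>fst o' + of_int k' - fst p\<bar> \<le> 1" using near by blast
    \<comment> \<open>A last step from \<open>p\<close> to a translate of \<open>o'\<close> closes
      the chain, so \<open>cycle_length\<close> bounds the values independently of the
      chain.\<close>
    define m' where "m' = \<lceil>snd p - snd o'\<rceil> + 2"
    have "snd p + 2 \<le> snd o' + of_int m'" unfolding m'_def by simp linarith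
    then have "up p (o' + rv (k', m'))"
      using k' shift[OF o'] p by (auto simp: up_def rv_Pair abs_minus_commute)
    then have "(up ^^ Suc n) (o' + rv (k, m)) (o' + rv (k', m'))" using c by auto
    moreover have "o' + rv (k', m') = (o' + rv (k, m)) + rv (k' - k, m' - m)"
      by (simp add: rv_Pair prod_eq_iff)
    ultimately have "int (Suc n) \<le> 3 * (m' - m)"
      using cycle_length[of "Suc n" "o' + rv (k, m)" "k' - k" "m' - m"] shift[OF o'] by simp
    then show "x \<le> 3 * m'" using x by simp
  qed
  then obtain h where h: "\<And>p. p \<in> P \<Longrightarrow> h p \<in> S p" "\<And>p x. p \<in> P \<Longrightarrow> x \<in> S p \<Longrightarrow> x \<le> h p"
    by metis
  have sh: "x + 3 * b \<in> S (p + rv (a, b))" if "x \<in> S p" for x p a b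
  proof -
    obtain n k m where x: "x = int n + 3 * m" and c: "(up ^^ n) (o' + rv (k, m)) p"
      using \<open>x \<in> S p\<close> unfolding S_def by blast
    have "(up ^^ n) (o' + rv (k + a, m + b)) (p + rv (a, b))"
      using chain_shift[OF c, of "(a, b)"] by (simp add: rv_Pair add.assoc)
    then have "int n + 3 * (m + b) \<in> S (p + rv (a, b))" unfolding S_def by blast
    then show ?thesis by (simp add: x algebra_simps)
  qed
  show thesis
  proof (rule that)
    fix p q assume u: "up p q"
    then have P: "p \<in> P" "q \<in> P" by (auto simp: up_def)
    obtain n k m where x: "h p = int n + 3 * m" and c: "(up ^^ n) (o' + rv (k, m)) p"
      using h(1)[OF P(1)] unfolding S_def by blast
    have "(up ^^ Suc n) (o' + rv (k, m)) q" using c u by auto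
    then have "int (Suc n) + 3 * m \<in> S q" unfolding S_def by blast
    then show "h p < h q" using h(2)[OF P(2)] x by fastforce
  next
    fix p a b assume P: "p \<in> P"
    have "h p + 3 * b \<le> h (p + rv (a, b))"
      using sh[OF h(1)[OF P]] h(2) shift[OF P] by blast
    moreover have "h (p + rv (a, b)) + 3 * (- b) \<le> h (p + rv (a, b) + rv (- a, - b))"
      using sh[OF h(1)[OF shift[OF P]]] h(2)[OF shift[OF shift[OF P]]] by blast
    moreover have "p + rv (a, b) + rv (- a, - b) = p" by (simp add: rv_Pair prod_eq_iff)
    ultimately show "h (p + rv (a, b)) = h p + 3 * b" by simp
  qed
qed

end

text \<open>The potentials for the upward and the rightward steps label the points by a grid of period 3 with one vacancy,
  put at \<open>(0, 0)\<close>: two points with the same labels would not be comparable.\<close>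

definition valid :: "int \<Rightarrow> int \<Rightarrow> bool" where
  "valid a b \<longleftrightarrow> \<not> (3 dvd a \<and> 3 dvd b)"

definition grid :: "(int \<Rightarrow> int \<Rightarrow> real \<times> real) \<Rightarrow> bool" where
  "grid f \<longleftrightarrow> (\<forall>a b. f (a + 3) b = f a b + (1, 0) \<and> f a (b + 3) = f a b + (0, 1)) \<and>
     (\<forall>a b a' b'. valid a b \<longrightarrow> valid a' b' \<longrightarrow> (a, b) \<noteq> (a', b') \<longrightarrow>
        d0 \<le> norm (f a' b' - f a b) \<and>
        (\<bar>fst (f a' b' - f a b)\<bar> \<le> snd (f a' b' - f a b) \<longrightarrow> b < b') \<and>
        (\<bar>snd (f a' b' - f a b)\<bar> \<le> fst (f a' b' - f a b) \<longrightarrow> a < a'))"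

lemma swap_add_rv: "prod.swap (p + rv z) = prod.swap p + rv (prod.swap z)"
  by (simp add: rv_def prod_eq_iff)

lemma mem_swap_image: "p \<in> prod.swap ` X \<longleftrightarrow> prod.swap p \<in> X"
  by (cases p) auto

lemma norm_swap: "norm (prod.swap p - prod.swap q) = norm (p - q :: real \<times> real)"
  by (simp add: norm_prod_def add.commute)

text \<open>Exchanging the coordinates turns flat steps into steep ones, so that
  \<open>potential\<close> also yields the horizontal labels.\<close>

lemma (in packing8) swapped: "packing8 (prod.swap ` P) (prod.swap ` B)"
proof
  fix p q z
  show "p + rv z \<in> prod.swap ` P" if "p \<in> prod.swap ` P"
    using that shift[of "prod.swap p" "prod.swap z"] by (simp only: mem_swap_image swap_add_rv)
  show "d0 \<le> norm (q - p)" if "p \<in> prod.swap ` P" "q \<in> prod.swap ` P" "p \<noteq> q"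
  proof -
    have "prod.swap p \<noteq> prod.swap q" using that(3) by (cases p; cases q) auto
    then show ?thesis using sep[of "prod.swap p" "prod.swap q"] that by (simp add: mem_swap_image norm_swap)
  qed
  show "card (prod.swap ` B) = 8" by (simp add: card_image card_B)
  show "prod.swap ` B \<subseteq> prod.swap ` P" using B_sub by blast
  show "\<exists>b\<in>prod.swap ` B. \<exists>z. p = b + rv z" if "p \<in> prod.swap ` P"
  proof -
    obtain b z where b: "b \<in> B" "prod.swap p = b + rv z"
      using cover[of "prod.swap p"] \<open>p \<in> _\<close> unfolding mem_swap_image by blast
    have "p = prod.swap b + rv (prod.swap z)"
      using arg_cong[OF b(2), of prod.swap] by (simp only: swap_add_rv swap_swap)
    then show ?thesis using b(1) by blast
  qed
  show "p = q" if "p \<in> prod.swap ` B" "q \<in> prod.swap ` B" "p = q + rv z"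
  proof -
    have "prod.swap p = prod.swap q + rv (prod.swap z)"
      using arg_cong[OF that(3), of prod.swap] by (simp only: swap_add_rv)
    then have "prod.swap p = prod.swap q"
      using B_inj[of "prod.swap p" "prod.swap q"] that by (simp only: mem_swap_image)
    then show ?thesis by (cases p; cases q) auto
  qed
qed

theorem (in packing8) ex_grid: "\<exists>f. grid f \<and> P = {f a b | a b. valid a b}"
proof -
  interpret sw: packing8 "prod.swap ` P" "prod.swap ` B" by (rule swapped)
  obtain h where h: "\<And>p q. up p q \<Longrightarrow> h p < h q" "\<And>p a b. p \<in> P \<Longrightarrow> h (p + rv (a, b)) = h p + 3 * b"
    using potential by blast
  obtain g' where g': "\<And>p q. sw.up p q \<Longrightarrow> g' p < g' q"
    "\<And>p a b. p \<in> prod.swap ` P \<Longrightarrow> g' (p + rv (a, b)) = g' p + 3 * b"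
    using sw.potential by blast
  define g where "g p = g' (prod.swap p)" for p
  have gs: "g (p + rv (a, b)) = g p + 3 * a" if "p \<in> P" for p a b
  proof -
    have "prod.swap (p + rv (a, b)) = prod.swap p + rv (b, a)" by (simp add: rv_Pair prod_eq_iff)
    then show ?thesis using g'(2)[of "prod.swap p" b a] that by (simp add: g_def)
  qed
  have gu: "g p < g q" if "p \<in> P" "q \<in> P" "p \<noteq> q" "\<bar>snd (q - p)\<bar> \<le> fst (q - p)" for p q
    unfolding g_def using that by (intro g'(1)) (auto simp: sw.up_def prod_eq_iff)
  have hu: "h p < h q" if "p \<in> P" "q \<in> P" "p \<noteq> q" "\<bar>fst (q - p)\<bar> \<le> snd (q - p)" for p q
    using that by (intro h(1)) (auto simp: up_def)
  \<comment> \<open>Every nonzero vector or its negative is steep or flat, so one of the two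
    potentials separates distinct points.\<close>
  have inj: "p = q" if "p \<in> P" "q \<in> P" "g p = g q" "h p = h q" for p q
  proof (rule ccontr)
    assume "p \<noteq> q"
    define u v where "u = fst (q - p)" and "v = snd (q - p)"
    have "\<not> \<bar>v\<bar> \<le> u" "\<not> \<bar>u\<bar> \<le> v"
      using gu[of p q] hu[of p q] that \<open>p \<noteq> q\<close> by (auto simp: u_def v_def)
    moreover have "\<not> \<bar>v\<bar> \<le> - u" "\<not> \<bar>u\<bar> \<le> - v"
      using gu[of q p] hu[of q p] that \<open>p \<noteq> q\<close> by (auto simp: u_def v_def abs_minus_commute)
    ultimately show False by linarith
  qed
  define c where "c b = (g b mod 3, h b mod 3)" for b
  have cP: "c (p + rv z) = c p" if "p \<in> P" for p z
    using gs[OF that] h(2)[OF that] by (cases z) (simp add: c_def)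
  have shift_eq: "\<exists>z. g (p + rv z) = a \<and> h (p + rv z) = b"
    if "p \<in> P" "g p mod 3 = a mod 3" "h p mod 3 = b mod 3" for p a b
  proof -
    have "3 dvd a - g p" "3 dvd b - h p" using that(2,3) by (simp_all add: mod_eq_dvd_iff[symmetric])
    then obtain i j where "a - g p = 3 * i" "b - h p = 3 * j" by (auto elim!: dvdE)
    then have "a = g p + 3 * i" "b = h p + 3 * j" by simp_all
    then have "g (p + rv (i, j)) = a \<and> h (p + rv (i, j)) = b"
      using gs h(2) that(1) by simp
    then show ?thesis by blast
  qed
  \<comment> \<open>Points with equal residues become equal in both labels after a translation.
    Hence the eight classes take eight of the nine values of \<open>c\<close>; the missing one is
    moved to \<open>(0, 0)\<close> below.\<close>
  have "inj_on c B"
  proof (rule inj_onI)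
    fix b b' assume b: "b \<in> B" "b' \<in> B" "c b = c b'"
    then have P: "b \<in> P" "b' \<in> P" using B_sub by auto
    obtain z where "g (b' + rv z) = g b" "h (b' + rv z) = h b"
      using shift_eq[OF P(2), of "g b" "h b"] b(3) by (auto simp: c_def)
    then have "b = b' + rv z" using inj[OF P(1) shift[OF P(2)]] by simp
    then show "b = b'" using B_inj b by blast
  qed
  then have cc: "card (c ` B) = 8" using card_B by (simp add: card_image)
  have csub: "c ` B \<subseteq> {0..2} \<times> {0..2}" by (auto simp: c_def)
  have "card (({0..2} \<times> {0..2}) - c ` B) = 1"
    using cc csub by (subst card_Diff_subset) (auto intro: finite_subset[OF csub] simp: card_cartesian_product)
  then obtain m where "({0..2} \<times> {0..2}) - c ` B = {m}" by (auto simp: card_1_singleton_iff)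
  then obtain u v where uv: "({0..2} \<times> {0..2}) - c ` B = {(u, v)}" by (cases m) auto
  have "(u, v) \<in> {0..2} \<times> {0..2}" using uv by blast
  then have uv3: "u mod 3 = u" "v mod 3 = v" by auto
  have ex: "\<exists>!p. p \<in> P \<and> g p = a + u \<and> h p = b + v" if "valid a b" for a b
  proof -
    have "((a + u) mod 3, (b + v) mod 3) \<noteq> (u, v)"
    proof
      assume "((a + u) mod 3, (b + v) mod 3) = (u, v)"
      then have "(a + u) mod 3 = u mod 3" "(b + v) mod 3 = v mod 3" using uv3 by auto
      then show False using \<open>valid a b\<close> by (auto simp: valid_def mod_eq_dvd_iff)
    qed
    moreover have "((a + u) mod 3, (b + v) mod 3) \<in> {0..2} \<times> {0..2}" by auto
    ultimately have "((a + u) mod 3, (b + v) mod 3) \<in> c ` B" using uv by blast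
    then obtain b' where b': "b' \<in> B" "c b' = ((a + u) mod 3, (b + v) mod 3)" by (metis imageE)
    have "b' \<in> P" using b'(1) B_sub by blast
    have "g b' mod 3 = (a + u) mod 3" "h b' mod 3 = (b + v) mod 3" using b'(2) by (simp_all add: c_def)
    from shift_eq[OF \<open>b' \<in> P\<close> this] obtain z where "g (b' + rv z) = a + u" "h (b' + rv z) = b + v" by blast
    then show ?thesis using inj shift[OF \<open>b' \<in> P\<close>] by (intro ex1I[of _ "b' + rv z"]) auto
  qed
  \<comment> \<open>The value at a vacancy is arbitrary but periodic, so that the period conditions
    of \<open>grid\<close> hold at all indices.\<close>
  define f where "f a b = (if valid a b then THE p. p \<in> P \<and> g p = a + u \<and> h p = b + v
    else (of_int a / 3, of_int b / 3))" for a b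
  have f: "f a b \<in> P" "g (f a b) = a + u" "h (f a b) = b + v" if "valid a b" for a b
    using theI'[OF ex[OF that]] that by (auto simp: f_def)
  have per: "f (a + 3 * i) (b + 3 * j) = f a b + rv (i, j)" for a b i j
  proof (cases "valid a b")
    case True
    then have v: "valid (a + 3 * i) (b + 3 * j)" by (auto simp: valid_def dvd_add_left_iff)
    show ?thesis
      using f[OF True] f[OF v] gs h(2) shift by (intro inj) auto
  next
    case False
    then have "\<not> valid (a + 3 * i) (b + 3 * j)" by (auto simp: valid_def)
    then show ?thesis using False by (simp add: f_def rv_Pair add_divide_distrib)
  qed
  have "grid f"
    unfolding grid_def
  proof (intro conjI allI impI)
    show "f (a + 3) b = f a b + (1, 0)" "f a (b + 3) = f a b + (0, 1)" for a b
      using per[of a 1 b 0] per[of a 0 b 1] by (auto simp: rv_Pair)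
    fix a b a' b' assume v: "valid a b" "valid a' b'" and ne: "(a, b) \<noteq> (a', b')"
    have n: "f a b \<noteq> f a' b'" using ne f[OF v(1)] f[OF v(2)] by auto
    show "d0 \<le> norm (f a' b' - f a b)" using sep f(1) v n by blast
    show "b < b'" if "\<bar>fst (f a' b' - f a b)\<bar> \<le> snd (f a' b' - f a b)"
      using hu[OF f(1)[OF v(1)] f(1)[OF v(2)] n that] f(3) v by simp
    show "a < a'" if "\<bar>snd (f a' b' - f a b)\<bar> \<le> fst (f a' b' - f a b)"
      using gu[OF f(1)[OF v(1)] f(1)[OF v(2)] n that] f(2) v by simp
  qed
  moreover have "P = {f a b | a b. valid a b}"
  proof
    show "{f a b | a b. valid a b} \<subseteq> P" using f(1) by blast
    show "P \<subseteq> {f a b | a b. valid a b}"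
    proof
      fix p assume p: "p \<in> P"
      obtain b z where b: "b \<in> B" "p = b + rv z" using cover[OF p] by blast
      then have "c p = c b" using cP B_sub by blast
      then have "c p \<noteq> (u, v)" using uv b(1) by (metis DiffE image_eqI insertI1)
      moreover have "valid (g p - u) (h p - v) \<longleftrightarrow> c p \<noteq> (u, v)"
        using uv3 by (auto simp: valid_def c_def mod_eq_dvd_iff[symmetric])
      ultimately have v: "valid (g p - u) (h p - v)" by simp
      then have "f (g p - u) (h p - v) = p" using f[OF v] p by (intro inj) auto
      then show "p \<in> {f a b | a b. valid a b}" using v by (metis (mono_tags, lifting) mem_Collect_eq)
    qed
  qed
  ultimately show ?thesis by blast
qed

subsection \<open>The branch and bound\<close>

text \<open>Modulo 3, any nonzero difference of labels is, up to sign, one of \<open>(1, 0)\<close>,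
  \<open>(0, 1)\<close>, \<open>(1, 1)\<close>, \<open>(-1, 1)\<close>. So each of the 28 pairs of
  points is adjacent in the grid in just one way, and each pair appears here once, oriented along
  that difference.\<close>

definition edges :: "edge list" where
  "edges = [
  (0, 4, -1, 0), (0, 3, 0, 0), (0, 1, 0, 0), (1, 3, 0, 0), (1, 2, 0, 0), (1, 4, 0, 0), (2, 4, 0, 0),
  (2, 0, 1, 0), (2, 3, 1, 0), (3, 7, -1, 0), (3, 5, 0, 0), (3, 6, 0, 0), (4, 6, 0, 0), (4, 7, 0, 0),
  (4, 3, 1, 0), (4, 5, 1, 0), (5, 2, -1, 1), (5, 0, 0, 1), (5, 6, 0, 0), (5, 1, 0, 1), (6, 0, 0, 1),
  (6, 1, 0, 1), (6, 7, 0, 0), (6, 2, 0, 1), (7, 1, 0, 1), (7, 2, 0, 1), (7, 5, 1, 0), (7, 0, 1, 1)]"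

text \<open>Cones about the directions of the 20 contacts of the optimal configuration, of half-width about 15 degrees for
  the sides between two triangles and 19 degrees for the sides of the squares; \<open>((0, 0), (0, 0))\<close>
  is no restriction.\<close>

definition contact_cones :: "cone list" where
  "contact_cones = [
  ((-220, 249), (-326, 64)), ((249, 220), (64, 326)), ((321, -86), (321, 86)), ((-64, 326), (-249,
  220)), ((220, -249), (326, -64)), ((326, 64), (220, 249)), ((86, 321), (-86, 321)), ((326, 64),
  (220, 249)), ((0, 0), (0, 0)), ((-220, 249), (-326, 64)), ((86, 321), (-86, 321)), ((326, 64), (220,
  249)), ((-64, 326), (-249, 220)), ((249, 220), (64, 326)), ((0, 0), (0, 0)), ((0, 0), (0, 0)), ((0,
  0), (0, 0)), ((-64, 326), (-249, 220)), ((220, -249), (326, -64)), ((249, 220), (64, 326)), ((0, 0),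
  (0, 0)), ((0, 0), (0, 0)), ((321, -86), (321, 86)), ((249, 220), (64, 326)), ((0, 0), (0, 0)),
  ((-64, 326), (-249, 220)), ((326, 64), (220, 249)), ((0, 0), (0, 0))]"

text \<open>Quarter planes between the diagonals, then two half-planes: for diagonal neighbours the
  two orders exclude only the opposite two quarters.\<close>

abbreviation cE :: cone where "cE \<equiv> ((235, -235), (235, 235))"
abbreviation cN :: cone where "cN \<equiv> ((235, 235), (-235, 235))"
abbreviation cW :: cone where "cW \<equiv> ((-235, 235), (-235, -235))"
abbreviation cNE :: cone where "cNE \<equiv> ((235, -235), (-235, 235))"
abbreviation cNW :: cone where "cNW \<equiv> ((235, 235), (-235, -235))"

text \<open>The parameters belong to the edges 5, 12, 11 and 3, the sides of the quadrilateral
  around the vacancy. The case distinction cuts their half-planes into quarters.\<close>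

definition start :: "cone \<Rightarrow> cone \<Rightarrow> cone \<Rightarrow> cone \<Rightarrow> cone list" where
  "start se ne nw sw = [cNW, cN, cE, sw, cE, se, cN, cE, cNE, cNW, cN, nw,
    ne, cN, cE, cNE, cNW, cN, cE, cNE, cNW, cN, cE, cNE, cNW, cN, cE, cNE]"

text \<open>The trees come from a branch and bound search. Their names are the flags of \<open>turns\<close> below.\<close>

definition tree_1010 :: tree where
  "tree_1010 =
Split 25 0 332 (Split 10 86 321 (Split 6 0 332 (Split 13 (-86) 321 (Leaf [6,1,3,13,1,3,25,1,3])
(Leaf [6,2,5,10,5,0,13,-3,5,14,5,0,18,5,0,22,5,0,25,2,5])) (Split 8 235 235 (Split 13 86 321 (Leaf
[6,-2,5,8,5,0,10,5,0,12,-5,0,13,3,5,18,5,0,25,3,5]) (Split 25 164 289 (Leaf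
[8,4,0,10,4,0,18,4,0,22,4,0,25,4,0]) (Split 13 0 332 (Leaf
[6,-2,5,8,3,0,10,3,0,12,-3,0,13,1,5,18,3,0,25,1,5]) (Leaf
[6,-2,5,8,3,0,10,3,0,13,-2,5,18,3,0,22,3,0,25,1,5])))) (Split 13 (-86) 321 (Split 22 321 (-86)
(Leaf [10,3,0,12,-4,-4,13,1,4,14,3,0,18,3,0,22,-1,-4]) (Split 1 86 321 (Leaf
[1,4,0,6,-2,4,7,4,0,10,4,0,12,-4,0,13,2,4,18,4,0,25,2,4]) (Split 6 (-86) 321 (Split 25 164 289
(Leaf [6,3,4,13,3,4,25,3,4]) (Leaf [6,1,3,13,1,3,25,1,3])) (Split 17 (-86) 321 (Split 2 321 (-86)
(Split 1 (-86) 321 (Leaf [1,2,4,10,2,4,17,2,4]) (Split 14 289 164 (Leaf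
[1,-4,4,2,4,-4,5,4,-4,14,4,-4]) (Split 5 289 164 (Leaf [2,4,-4,5,4,-4,6,-4,4,7,4,-4]) (Leaf
[2,1,-1,3,-7,-7,5,8,6,6,-1,1,7,1,-1,14,7,7])))) (Split 7 332 0 (Split 8 86 321 (Split 5 289 164
(Leaf [2,10,-2,5,10,-2,6,-10,2,7,9,-4,8,1,2,10,1,2,17,1,2]) (Split 2 321 86 (Leaf
[2,3,-1,5,3,-1,6,-3,1,7,3,-1]) (Leaf
[2,25,14,5,25,14,6,-29,-7,7,19,-8,8,13,22,10,13,22,12,-7,0,13,3,7,17,6,22,18,7,0,25,3,7]))) (Leaf
[2,4,0,5,4,0,7,3,-2,8,-3,2,10,1,2,14,4,0,17,1,2])) (Split 5 321 (-86) (Split 2 289 164 (Leaf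
[2,3,-3,5,3,-3,6,-3,3,7,3,-3]) (Split 7 289 164 (Leaf [2,3,-3,5,3,-3,6,-3,3,7,3,-3]) (Leaf
[2,4,2,4,3,3,5,1,-1,6,-1,1,7,4,2]))) (Split 25 164 289 (Leaf
[1,-1,3,2,25,7,5,25,7,6,-7,12,7,24,10,10,12,3,13,5,19,14,13,0,18,12,3,22,12,3,25,17,22]) (Leaf
[2,8,2,5,8,2,6,-5,9,7,8,2,13,3,11,25,3,11]))))) (Split 13 0 332 (Leaf
[6,-3,5,7,5,0,12,-5,0,13,2,5,17,-5,0,18,5,0,25,2,5]) (Leaf
[6,-3,5,7,5,0,13,-3,5,17,-5,0,18,5,0,22,5,0,25,2,5])))))) (Split 14 332 0 (Leaf
[8,0,2,10,4,0,13,-4,2,14,4,-2,18,4,0,22,4,0,25,0,2]) (Split 22 332 0 (Leaf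
[10,4,0,12,-1,-1,13,-3,1,14,4,0,18,4,0,22,3,-1]) (Leaf
[10,4,1,13,-4,-1,14,4,1,18,4,1,22,4,1])))))) (Split 6 0 332 (Split 14 289 (-164) (Split 15 235 235
(Split 15 289 164 (Split 13 (-86) 321 (Leaf [6,1,3,13,1,3,25,1,3]) (Split 18 321 (-86) (Leaf
[13,-3,3,15,3,-3,18,3,-3,22,3,-3]) (Leaf
[6,6,14,10,-5,5,11,5,-5,13,-10,16,15,16,-2,18,11,3,22,16,-2,25,6,14]))) (Split 1 164 289 (Split 3
(-321) (-86) (Split 4 321 86 (Leaf [1,4,0,3,-4,1,4,4,-1,7,4,0,13,0,1,14,0,-1,25,0,1]) (Leaf
[1,2,1,3,-4,1,4,2,1,5,2,-2,7,2,1,14,2,-2])) (Leaf [1,2,1,2,1,-1,3,-2,-1,4,3,0,7,3,0])) (Split 17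
86 321 (Split 1 (-164) 289 (Split 4 289 (-164) (Leaf
[1,0,5,2,2,-2,4,2,-2,6,3,0,13,0,2,14,0,-5,15,3,3,17,2,3,18,1,0,22,1,0,25,1,2]) (Leaf
[1,0,8,2,5,0,4,4,1,5,1,-1,6,4,1,14,0,-8,15,5,8,17,5,8])) (Leaf
[1,-2,2,2,3,0,5,3,0,14,2,-2,15,1,2,17,1,2])) (Split 13 (-86) 321 (Leaf [6,1,3,13,1,3,25,1,3])
(Split 18 321 (-86) (Leaf [1,-2,8,6,2,5,13,-5,9,14,2,-8,15,5,4,17,-2,8,18,7,-4,22,7,-4,25,2,5])
(Leaf [6,2,4,11,2,-2,13,-2,4,14,2,-2,15,2,2,18,2,2,22,4,0,25,2,4])))))) (Split 17 (-86) 321 (Split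
1 (-86) 321 (Leaf [1,1,3,11,1,0,14,0,-3,15,0,3,17,1,3,22,1,0,26,1,0]) (Leaf
[1,-2,4,2,2,0,5,2,0,14,2,-4,15,0,4,17,0,4])) (Leaf
[1,0,4,3,-2,0,4,2,0,7,2,0,14,2,-4,15,-2,4,17,-2,4]))) (Split 22 289 (-164) (Split 13 (-164) 289
(Leaf [11,3,0,12,-4,-4,13,1,4,14,3,0,22,-1,-4]) (Leaf [11,3,0,12,-1,-1,13,-2,1,14,3,0,22,2,-1]))
(Split 11 289 (-164) (Split 10 (-164) 289 (Leaf [10,0,3,11,0,-3,18,3,3,22,3,0,26,3,0]) (Leaf
[10,-2,2,11,2,-2,18,2,2,22,4,0,26,4,0])) (Split 6 164 289 (Leaf
[6,8,1,11,8,1,14,8,1,22,8,1,25,8,1]) (Split 25 164 289 (Leaf [6,7,1,11,7,1,14,7,1,22,7,1,25,7,1])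
(Split 13 (-127) 307 (Leaf [6,1,3,13,1,3,25,1,3]) (Leaf
[6,2,8,11,7,1,13,-5,7,14,7,1,22,7,1,25,2,8]))))))) (Split 17 86 321 (Split 15 235 235 (Split 5 321
86 (Split 10 (-164) 289 (Split 1 0 332 (Leaf [1,3,7,2,1,-1,5,1,-1,10,3,7,15,1,-1,17,4,6]) (Leaf
[1,-3,7,2,5,-3,5,5,-3,10,-1,7,14,2,0,15,3,-3,17,2,4])) (Leaf
[1,0,1,2,1,-1,3,-7,0,4,1,1,5,7,-2,6,0,1,7,1,0,10,-7,1,15,7,-1])) (Split 1 0 332 (Split 10 (-86)
321 (Leaf [1,2,3,10,2,3,17,2,3]) (Split 26 321 86 (Split 15 321 86 (Leaf
[1,1,3,2,1,-1,3,-3,0,5,4,-1,10,-2,3,15,4,-1,17,2,2]) (Split 17 203 263 (Leaf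
[1,7,0,10,-1,2,11,8,-2,17,7,0,22,8,-2,26,8,-2]) (Split 3 (-289) 164 (Split 26 321 (-86) (Split 7
321 (-86) (Leaf
[1,6,3,3,-4,4,5,4,-4,6,-2,5,7,3,-2,10,-4,7,11,6,0,15,2,1,17,3,5,22,6,0,25,1,3,26,5,-3]) (Leaf
[1,2,5,7,2,5,10,-3,5,11,5,0,22,5,0,25,2,5,26,3,-5])) (Leaf
[1,2,4,10,-2,4,11,4,0,17,2,4,22,4,0,26,4,0])) (Leaf
[1,3,6,3,-5,-3,5,5,3,10,-2,3,15,5,3,17,3,6])))) (Leaf
[1,2,1,3,-2,-1,5,2,1,13,0,3,15,2,-2,17,2,1,26,0,3]))) (Split 10 0 332 (Split 2 321 86 (Leaf
[1,-1,4,2,3,-1,5,3,-1,10,1,4,14,2,0,15,1,-1,17,2,3]) (Split 17 164 289 (Split 15 321 86 (Leaf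
[2,4,-2,5,4,-2,15,4,-2,17,4,-2]) (Leaf [2,4,2,5,4,2,15,4,2,17,4,2])) (Split 1 (-164) 289 (Leaf
[1,1,4,10,1,4,17,1,4]) (Split 14 289 (-164) (Leaf [1,-4,3,2,4,-3,5,4,-3,14,4,-3]) (Leaf
[1,-4,-2,2,4,2,5,4,2,14,4,2]))))) (Split 15 321 86 (Leaf
[1,-1,3,2,2,-2,5,2,-2,10,-1,3,15,2,-2,17,1,1]) (Split 2 321 86 (Leaf
[1,-1,3,2,2,-2,5,2,-2,10,-1,3,15,2,-2,17,1,1]) (Split 17 164 289 (Leaf
[2,4,2,5,4,2,15,4,2,17,4,2]) (Split 1 (-164) 289 (Split 10 (-164) 289 (Leaf
[1,-3,11,10,-3,11,17,-3,11]) (Leaf [1,-3,4,10,-3,4,17,-3,4])) (Leaf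
[1,-3,4,10,-3,4,17,-3,4])))))))) (Split 14 321 (-86) (Split 26 321 86 (Split 1 0 332 (Leaf
[1,3,5,11,3,-1,14,0,-6,15,0,6,17,3,5,22,3,-1,26,3,-1]) (Split 2 321 86 (Leaf
[1,-3,3,2,3,-3,5,3,-3,14,3,-3]) (Split 5 321 86 (Leaf [1,-3,3,2,3,-3,5,3,-3,14,3,-3]) (Split 15
164 289 (Split 1 (-86) 321 (Leaf [1,0,3,2,2,1,5,2,1,14,0,-3,15,2,4,17,2,4]) (Leaf
[1,-3,2,2,6,3,5,6,3,14,3,-2,15,3,5,17,3,5])) (Split 1 (-86) 321 (Leaf
[1,-1,3,14,1,-3,15,-1,3,17,-1,3]) (Leaf [1,-4,4,14,4,-4,15,-4,4,17,-4,4])))))) (Split 1 (-86) 321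
(Leaf [1,1,4,13,1,4,14,-1,-4,17,1,4,26,1,4]) (Leaf
[1,-2,3,2,2,0,5,2,0,13,0,3,14,2,-3,17,0,3,26,0,3]))) (Split 1 (-86) 321 (Split 26 321 86 (Split 22
321 (-86) (Leaf [10,-2,6,11,5,-5,12,-3,-3,13,0,2,14,3,1,22,2,-8,26,2,-6]) (Split 10 (-86) 321
(Leaf [1,2,4,10,2,4,17,2,4]) (Split 11 321 86 (Leaf [10,-3,1,11,3,-1,22,3,-1,26,3,-1]) (Split 7
321 86 (Split 22 321 86 (Leaf [10,-4,1,11,4,-1,22,4,-1,26,4,-1]) (Split 26 321 (-86) (Split 5 321
86 (Leaf [1,1,2,2,6,-4,5,6,-4,6,-4,10,7,7,-2,11,7,4,14,6,2,15,-4,4,22,7,4,25,3,8,26,4,-4]) (Split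
2 321 86 (Leaf [1,1,2,2,6,-4,5,6,-4,6,-4,10,7,7,-2,11,7,4,14,6,2,15,-4,4,22,7,4,25,3,8,26,4,-4])
(Split 15 164 289 (Split 6 (-86) 321 (Leaf
[1,7,12,6,4,10,10,-4,6,11,11,6,15,4,10,17,7,12,22,11,6,25,4,10,26,7,-4]) (Split 7 321 (-86) (Leaf
[2,5,3,5,5,3,6,-2,3,7,2,-3,15,3,6,17,3,6]) (Leaf
[1,8,29,2,7,4,5,7,4,7,10,24,10,-11,18,11,26,15,14,7,4,17,5,9,22,26,15,25,10,24,26,16,-9]))) (Leaf
[6,-1,3,11,2,1,14,2,1,15,-3,2,22,2,1,25,-1,3,26,3,-2])))) (Leaf
[1,1,2,10,-1,1,11,2,1,17,1,2,22,2,1,26,2,1]))) (Leaf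
[1,1,2,7,1,2,10,-3,1,11,4,1,22,4,1,25,1,2,26,3,-1]))))) (Split 10 (-86) 321 (Leaf
[1,2,4,10,2,4,17,2,4]) (Split 16 (-235) 235 (Split 16 0 332 (Leaf
[1,7,2,6,0,5,7,6,0,10,-1,2,11,8,0,13,0,5,16,6,5,17,1,2,22,8,0,26,8,5]) (Split 13 86 321 (Leaf
[2,4,0,5,4,0,6,-1,2,13,3,2,16,-1,2,17,4,0,26,3,2]) (Leaf
[2,2,0,5,2,0,6,-6,15,13,-4,15,16,-6,15,17,2,0,26,-4,15]))) (Split 13 0 332 (Leaf
[1,1,3,2,1,0,5,1,0,6,-2,5,10,-2,3,11,3,0,12,-3,0,13,2,5,16,-4,0,17,2,3,25,2,5]) (Split 13 (-86)
321 (Leaf [1,1,3,2,1,0,5,1,0,6,-2,5,10,-2,3,11,3,0,13,-1,5,16,-4,0,17,2,3,22,3,0,25,2,5]) (Leaf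
[6,-4,5,10,-6,0,11,6,0,13,-4,5,16,-6,0,22,6,0,25,2,5])))))) (Split 14 321 86 (Split 2 321 86 (Leaf
[1,-3,1,2,3,-1,5,3,-1,14,3,-1]) (Split 5 321 86 (Leaf [1,-3,1,2,3,-1,5,3,-1,14,3,-1]) (Split 15
164 289 (Leaf [1,-3,0,2,4,2,5,4,2,14,3,0,15,1,2,17,1,2]) (Leaf
[1,-4,0,2,3,1,5,3,1,14,4,0,15,-1,1,17,-1,1])))) (Split 16 (-235) 235 (Split 5 321 (-86) (Leaf
[1,-2,3,2,4,-3,5,4,-3,6,-2,4,7,2,0,10,0,4,14,2,1,16,0,4]) (Split 2 321 (-86) (Leaf
[1,-2,3,2,4,-3,5,4,-3,6,-2,4,7,2,0,10,0,4,14,2,1,16,0,4]) (Leaf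
[1,-17,-4,2,19,5,5,19,5,6,-2,5,7,2,0,10,0,6,14,17,10,16,0,5,17,0,1]))) (Split 16 (-321) (-86)
(Split 5 321 86 (Leaf [1,-7,10,2,13,0,4,3,3,5,10,-3,6,-6,5,10,-3,12,14,4,2,16,-9,2,17,6,10])
(Split 2 321 (-86) (Leaf [1,-1,1,2,1,-1,3,-3,-3,5,4,2,14,4,2]) (Leaf
[1,-4,-1,2,4,1,3,-3,-3,5,7,4,14,7,4]))) (Leaf
[6,-2,0,12,-2,-2,13,0,2,16,-3,-2,18,3,2,22,1,0,25,1,2]))))))) (Split 1 86 321 (Split 13 0 332
(Split 6 (-86) 321 (Leaf [6,1,3,13,1,3,25,1,3]) (Leaf
[1,5,0,6,-3,5,7,5,0,11,5,0,12,-5,0,13,2,5,25,2,5])) (Split 25 164 289 (Leaf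
[1,4,0,7,4,0,11,4,0,22,4,0,25,4,0]) (Leaf [1,3,0,6,-2,5,7,3,0,11,3,0,13,-2,5,22,3,0,25,1,5])))
(Split 1 (-164) 289 (Split 10 (-164) 289 (Split 17 (-164) 289 (Leaf [1,-1,6,10,-1,6,17,-1,6])
(Leaf [1,-2,3,10,-2,3,17,-2,3])) (Leaf [1,-3,3,10,-3,3,17,-3,3])) (Leaf
[1,-2,3,10,-2,3,17,-2,3])))))) (Split 3 (-321) (-86) (Split 4 321 86 (Split 5 321 (-86) (Split 6 0
332 (Leaf [3,-3,0,4,4,4,5,-1,-4,6,4,4,14,3,0]) (Split 9 (-235) 235 (Split 14 321 86 (Leaf
[3,-4,2,5,4,-2,14,4,-2]) (Leaf
[1,0,1,2,1,-1,3,-7,2,4,1,1,5,7,-4,6,-3,8,7,1,0,9,0,7,12,-3,0,14,7,4,18,3,0,25,-3,7,26,3,0]))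
(Split 9 (-332) 0 (Leaf [3,-3,1,4,2,2,5,1,-3,6,-1,3,9,-3,1,25,-3,1]) (Leaf
[3,-7,-3,4,5,5,5,2,-2,6,-2,5,9,-7,-3,13,0,3,25,-7,0])))) (Split 6 86 321 (Split 3 (-321) 86 (Split
25 (-164) 289 (Split 6 127 307 (Split 9 (-235) 235 (Split 14 332 0 (Leaf
[3,-3,1,4,3,-1,6,3,-1,14,3,-1]) (Leaf [3,-2,0,4,2,0,6,4,2,9,2,2,14,4,2,25,2,2])) (Split 13 86 321
(Leaf [6,3,2,13,3,2,25,3,2]) (Split 6 203 263 (Split 14 289 164 (Leaf
[3,-4,1,4,4,-1,6,4,-1,14,4,-1]) (Leaf [3,-3,-3,4,3,3,6,3,3,14,3,3])) (Split 25 (-86) 321 (Split 14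
289 164 (Split 13 (-164) 289 (Leaf [3,-4,1,4,4,-1,6,3,5,13,-1,6,14,4,-1,25,-1,6]) (Leaf
[3,-3,1,4,3,-1,13,-3,1,14,3,-1,25,-3,1])) (Split 13 (-127) 307 (Leaf
[3,-4,-3,4,4,3,6,4,7,13,0,4,14,4,3,25,0,4]) (Split 11 289 164 (Split 11 289 (-164) (Leaf
[3,-4,-4,4,4,4,6,3,6,11,1,-1,13,-2,3,14,5,3,22,1,-1,25,-1,2]) (Leaf
[3,-5,-5,4,5,5,6,5,8,11,2,0,13,-2,3,14,7,5,22,2,0,25,0,3])) (Leaf
[11,4,3,12,-3,-3,13,-1,0,14,4,3,22,1,0])))) (Split 14 289 164 (Split 13 0 332 (Leaf
[3,-4,1,4,4,-1,6,5,8,13,1,9,14,4,-1,25,1,9]) (Leaf [3,-4,1,4,4,-1,6,2,3,13,-2,4,14,4,-1,25,-2,4]))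
(Split 9 (-289) 164 (Leaf [3,-4,1,4,4,-1,6,2,3,9,-2,4,14,2,3,25,-2,4]) (Split 13 0 332 (Leaf
[3,-3,-1,4,3,1,6,2,4,9,-3,-1,13,2,4,25,-1,3]) (Split 13 (-86) 321 (Split 6 164 289 (Leaf
[3,-7,-5,4,7,5,6,6,9,13,-1,4,14,7,5,25,-1,4]) (Leaf [6,-1,3,13,-1,3,25,-1,3])) (Leaf
[3,-3,-2,4,3,2,6,2,3,13,-1,1,14,3,2,25,-1,1]))))))))) (Split 13 0 332 (Split 13 164 289 (Leaf
[6,3,2,13,3,2,25,3,2]) (Leaf [6,1,3,13,1,3,25,1,3])) (Leaf [6,-1,3,13,-1,3,25,-1,3]))) (Split 4
321 (-86) (Split 9 (-235) 235 (Split 14 332 0 (Leaf [3,-4,2,4,4,-2,6,4,-1,13,0,1,14,4,-2,25,0,1])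
(Split 9 (-164) 289 (Split 9 (-86) 321 (Leaf [6,4,4,9,4,4,14,4,4,25,4,4]) (Leaf
[3,-7,4,4,7,-4,6,5,2,9,-2,6,14,5,2,25,-2,6])) (Leaf [3,-5,3,4,5,-3,6,2,1,9,-3,4,14,2,1,25,-3,4])))
(Split 9 (-289) 164 (Leaf [3,-4,2,4,4,-2,9,-4,2,25,-4,2]) (Leaf
[3,-3,-1,4,3,1,9,-3,-1,25,-3,-1]))) (Split 14 289 (-164) (Split 3 (-263) 203 (Leaf
[3,-4,4,5,4,-4,14,4,-4]) (Leaf [3,-4,1,4,4,-1,6,4,-1,14,4,-1])) (Split 14 332 0 (Leaf
[3,-3,0,4,3,0,6,3,0,14,3,0]) (Leaf [3,-3,-1,4,3,1,6,3,1,14,3,1]))))) (Split 14 289 (-164) (Split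
13 86 321 (Split 27 235 235 (Leaf [1,0,1,2,1,-1,3,-3,0,4,4,-1,6,4,-1,13,1,0,14,3,-1,27,1,0]) (Leaf
[1,0,2,3,-4,1,4,4,-1,6,4,-1,12,-1,0,13,1,2,14,4,-3,18,1,0,26,1,0,27,0,2])) (Split 4 289 (-164)
(Leaf [3,-5,4,4,5,-4,6,4,-1,13,-1,3,14,5,-4,25,-1,3]) (Leaf [3,-3,0,4,3,0,6,3,0,14,3,0]))) (Split
14 332 0 (Leaf [3,-4,0,4,4,0,6,4,0,14,4,0]) (Leaf [3,-3,-1,4,3,1,6,3,1,14,3,1])))) (Split 9 (-235)
235 (Split 26 332 0 (Split 10 (-86) 321 (Split 13 86 321 (Split 18 321 86 (Split 18 289 (-164)
(Split 12 (-332) 0 (Leaf [6,0,1,12,-4,2,13,4,-1,18,4,-2,25,0,1,26,4,-2]) (Split 26 289 (-164)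
(Leaf [12,-1,-1,13,1,1,18,7,-5,22,6,-6,26,7,-5]) (Leaf
[12,-2,-1,13,2,1,18,4,-1,22,2,-2,26,4,-1]))) (Split 12 (-332) 0 (Split 25 (-164) 289 (Leaf
[6,-1,4,12,-3,1,13,2,3,18,3,-1,25,-1,4,26,3,-1]) (Leaf
[6,-4,5,12,-6,2,13,2,3,18,6,-2,25,-4,5,26,6,-2])) (Leaf [12,-2,-1,13,2,1,18,3,0,22,1,-1,26,3,0])))
(Split 12 (-289) 164 (Split 14 289 (-164) (Leaf [10,1,3,11,14,-14,12,-15,11,14,15,-11,18,1,3])
(Split 10 86 321 (Leaf [10,3,3,12,-3,-3,14,3,3,18,3,3]) (Leaf
[10,0,3,11,2,-2,12,-2,-1,14,2,1,18,0,3]))) (Leaf [12,-3,-3,13,3,3,18,3,3,26,3,3]))) (Split 25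
(-164) 289 (Leaf [6,-1,3,13,-1,3,25,-1,3]) (Leaf [6,-2,3,13,-2,3,25,-2,3]))) (Split 4 289 (-164)
(Leaf [3,-4,2,4,4,-2,10,-4,2,25,-4,2,26,4,-2]) (Leaf [3,-4,1,4,4,-1,10,-4,1,25,-4,1,26,4,-1])))
(Split 13 86 321 (Split 18 321 (-86) (Split 12 (-289) 164 (Split 26 321 86 (Split 25 (-164) 289
(Leaf [6,-1,3,12,-2,1,13,1,2,18,2,-1,25,-1,3,26,2,-1]) (Leaf
[6,-3,2,12,-3,2,18,3,-2,25,-3,2,26,3,-2])) (Split 1 86 321 (Split 7 289 164 (Split 17 (-164) 289
(Leaf [1,4,4,9,4,4,17,4,4,26,4,4]) (Split 7 321 86 (Leaf [6,-4,2,7,4,-2,12,-4,2,17,-4,2,18,4,-2])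
(Split 9 (-164) 289 (Leaf [1,4,4,9,4,4,17,4,4,26,4,4]) (Split 25 (-164) 289 (Leaf
[1,3,3,7,3,3,9,3,3,25,3,3]) (Leaf
[1,5,9,3,-15,4,4,15,-4,6,-7,4,7,12,5,9,-10,13,12,-7,4,17,-7,4,18,7,-4,25,-10,13]))))) (Leaf
[1,2,3,3,-2,0,4,2,0,7,2,3,9,0,3,25,0,3])) (Split 9 (-86) 321 (Leaf
[1,0,2,9,3,2,12,-3,0,14,3,0,17,0,2,18,3,0,26,3,2]) (Split 17 0 332 (Leaf
[1,-6,24,2,17,0,4,3,-1,5,14,1,6,-4,16,9,-6,24,13,10,17,17,11,24,25,-7,17,26,11,24]) (Split 25
(-164) 289 (Leaf [1,-2,4,6,-2,7,9,-2,4,12,-5,2,13,3,5,17,-2,4,18,5,-2,25,-2,7,26,3,2]) (Leaf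
[1,-2,5,6,-5,3,9,-2,5,12,-5,3,17,-2,5,18,5,-3,25,-5,3,26,3,2])))))) (Split 25 (-164) 289 (Leaf
[6,-1,4,12,-5,-2,13,4,6,18,5,2,25,-1,4,26,5,2]) (Leaf
[6,-2,3,12,-5,-2,13,3,5,18,5,2,25,-2,3,26,5,2]))) (Leaf [12,-3,-1,13,3,1,18,3,1,26,3,1])) (Split
25 (-164) 289 (Leaf [6,-1,3,13,-1,3,25,-1,3]) (Leaf [6,-3,3,13,-3,3,25,-3,3])))) (Split 13 86 321
(Split 3 (-307) 127 (Split 26 332 0 (Split 10 86 321 (Leaf
[9,-4,-4,10,4,4,12,-4,0,13,4,0,18,4,0,26,0,-4]) (Split 6 0 332 (Leaf
[3,-4,1,4,4,-1,6,2,4,9,-3,-3,10,-1,4,13,2,4,25,-2,5,26,1,-4]) (Leaf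
[6,-3,7,9,-2,-2,10,-1,2,11,3,0,12,-7,0,13,4,7,18,4,0,25,-3,7,26,5,-2]))) (Split 18 321 (-86)
(Split 9 (-321) 86 (Split 25 (-164) 289 (Split 17 0 332 (Split 2 321 (-86) (Leaf
[1,0,3,2,4,-2,3,-2,-2,5,6,0,6,-2,7,9,-2,1,13,4,7,17,4,1,25,-2,7,26,4,1]) (Leaf
[2,7,2,5,7,2,13,7,2,17,7,2,26,7,2])) (Split 12 (-289) 164 (Split 5 321 86 (Leaf
[3,-2,1,5,2,-1,6,-1,3,9,-2,1,13,1,2,25,-1,3]) (Split 26 321 86 (Leaf
[6,-1,3,12,-2,1,13,1,2,18,2,-1,25,-1,3,26,2,-1]) (Split 7 321 86 (Leaf
[6,-2,8,7,2,-5,12,-5,3,13,3,5,17,-2,5,18,5,-3,25,0,3,26,3,2]) (Split 1 164 289 (Leaf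
[1,3,2,3,-3,-2,5,3,2,7,3,2,13,3,2,25,3,2]) (Split 6 0 332 (Split 1 86 321 (Leaf
[1,2,5,3,-5,-3,5,5,3,6,2,16,7,3,2,9,-3,2,12,-3,2,13,10,17,17,-1,3,18,3,-2,25,5,18,26,2,1]) (Leaf
[1,-2,4,3,-5,0,4,5,0,6,2,14,9,-7,4,12,-5,2,13,7,12,17,-2,4,18,5,-2,25,-3,14,26,3,2])) (Leaf
[1,-1,6,3,-5,-3,5,5,3,6,-4,10,7,1,1,9,-6,3,12,-5,3,13,6,10,17,-2,5,18,5,-3,25,-3,11,26,3,2]))))))
(Leaf [6,-1,3,12,-4,-2,13,3,5,18,4,2,25,-1,3,26,4,2]))) (Split 4 289 (-164) (Leaf
[3,-3,2,4,3,-2,9,-3,2,25,-3,2]) (Leaf [3,-3,0,4,3,0,9,-3,0,25,-3,0]))) (Leaf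
[3,-4,-1,5,4,1,9,-4,-1,13,4,1])) (Leaf [12,-3,-1,13,3,1,18,3,1,26,3,1]))) (Leaf
[3,-4,-1,5,4,1,9,-4,-1,13,4,1])) (Split 25 (-164) 289 (Leaf [6,-1,4,13,-1,4,25,-1,4]) (Leaf
[6,-3,4,13,-3,4,25,-3,4])))))) (Split 6 0 332 (Split 14 289 (-164) (Split 3 (-289) 164 (Leaf
[3,-8,6,4,1,1,5,7,-7,6,1,1,14,8,-6]) (Split 3 (-321) 86 (Leaf [3,-4,1,4,1,2,5,3,-3,6,1,2,14,4,-1])
(Leaf [3,-4,-4,4,4,4,6,4,4,14,4,4]))) (Split 6 86 321 (Leaf [3,-3,-3,4,3,3,6,3,3,14,3,3]) (Leaf
[3,-2,-1,4,0,3,5,2,-2,6,0,3,14,2,1]))) (Leaf [2,3,0,4,-1,4,5,4,-4,6,-4,4,7,3,0]))) (Split 6 86 321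
(Split 4 289 (-164) (Split 7 289 (-164) (Leaf [2,7,-7,3,-1,-1,4,8,-6,6,1,1,7,7,-7,14,1,1]) (Split
1 86 321 (Leaf [1,4,4,3,-4,-4,4,4,4,7,4,4]) (Leaf [1,-1,4,2,3,-3,3,1,-4,4,2,1,7,2,1]))) (Leaf
[3,-4,-4,4,4,4,6,4,4,14,4,4])) (Split 1 0 332 (Split 6 (-86) 321 (Split 27 235 235 (Split 13 0 332
(Leaf [1,1,2,2,2,-2,3,-1,-2,4,1,0,5,2,0,6,0,3,13,2,3,25,-1,3,27,3,0]) (Leaf
[6,-1,3,13,-1,3,25,-1,3])) (Split 1 86 321 (Leaf [1,4,4,3,-4,-4,4,4,4,6,0,4,7,4,0,13,0,4,27,0,4])
(Leaf [1,0,4,2,2,-2,3,0,-4,4,2,2,6,0,2,7,2,0,13,0,2,27,0,2]))) (Leaf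
[1,1,3,2,3,-3,3,-1,-3,5,4,0,6,-4,0,7,4,0])) (Leaf [1,-4,4,2,4,-4,3,1,-4,5,3,0,14,3,0]))))"

lemma check_1010: "check edges [] (start cE cW cE cW) tree_1010"
  by code_simp

definition tree_1100 :: tree where
  "tree_1100 =
Split 4 321 86 (Split 1 (-86) 321 (Split 7 321 86 (Split 6 86 321 (Split 14 332 0 (Split 4 289
(-164) (Split 27 235 235 (Split 3 (-332) 0 (Leaf [3,-4,2,4,4,-2,6,4,-1,13,0,1,14,4,-2,25,0,1])
(Split 1 0 332 (Split 7 321 (-86) (Split 7 289 (-164) (Leaf
[1,1,2,2,16,-16,3,-3,-2,4,19,-14,6,2,0,7,17,-14,14,2,0]) (Split 3 (-321) (-86) (Split 1 86 321
(Leaf [1,3,0,3,-3,0,4,3,0,7,3,0]) (Split 25 (-86) 321 (Split 14 289 (-164) (Leaf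
[1,2,13,2,23,-23,3,-16,-2,4,39,-21,6,16,-4,7,25,-10,13,2,7,14,14,-11,25,2,7]) (Leaf
[3,-3,0,4,3,0,6,3,0,14,3,0])) (Leaf [1,0,2,2,2,-2,3,-4,-1,4,6,-1,6,4,-1,14,4,-1,25,-2,0,27,2,0])))
(Leaf [1,1,2,2,3,-3,3,-1,-2,4,4,-1,7,4,-1]))) (Leaf [1,1,3,3,-5,-2,4,5,2,6,4,-1,7,1,3,14,4,-1]))
(Leaf [1,-2,2,2,2,-2,3,-2,-1,4,4,-1,6,4,-1,14,4,-1]))) (Split 3 (-332) 0 (Leaf
[3,-4,2,4,4,-2,6,4,-1,13,0,1,14,4,-2,25,0,1]) (Split 1 86 321 (Leaf
[1,4,6,3,-9,-4,4,9,4,6,5,5,7,4,-1,13,0,7,14,5,-2,27,0,7]) (Leaf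
[1,0,4,3,-5,-2,4,5,2,6,5,2,13,0,4,14,5,-2,27,0,4])))) (Split 3 (-321) (-86) (Split 3 (-289) 164
(Split 14 289 (-164) (Leaf [3,-4,3,4,1,0,5,3,-3,6,1,0,14,4,-3]) (Leaf
[3,-4,1,4,4,-1,6,4,-1,14,4,-1])) (Leaf [3,-6,1,4,6,-1,6,6,-1,14,6,-1])) (Leaf
[3,-3,-3,4,3,3,6,3,3,14,3,3]))) (Split 23 235 235 (Split 14 289 164 (Split 4 321 (-86) (Split 2
321 86 (Leaf [2,4,-2,4,4,-2,7,4,-2]) (Split 3 (-289) 164 (Split 10 0 332 (Split 17 (-86) 321 (Leaf
[1,2,7,6,1,0,10,3,7,14,1,0,17,2,7,18,1,0,23,1,0]) (Leaf
[3,-6,3,4,6,-3,6,8,2,7,4,-5,10,2,5,14,8,2,17,-4,5,18,6,0,23,6,0])) (Split 16 (-235) 235 (Split 16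
(-164) 289 (Leaf [3,-3,2,4,3,-2,6,4,1,10,1,3,14,4,1,16,1,3]) (Split 10 (-164) 289 (Leaf
[3,-3,2,4,3,-2,6,3,1,10,0,3,14,3,1,16,0,3]) (Leaf [3,-6,3,4,6,-3,6,3,1,10,-3,4,14,3,1,16,-3,4])))
(Split 17 86 321 (Split 16 (-289) 164 (Split 10 (-164) 289 (Split 1 86 321 (Leaf
[1,3,2,10,3,2,17,3,2]) (Leaf [1,0,3,2,3,2,3,-6,5,4,9,-3,6,4,1,10,-2,9,14,4,1,16,-5,4,17,3,5]))
(Leaf [3,-3,2,4,3,-2,10,-3,2,16,-3,2])) (Leaf [2,3,3,4,3,3,16,-3,-3,17,3,3])) (Split 10 (-164) 289
(Leaf [3,-9,5,4,9,-5,6,7,2,7,2,-7,10,-2,7,14,7,2,17,-2,7]) (Leaf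
[3,-3,2,4,3,-2,7,3,-2,10,-3,2,17,-3,2]))))) (Leaf [3,-4,-1,4,4,1,6,4,1,14,4,1]))) (Leaf
[3,-4,-1,4,4,1,6,4,1,14,4,1])) (Split 2 321 86 (Leaf [2,2,-7,3,-5,-5,4,7,-2,6,5,5,7,2,-7,14,5,5])
(Split 10 86 321 (Leaf [1,1,1,6,4,3,7,1,-3,10,5,4,14,4,3,17,0,4,18,5,0,23,5,0]) (Split 16 (-235)
235 (Leaf [3,-2,0,4,2,0,6,2,4,10,0,4,14,2,4,16,0,4]) (Split 17 86 321 (Split 16 (-289) 164 (Split
10 (-164) 289 (Leaf [2,3,2,4,3,2,6,2,4,7,1,-2,10,2,4,14,2,4,17,2,4]) (Leaf
[3,-3,0,4,3,0,6,1,2,10,-2,2,14,1,2,16,-2,2])) (Leaf [2,3,3,4,3,3,16,-3,-3,17,3,3])) (Leaf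
[3,-5,0,4,5,0,6,3,7,7,2,-7,10,-2,7,14,3,7,17,-2,7])))))) (Split 3 (-289) 164 (Split 4 289 (-164)
(Leaf [3,-7,5,4,7,-5,6,1,1,11,-6,6,14,1,1,23,-6,6]) (Leaf
[3,-3,0,4,3,0,6,2,1,11,-1,1,14,2,1,23,-1,1])) (Split 3 (-321) 86 (Leaf
[3,-3,0,4,3,0,6,2,1,11,-1,1,14,2,1,23,-1,1]) (Leaf [3,-3,-1,4,3,1,6,3,1,14,3,1]))))) (Split 3
(-332) 0 (Split 21 (-164) 289 (Split 22 321 86 (Split 2 321 86 (Split 4 321 (-86) (Leaf
[2,4,-2,4,4,-2,7,4,-2]) (Split 7 289 (-164) (Leaf [2,3,-3,5,3,-3,6,-3,3,7,3,-3]) (Leaf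
[1,1,1,2,7,-2,3,-1,-1,4,8,-1,7,8,-1]))) (Split 5 321 86 (Split 14 289 164 (Split 7 321 (-86)
(Split 14 332 0 (Leaf [3,-4,2,5,4,-2,14,4,-2]) (Leaf
[2,2,-2,3,-8,3,5,10,-5,6,-2,7,7,2,-7,10,0,5,14,8,2,17,0,5])) (Split 6 (-86) 321 (Split 4 289
(-164) (Split 5 321 (-86) (Leaf [3,-7,3,4,1,1,5,6,-4,6,1,1,14,7,-3]) (Split 14 321 86 (Split 3
(-289) 164 (Leaf [3,-3,3,5,3,-3,14,3,-3]) (Leaf [3,-3,1,5,3,-1,14,3,-1])) (Split 3 (-307) 127
(Split 23 235 235 (Split 10 (-86) 321 (Split 17 (-86) 321 (Leaf
[2,5,3,3,-8,5,5,13,-2,6,-2,7,7,2,-7,10,3,10,14,11,5,17,3,10]) (Split 10 164 289 (Leaf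
[2,3,0,5,3,0,6,0,1,7,4,-1,10,3,1,14,3,1,17,-1,1,18,4,0,23,4,0]) (Leaf
[6,0,3,7,2,-3,10,0,3,14,0,3,17,-2,3,18,2,0,23,2,0]))) (Split 16 (-235) 235 (Split 16 (-164) 289
(Leaf [2,1,0,5,1,0,6,0,5,7,1,0,10,1,5,14,1,5,16,1,5]) (Leaf
[3,-2,1,4,2,-1,6,0,3,10,-2,4,14,0,3,16,-2,4])) (Split 17 86 321 (Split 16 (-289) 164 (Split 10
(-127) 307 (Leaf [2,3,2,3,-3,2,5,6,0,6,-1,2,7,1,-2,10,2,4,14,5,2,17,2,4]) (Leaf
[2,4,3,3,-21,14,5,25,-11,6,-16,15,7,1,-3,10,-12,18,14,9,4,16,-15,12,17,3,6])) (Leaf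
[2,3,3,4,3,3,16,-3,-3,17,3,3])) (Leaf [3,-2,1,4,2,-1,6,0,3,7,2,-4,10,-2,4,14,0,3,17,-2,4]))))
(Leaf [3,-3,2,4,3,-2,6,0,1,11,-3,3,14,0,1,23,-3,3])) (Leaf [3,-4,0,5,4,0,14,4,0])))) (Leaf
[2,6,0,4,4,7,5,2,-7,6,-2,7,7,6,0])) (Leaf [2,3,-1,5,3,-1,6,-3,1,7,3,-1]))) (Split 23 235 235
(Split 6 (-86) 321 (Split 17 0 332 (Split 16 (-235) 235 (Leaf [6,0,4,10,0,4,14,0,4,16,0,4]) (Split
10 (-164) 289 (Leaf [2,5,2,4,3,3,5,2,-1,6,0,12,7,3,-9,10,2,11,14,2,11,17,2,11]) (Leaf
[2,3,2,4,3,2,6,-2,5,7,1,-3,10,-2,5,14,-2,5,16,-4,0,17,2,5]))) (Leaf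
[6,0,3,7,1,-3,10,0,3,14,0,3,17,-1,3,18,1,0,23,1,0])) (Leaf [2,4,-1,5,4,-1,6,-4,1,7,4,-1])) (Leaf
[6,-2,4,11,-2,4,14,-2,4,23,-2,4]))) (Split 10 (-86) 321 (Split 17 (-86) 321 (Split 17 86 321 (Leaf
[1,2,4,10,2,4,17,2,4]) (Split 10 86 321 (Leaf [1,2,4,10,2,4,17,2,4]) (Leaf
[1,4,14,3,-4,1,4,4,-1,7,4,-1,10,0,15,17,0,15]))) (Split 27 235 235 (Split 18 321 86 (Leaf
[17,-3,1,18,3,-1,22,3,-1,27,3,-1]) (Split 27 321 86 (Leaf [17,-3,1,18,3,-1,22,3,-1,27,3,-1])
(Split 13 0 332 (Split 25 0 332 (Split 6 (-86) 321 (Leaf [6,1,3,13,1,3,25,1,3]) (Split 13 164 289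
(Leaf [2,4,2,5,4,2,13,4,2,27,4,2]) (Split 7 289 (-164) (Split 22 321 (-86) (Leaf
[6,-3,5,7,3,-5,13,-3,5,17,-5,4,18,5,-4,22,5,-4,27,2,1]) (Leaf
[6,-1,2,7,1,-2,13,-1,2,17,-6,-1,18,6,1,22,6,1,27,5,3])) (Leaf
[2,11,6,5,11,6,6,-7,11,7,14,5,13,4,17,17,-3,1,18,3,-1,22,3,-1,25,7,16])))) (Split 13 164 289 (Leaf
[2,4,2,5,4,2,13,4,2,27,4,2]) (Split 6 (-86) 321 (Split 25 (-86) 321 (Leaf [6,0,3,13,0,3,25,0,3])
(Split 23 235 235 (Leaf [6,0,3,13,0,3,17,-2,0,18,2,0,23,2,0,25,-2,3,27,2,0]) (Split 22 321 (-86)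
(Leaf [6,0,3,13,0,3,22,0,-3,23,0,3]) (Leaf
[1,1,3,6,0,4,10,1,3,13,0,4,17,-6,-1,18,7,4,22,7,0,23,0,4,27,7,4])))) (Split 6 (-164) 289 (Leaf
[6,-3,7,13,-3,7,25,-3,7]) (Leaf [6,-3,3,13,-3,3,25,-3,3]))))) (Split 25 0 332 (Split 7 321 (-86)
(Leaf [6,-3,10,7,6,-3,12,1,1,13,-4,9,17,-6,3,18,6,-3,22,7,-2,25,3,7]) (Leaf
[6,-2,4,7,4,0,13,-2,4,17,-4,0,18,4,0,22,4,0,25,2,4])) (Leaf [6,-1,3,13,-1,3,25,-1,3]))))) (Split 7
321 (-86) (Split 27 86 321 (Split 13 86 321 (Split 6 (-86) 321 (Leaf
[2,2,1,5,2,1,6,0,3,7,0,-3,13,2,4,27,2,4]) (Leaf [2,2,1,5,2,1,6,-1,1,7,1,-1,13,1,2,27,1,2])) (Leaf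
[6,-1,3,7,1,-3,13,-1,3,27,-1,3])) (Leaf [6,-1,4,7,1,-4,13,-1,4,27,-1,4])) (Split 23 235 235 (Split
18 332 0 (Leaf [1,1,4,3,-6,1,4,6,-1,7,6,-1,11,-5,5,17,-5,5,18,5,-5]) (Split 4 321 (-86) (Split 23
321 86 (Leaf [7,3,-1,17,-3,1,18,3,-1,23,3,-1]) (Split 10 164 289 (Leaf
[1,3,5,7,5,2,10,3,5,17,-2,3,18,5,2,23,5,2]) (Leaf
[1,3,11,3,-2,1,4,2,-1,7,9,2,10,1,12,17,-6,9,18,7,3,23,7,3]))) (Leaf [2,4,2,4,4,2,7,4,2]))) (Split
23 86 321 (Split 18 321 (-86) (Leaf [1,1,2,3,-4,1,4,4,-1,7,4,-1,11,-3,3,17,-3,3,18,3,-3]) (Split 1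
86 321 (Leaf [1,10,3,3,-11,3,4,11,-3,7,12,0,10,1,4,11,-2,2,17,-2,3,18,3,1,23,1,3]) (Split 10 86
321 (Split 18 289 164 (Leaf [1,0,10,7,3,5,10,4,6,11,-4,4,17,-3,5,18,7,1,23,3,5]) (Leaf
[1,2,4,7,2,4,10,2,4,18,2,4,23,2,4])) (Leaf [1,-2,4,10,-2,4,17,-2,4])))) (Leaf
[1,0,9,3,-16,7,4,19,-5,6,-3,10,11,-16,16,13,-3,10,21,3,2,22,3,-1,23,-22,15,27,0,9])))))) (Split 25
86 321 (Split 20 (-235) 235 (Split 13 (-86) 321 (Split 7 321 (-86) (Leaf
[2,9,5,5,9,5,6,-1,3,7,9,-5,12,8,8,20,0,10,22,8,-2,25,8,-2]) (Leaf
[2,12,7,5,12,7,6,-3,11,7,12,0,12,5,5,13,4,13,20,0,7,22,5,-2,25,9,11])) (Split 20 (-164) 289 (Leaf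
[2,3,3,5,3,3,12,3,3,20,3,3]) (Split 22 321 (-86) (Split 6 0 332 (Leaf
[6,0,3,7,1,-2,12,1,1,13,-1,2,20,-1,2,22,2,-1,25,1,1]) (Leaf
[6,-3,4,7,3,-4,13,-3,4,20,-3,4,22,3,-4])) (Leaf
[6,-1,4,7,3,-1,12,1,1,13,-2,3,20,-3,1,22,4,0,25,2,3])))) (Split 20 (-332) 0 (Split 20 (-289) 164
(Split 7 289 (-164) (Leaf [2,2,-2,5,2,-2,6,-2,9,7,17,-13,12,0,7,20,-15,11,22,15,-4,25,15,-4])
(Split 22 289 (-164) (Split 13 (-86) 321 (Leaf
[2,2,1,5,2,1,7,4,-1,13,2,1,20,-2,2,22,2,-2,25,4,-1]) (Leaf
[6,-1,2,7,3,-2,13,-1,2,20,-3,2,22,3,-2,25,2,0])) (Leaf [7,5,-1,20,-5,1,22,5,-1,25,5,-1]))) (Leaf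
[7,4,-1,20,-4,1,22,4,-1,25,4,-1])) (Split 21 0 332 (Split 17 86 321 (Split 15 235 235 (Leaf
[3,-1,3,5,3,0,10,-1,3,15,3,0,17,2,3,20,-2,-3,21,2,3]) (Leaf
[6,-1,4,7,4,-1,15,-1,4,17,3,4,20,-7,-3,22,7,3,25,3,3,26,4,0])) (Leaf
[3,-7,12,4,11,-3,7,11,-3,10,-7,12,17,-7,12,20,-4,-9,21,4,9])) (Leaf
[2,2,-2,7,4,-1,20,-2,-1,21,-2,2,22,4,-1,25,4,-1])))) (Split 13 0 332 (Split 26 321 86 (Split 6
(-86) 321 (Leaf [3,-18,5,4,18,-5,6,10,24,10,-18,5,13,10,24,25,-8,29,26,18,-5]) (Leaf
[3,-3,1,5,3,-1,6,-2,3,10,-3,1,13,1,2,25,-2,3,26,3,-1])) (Leaf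
[2,0,2,3,-4,-1,5,4,3,10,-4,-1,13,4,3,17,0,2,26,4,3])) (Split 13 (-164) 289 (Leaf
[6,-1,3,13,-1,3,25,-1,3]) (Leaf [6,-3,4,13,-3,4,25,-3,4]))))))) (Split 6 (-86) 321 (Split 25 (-86)
321 (Leaf [6,1,3,12,1,3,22,1,3,25,1,3]) (Split 27 235 235 (Leaf
[2,3,0,3,-1,1,4,4,-1,6,0,6,11,-1,1,12,0,6,22,-1,7,25,-4,7,27,3,0]) (Leaf
[1,0,3,3,-4,1,4,4,-1,6,0,11,11,-4,4,12,0,11,22,-4,15,25,-4,12,27,0,3]))) (Split 25 0 332 (Split 6
(-203) 263 (Split 25 164 289 (Leaf [6,3,3,12,3,3,22,3,3,25,3,3]) (Split 7 289 (-164) (Split 6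
(-164) 289 (Leaf [6,1,3,12,1,3,22,1,3,25,1,3]) (Leaf
[2,6,-4,5,6,-4,6,-5,7,7,6,-4,12,1,3,22,1,3,25,1,3])) (Leaf
[2,3,0,5,3,0,6,-2,4,7,3,0,12,1,4,22,1,4,25,1,4]))) (Leaf [2,4,-1,5,4,-1,6,-4,1,7,4,-1])) (Split 12
(-86) 321 (Leaf [3,-4,4,5,4,-4,6,-3,8,11,-4,4,12,1,4,18,1,0,22,-2,8,25,-3,8,26,1,0]) (Leaf
[6,-2,4,12,-2,4,18,1,0,22,-1,4,25,-2,4,26,1,0]))))) (Split 5 321 86 (Split 23 235 235 (Leaf
[2,10,-3,5,1,-3,6,-1,3,7,10,-3,21,-9,0,23,9,0]) (Leaf
[3,-4,4,5,2,-5,6,-2,5,11,-4,4,21,-2,-1,23,-2,5])) (Split 2 321 86 (Split 1 86 321 (Split 3 (-289)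
164 (Leaf [1,4,-1,3,-11,8,4,4,-1,7,4,-1,11,-7,7,21,-7,7]) (Leaf [1,4,-1,3,-4,1,4,4,-1,7,4,-1]))
(Leaf [1,-4,4,2,4,-4,11,-4,4,21,-4,4])) (Split 4 321 (-86) (Split 23 235 235 (Split 7 289 (-164)
(Leaf [2,3,-2,4,0,-2,7,3,-2,21,-3,0,23,3,0]) (Leaf [2,4,0,7,4,0,21,-4,0,23,4,0])) (Split 23 86 321
(Leaf [1,1,3,2,4,-4,3,-9,5,4,-5,-19,7,5,-1,11,-8,8,21,-18,-10,23,10,18]) (Leaf
[3,-3,3,4,3,-3,11,-3,3,23,-3,3]))) (Split 7 321 (-86) (Split 27 235 235 (Split 22 321 86 (Split 22
289 (-164) (Split 13 86 321 (Split 6 (-86) 321 (Leaf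
[2,3,0,4,1,2,6,1,2,13,1,2,21,-2,2,22,2,-2,27,3,0]) (Leaf
[2,12,-2,5,6,3,6,-3,2,7,3,-2,13,3,5,21,-6,5,22,6,-5,27,9,0])) (Leaf
[2,2,-1,4,1,2,6,-1,3,7,2,-1,13,-1,3,21,-1,3,22,1,-3])) (Leaf [2,4,0,21,-4,0,22,4,0,27,4,0])) (Leaf
[2,5,1,5,1,-1,6,-1,1,7,1,1,21,-4,-2,22,4,2,25,0,2,27,4,0])) (Split 27 86 321 (Split 13 86 321
(Split 6 (-86) 321 (Leaf [2,2,1,5,2,1,6,0,3,7,0,-3,13,2,4,27,2,4]) (Leaf
[2,2,1,5,2,1,6,-1,1,7,1,-1,13,1,2,27,1,2])) (Leaf [6,-1,3,7,1,-3,13,-1,3,27,-1,3])) (Leaf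
[6,-1,3,7,1,-3,13,-1,3,27,-1,3]))) (Leaf [2,4,2,4,4,2,7,4,2])))))) (Split 4 332 0 (Split 6 (-86)
321 (Split 7 332 0 (Split 1 86 321 (Split 4 289 (-164) (Split 7 289 (-164) (Leaf
[1,1,1,2,6,-6,3,-1,-1,4,7,-5,7,7,-5]) (Leaf [1,2,1,2,2,-2,3,-2,-1,4,4,-1,7,4,-1])) (Leaf
[1,2,1,2,2,-2,3,-2,-1,4,4,-1,7,4,-1])) (Split 5 332 0 (Leaf [2,2,-2,4,2,2,5,0,-4,6,0,4,7,2,-2])
(Split 27 235 235 (Split 25 (-86) 321 (Split 22 321 86 (Split 13 86 321 (Leaf
[6,2,4,13,2,4,25,2,4]) (Split 20 (-235) 235 (Leaf [1,0,3,2,2,-1,3,0,-3,5,2,2,12,2,2,20,2,2])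
(Split 14 321 (-86) (Split 15 235 235 (Split 13 (-86) 321 (Split 25 164 289 (Leaf
[6,2,3,13,2,3,25,2,3]) (Leaf [6,0,3,13,0,3,25,0,3])) (Split 25 86 321 (Split 20 (-332) 0 (Leaf
[6,1,1,7,7,-3,12,1,1,20,-7,3,22,8,-2,25,8,-2]) (Leaf
[6,0,4,7,2,-1,13,-2,4,15,2,0,17,0,2,18,2,-2,20,-2,-1,22,4,-1,25,2,3])) (Leaf
[6,-2,4,13,-2,4,25,-2,4]))) (Leaf [1,0,5,3,-5,-2,5,5,2,14,5,-3,15,0,5,17,0,5])) (Leaf
[3,-3,-1,5,3,1,14,3,1])))) (Leaf [6,1,4,12,1,4,22,1,4,25,1,4])) (Split 13 86 321 (Leaf
[1,0,5,2,5,-5,3,0,-5,4,2,-1,5,3,1,13,3,1,25,-2,1,27,5,0]) (Leaf [6,-2,4,13,-2,4,25,-2,4]))) (Split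
14 321 (-86) (Leaf [1,0,5,3,-5,-2,5,5,2,13,0,5,14,5,-3,27,0,5]) (Leaf [3,-3,-1,5,3,1,14,3,1])))))
(Leaf [1,1,3,2,1,-1,3,-1,-3,4,2,2,7,2,2])) (Split 5 332 0 (Leaf [2,4,-2,5,4,-2,6,-4,2,7,4,-2])
(Split 8 235 235 (Split 8 332 0 (Leaf [1,2,7,2,3,-3,3,-2,-1,4,5,-2,7,5,4,8,0,-6]) (Leaf
[3,-5,-2,5,5,2,6,-5,-1,8,5,2,13,0,1,25,0,1])) (Leaf
[1,1,3,2,4,-4,3,0,-5,5,4,1,6,-4,-1,7,5,-1,8,-1,2])))) (Leaf [1,1,3,2,1,-1,3,-1,-3,4,2,2,7,2,2]))))
(Split 17 (-164) 289 (Split 16 (-235) 235 (Split 10 (-86) 321 (Leaf [1,1,3,7,1,3,10,1,3,16,1,3])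
(Split 3 (-321) 86 (Split 16 (-86) 321 (Leaf [1,1,4,7,1,4,10,1,4,16,1,4]) (Split 4 321 (-86)
(Split 1 86 321 (Leaf [1,1,1,3,-2,1,4,2,-1,7,1,1,10,-1,2,16,-1,2]) (Leaf
[1,0,3,3,-2,1,4,2,-1,7,0,3,10,-2,4,16,-2,4])) (Leaf [1,1,4,3,-2,-2,4,2,2,7,1,4,10,-1,2,16,-1,2])))
(Split 16 0 332 (Leaf [1,1,3,7,1,3,10,1,3,16,1,3]) (Leaf
[1,1,4,3,-2,-2,4,2,2,7,1,4,10,-1,2,16,-1,2])))) (Split 4 332 0 (Split 3 (-332) 0 (Split 10 86 321
(Split 23 235 235 (Split 18 321 (-86) (Leaf [1,1,2,10,4,-1,11,-3,3,17,1,2,18,3,-3]) (Split 17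
(-86) 321 (Leaf [1,2,4,10,2,4,17,2,4]) (Split 9 (-235) 235 (Split 23 321 (-86) (Leaf
[1,1,4,7,3,2,9,1,4,17,-2,2,18,3,-2,23,3,-2,25,0,4,26,1,0]) (Leaf
[1,1,2,7,4,2,9,0,1,10,1,1,17,-3,0,18,4,1,23,4,1,25,0,1])) (Split 23 321 (-86) (Leaf
[1,1,4,7,2,1,9,-2,0,10,3,4,17,-1,3,18,4,1,22,2,2,23,2,-1,25,0,2]) (Leaf
[1,4,13,7,8,4,9,-2,0,10,7,12,11,-1,1,17,-4,9,18,11,3,22,2,2,23,8,2,25,0,2]))))) (Leaf
[1,1,4,7,0,3,10,4,1,11,-3,3,17,1,1,18,3,0,23,0,3])) (Split 16 (-289) 164 (Split 10 (-86) 321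
(Split 17 86 321 (Leaf [1,2,4,10,2,4,17,2,4]) (Split 1 164 289 (Leaf
[1,3,1,3,-2,1,4,2,-1,7,3,1,10,1,2,16,1,2]) (Leaf [1,1,11,7,2,4,10,1,11,16,2,4,17,-1,7]))) (Split
17 (-86) 321 (Split 1 86 321 (Split 3 (-289) 164 (Split 4 289 (-164) (Split 17 86 321 (Leaf
[1,2,0,3,-3,2,4,3,-2,10,-1,2,16,-3,2,17,2,0]) (Split 10 (-127) 307 (Leaf
[1,3,5,3,-2,1,4,2,-1,7,3,2,10,1,6,16,1,3,17,0,3]) (Leaf [3,-4,3,4,4,-3,10,-4,3,16,-4,3]))) (Leaf
[1,4,4,3,-4,-4,4,4,4,7,4,4])) (Leaf [1,4,4,3,-4,-4,4,4,4,7,4,4])) (Split 17 86 321 (Split 10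
(-164) 289 (Split 2 321 86 (Leaf [1,0,4,2,2,-1,4,2,-1,10,0,4,16,-2,1,17,2,3]) (Leaf
[1,0,10,2,3,2,4,3,2,7,-1,5,10,0,10,16,-4,3,17,4,7])) (Leaf
[1,0,2,3,-5,2,4,5,-2,7,0,2,10,-5,4,16,-5,4])) (Leaf [1,-2,4,10,-2,4,17,-2,4]))) (Leaf
[3,-3,1,4,3,-1,7,4,1,10,-3,1,16,1,2,17,-4,-1]))) (Split 1 86 321 (Split 10 (-164) 289 (Split 17 0
332 (Split 16 (-321) 86 (Split 10 (-86) 321 (Leaf [1,2,4,10,2,4,17,2,4]) (Leaf
[1,2,3,3,-3,1,4,3,-1,10,-1,4,16,-3,1,17,2,3])) (Leaf [1,3,3,3,-3,-3,4,3,3,16,-3,-3,17,3,3]))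
(Split 3 (-289) 164 (Split 0 (-235) 235 (Split 25 (-86) 321 (Split 25 164 289 (Leaf
[1,1,1,3,-1,-1,4,1,1,7,2,-1,16,-14,-2,17,-1,2,18,15,0,22,15,0,25,15,0]) (Split 10 0 332 (Leaf
[0,0,5,1,7,12,3,-5,2,4,5,-2,7,6,3,10,2,14,13,0,5,17,1,14,18,1,0,22,1,0,25,1,5]) (Leaf
[0,0,5,1,3,5,3,-5,2,4,5,-2,7,5,3,10,-2,7,13,0,5,17,-2,7,25,0,5]))) (Split 26 321 86 (Leaf
[1,4,6,3,-5,1,4,5,-1,7,3,2,10,-1,7,17,1,4,25,-2,3,26,2,-3]) (Split 13 0 332 (Leaf
[0,3,7,1,4,7,3,-5,2,4,5,-2,7,3,2,10,-1,9,13,3,7,17,4,12,25,-2,4,26,5,3]) (Leaf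
[0,0,5,3,-3,1,4,3,-1,7,0,4,10,0,1,13,-3,5,14,3,0,17,0,1,25,-3,5])))) (Split 23 235 235 (Split 23
321 (-86) (Leaf [1,2,3,3,-3,2,4,3,3,7,3,-2,10,-1,5,17,-1,5,21,0,5,23,0,-5]) (Split 18 289 (-164)
(Leaf [1,0,4,11,0,4,17,0,4,18,0,-4]) (Split 10 0 332 (Leaf
[1,3,5,7,4,1,10,3,5,17,-1,4,18,4,1,23,4,1]) (Split 0 (-321) 86 (Split 5 289 164 (Leaf
[0,-3,1,1,2,3,3,-3,1,5,3,-1,10,-1,4,17,-1,4]) (Split 13 164 289 (Leaf
[1,4,7,3,-11,-3,4,5,-2,5,6,5,7,5,3,10,-7,4,13,6,5,17,-1,4,25,0,5,26,6,0]) (Split 25 86 321 (Leaf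
[1,18,31,3,-21,-21,4,25,-10,5,-4,31,7,23,13,10,-3,10,13,-4,31,16,-22,-11,17,-5,18,18,24,3,22,24,
3,25,20,34]) (Leaf
[0,-11,6,1,15,26,3,-22,0,4,14,-6,5,8,6,7,11,6,10,-7,26,13,-3,12,17,-7,26,25,-3,12])))) (Leaf
[0,-14,-4,1,11,20,3,-16,-2,4,2,2,5,14,0,6,0,4,7,2,-2,10,-5,18,17,-5,18]))))) (Split 4 289 (-164)
(Leaf [1,1,1,3,-4,2,4,4,-2,7,1,1,11,-3,3,23,-3,3]) (Leaf [1,4,4,3,-4,-4,4,4,4,7,4,4])))) (Leaf
[1,4,4,3,-4,-4,4,4,4,7,4,4]))) (Leaf [3,-4,-1,4,4,1,10,-4,-1,16,-4,-1])) (Split 10 (-164) 289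
(Split 17 86 321 (Split 2 321 86 (Leaf [1,1,8,2,3,-1,3,-2,-2,4,5,1,10,-1,6,16,-5,-1,17,4,7]) (Leaf
[2,4,4,4,4,4,16,-4,-4,17,4,4])) (Leaf [1,-1,6,10,-1,6,17,-1,6])) (Leaf
[3,-3,-1,4,3,1,10,-3,-1,16,-3,-1]))))) (Leaf [1,3,3,3,-3,-3,4,3,3,7,3,3])) (Leaf
[1,3,3,3,-3,-3,4,3,3,7,3,3]))) (Split 23 235 235 (Split 18 321 (-86) (Leaf
[1,0,2,7,4,0,11,0,2,17,-4,2,18,4,-2,23,4,0]) (Split 23 289 (-164) (Split 2 289 164 (Leaf
[2,3,-1,4,3,3,7,3,-1,21,0,4,23,0,-4]) (Leaf [2,2,2,4,2,2,7,3,1,17,-1,1,18,1,-1,23,1,-1])) (Leaf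
[7,4,1,17,-4,-1,18,4,1,23,4,1]))) (Split 18 321 (-86) (Leaf
[1,1,4,3,-4,0,4,4,0,7,4,2,11,-3,4,17,-3,2,18,3,-2,23,0,2]) (Leaf
[1,1,3,3,-4,0,4,4,0,7,4,4,11,-3,3,17,-3,-1,18,3,1,23,0,4]))))) (Split 6 (-164) 289 (Split 5 332 0
(Split 7 289 164 (Split 2 289 164 (Leaf [1,-15,0,2,17,-3,4,3,3,5,14,-6,6,1,6,7,2,-3,14,15,0])
(Split 14 289 164 (Split 5 289 (-164) (Leaf [2,1,-1,4,2,2,5,-1,-3,6,1,3,7,1,-1]) (Leaf
[1,-4,1,2,4,-1,5,4,-1,14,4,-1])) (Split 6 0 332 (Leaf
[1,-4,-1,2,4,3,4,4,3,6,4,3,10,0,2,14,4,3,17,0,2]) (Split 5 321 (-86) (Leaf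
[2,3,-1,4,2,2,5,1,-3,6,-1,3,7,3,-1]) (Split 7 321 86 (Leaf
[1,-5,-1,2,6,-1,5,6,-1,6,-1,2,7,1,-2,14,5,1]) (Split 6 (-86) 321 (Split 10 (-86) 321 (Split 17
(-164) 289 (Leaf [1,-8,-2,2,24,12,4,14,14,5,10,-2,6,-1,8,7,15,6,10,1,4,14,9,6,17,1,4]) (Leaf
[1,-4,-1,2,7,4,4,4,4,5,3,0,6,0,2,7,4,2,11,-1,1,14,3,2,17,-1,1,18,1,-1])) (Leaf
[1,-5,-1,2,12,6,4,7,7,5,5,-1,6,-1,4,7,8,3,10,-1,2,14,4,3,17,-1,2])) (Leaf
[2,3,0,5,3,0,6,-3,0,7,3,0]))))))) (Split 2 321 86 (Leaf [1,-4,1,2,4,-1,5,4,-1,14,4,-1]) (Split 2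
263 203 (Split 6 0 332 (Leaf [1,-3,0,2,3,0,4,1,1,5,2,-1,6,1,1,14,3,0]) (Split 2 289 164 (Leaf
[1,-2,0,2,5,2,4,3,3,5,2,-1,6,0,1,7,3,2,14,2,0]) (Leaf
[1,-2,0,2,8,5,4,6,6,5,2,-1,6,0,1,7,6,5,14,2,0]))) (Leaf [2,3,3,4,3,3,7,3,3])))) (Split 5 289 164
(Split 14 321 (-86) (Leaf [1,-4,4,2,4,-4,5,4,-4,14,4,-4]) (Split 2 332 0 (Leaf
[1,-2,1,2,2,-1,3,-2,-2,5,4,1,14,4,1]) (Leaf [1,-4,-1,2,4,1,5,4,1,14,4,1]))) (Split 4 332 0 (Split
8 235 235 (Split 14 289 (-164) (Split 8 289 164 (Split 4 289 (-164) (Leaf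
[1,-3,3,2,3,-3,4,3,-3,8,3,-3]) (Leaf [1,-3,1,2,3,-1,4,3,-1,8,3,-1])) (Split 27 235 235 (Split 13
86 321 (Split 25 (-86) 321 (Leaf [8,2,4,13,2,4,14,-2,-4,25,2,4]) (Split 4 289 (-164) (Leaf
[1,-1,2,2,6,-2,4,3,-4,5,3,2,13,2,4,14,1,-2,25,-3,4,27,5,0]) (Leaf
[1,-2,2,2,9,-2,4,9,-2,8,5,4,13,3,6,14,-3,-6,25,-4,6,27,7,0]))) (Split 20 (-235) 235 (Leaf
[1,-2,4,2,2,0,5,2,0,12,0,4,14,2,-4,20,0,4]) (Split 25 86 321 (Leaf
[1,-3,0,8,2,2,13,-1,2,14,1,-2,20,-3,0,22,3,0,25,2,2]) (Leaf [8,-1,4,13,-1,4,14,1,-4,25,-1,4]))))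
(Leaf [1,-2,3,2,2,0,5,2,0,13,0,3,14,2,-3,27,0,3]))) (Split 8 321 86 (Leaf
[1,-4,2,2,4,-2,4,4,-2,8,4,-2]) (Split 2 289 164 (Split 4 289 (-164) (Leaf
[1,-4,4,2,4,-4,4,4,-4,8,4,-4]) (Leaf [1,-3,1,2,3,-1,4,3,-1,8,3,-1])) (Split 6 86 321 (Leaf
[1,-4,-1,2,4,1,4,5,-1,5,-1,2,6,5,-1,14,4,1]) (Split 25 (-164) 289 (Split 25 (-86) 321 (Split 20
(-235) 235 (Leaf [1,-2,2,2,19,15,4,2,-1,5,17,16,6,0,1,8,2,-2,12,17,17,20,17,17]) (Split 13 (-86)
321 (Split 27 235 235 (Split 13 164 289 (Split 27 321 86 (Leaf [2,4,-2,5,4,-2,13,4,-2,27,4,-2])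
(Leaf [2,4,2,5,4,2,13,4,2,27,4,2])) (Split 25 86 321 (Leaf
[1,-5,-1,2,2,1,5,2,1,6,-1,6,8,5,1,13,1,7,20,-3,0,22,3,0,25,4,7]) (Split 6 (-86) 321 (Leaf
[6,0,4,13,0,4,25,0,4]) (Leaf [1,-1,0,2,1,0,5,1,0,6,-1,4,8,1,0,13,0,4,25,0,4])))) (Split 13 164 289
(Leaf [1,-86,-23,2,87,66,5,87,66,7,1,1,8,86,23,13,87,66,25,87,24,27,0,42]) (Leaf
[1,-3,0,2,2,1,5,2,1,6,-1,7,8,3,0,13,1,8,25,2,7,27,-1,1]))) (Leaf
[1,-6,-1,2,1,1,5,1,1,13,-5,0,14,6,1,20,-5,0,22,5,0]))) (Split 13 86 321 (Split 27 235 235 (Split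
27 289 164 (Split 4 321 (-86) (Leaf [2,3,-3,4,3,-3,25,-3,3,27,3,-3]) (Leaf
[2,3,-1,4,3,-1,25,-3,1,27,3,-1])) (Split 6 0 332 (Leaf
[2,17,12,4,5,-2,5,12,14,6,1,8,13,13,22,25,-4,10,27,17,12]) (Leaf
[2,4,3,5,4,3,6,-1,2,13,3,5,25,-1,2,27,4,3]))) (Split 27 86 321 (Split 14 321 (-86) (Leaf
[1,-2,1,2,4,3,5,4,3,13,2,4,14,2,-1,27,2,4]) (Leaf [1,-4,-1,2,6,5,5,6,5,13,2,4,14,4,1,27,2,4]))
(Leaf [1,-5,-1,2,3,3,5,3,3,13,-2,2,14,5,1,27,-2,2]))) (Leaf [6,-1,3,13,-1,3,25,-1,3]))) (Split 13
86 321 (Split 27 235 235 (Split 4 289 (-164) (Leaf [2,3,0,4,2,-2,5,1,2,13,1,2,25,-2,2,27,3,0])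
(Leaf [2,4,0,4,4,0,25,-4,0,27,4,0])) (Split 27 86 321 (Split 14 321 (-86) (Leaf
[1,-2,1,2,4,3,5,4,3,13,2,4,14,2,-1,27,2,4]) (Leaf [1,-4,-1,2,6,5,5,6,5,13,2,4,14,4,1,27,2,4]))
(Leaf [1,-5,-1,2,3,3,5,3,3,13,-2,2,14,5,1,27,-2,2]))) (Leaf
[1,-3,0,2,3,0,4,4,-2,5,-1,2,13,-4,2,14,3,0,25,-4,2]))))))) (Split 7 289 (-164) (Split 10 (-86) 321
(Split 17 (-86) 321 (Leaf [6,5,3,7,-5,-20,8,0,20,10,5,20,13,0,3,14,5,0,17,5,20,25,0,3]) (Leaf
[1,-2,0,7,0,-4,8,0,4,10,-2,4,17,-2,4])) (Leaf [1,-2,0,7,0,-3,8,0,3,10,-2,3,17,-2,3])) (Split 22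
321 86 (Split 14 332 0 (Split 27 235 235 (Split 6 86 321 (Leaf
[1,-4,1,2,4,-1,4,4,-1,6,4,-1,14,4,-1]) (Split 14 289 (-164) (Split 25 (-86) 321 (Split 20 (-235)
235 (Leaf [1,-2,3,2,2,0,5,2,0,12,0,3,14,2,-3,20,0,3]) (Split 13 86 321 (Leaf
[2,1,0,5,1,0,7,1,0,8,0,3,13,1,3,14,0,-3,25,1,3]) (Leaf
[1,-1,0,8,0,4,13,-1,4,14,1,-4,20,-1,0,22,1,0,25,0,4]))) (Leaf
[2,2,0,5,2,0,8,-2,4,13,0,4,14,2,-4,25,-2,4,27,2,0])) (Split 2 289 164 (Leaf
[1,-3,1,2,3,-1,5,3,-1,14,3,-1]) (Split 13 86 321 (Split 25 0 332 (Leaf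
[2,3,2,5,3,2,6,0,3,7,3,2,13,3,5,25,3,5]) (Split 10 (-86) 321 (Split 27 289 164 (Split 17 (-86) 321
(Leaf [2,11,-3,5,11,-3,8,-8,14,10,3,11,14,11,-3,17,3,11,25,-8,14,27,8,-14]) (Leaf
[8,-3,7,10,-3,7,17,-4,7,18,1,0,22,1,0,25,-3,7,27,4,-7])) (Split 25 (-86) 321 (Leaf
[2,9,7,5,9,7,6,-1,7,13,8,14,25,-1,7,27,9,7]) (Leaf
[1,-4,-1,2,15,11,5,15,11,8,-3,3,13,8,13,14,7,-2,25,-3,3,27,11,10]))) (Leaf
[1,-3,0,2,3,0,5,3,0,10,-3,0,13,3,0,26,3,0]))) (Split 20 (-235) 235 (Leaf
[1,-1,0,2,4,3,5,4,3,12,3,3,14,1,0,20,3,3]) (Split 25 86 321 (Split 13 0 332 (Leaf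
[2,4,3,5,4,3,6,0,3,7,4,3,13,4,6,25,4,6]) (Leaf
[1,-12,-3,2,8,4,5,8,6,7,4,1,8,0,7,13,-4,10,14,12,-4,20,-8,0,21,0,2,22,8,-2,25,4,8])) (Leaf
[1,-4,-1,2,4,1,5,4,1,6,-2,15,8,-3,3,13,-5,18,14,7,-2,25,-5,18]))))))) (Split 13 86 321 (Split 2
289 164 (Split 14 289 (-164) (Leaf [1,-3,3,2,3,-3,5,3,-3,14,3,-3]) (Leaf
[1,-3,1,2,3,-1,5,3,-1,14,3,-1])) (Split 27 164 289 (Leaf
[1,-2,1,2,4,3,5,4,3,13,2,4,14,2,-1,27,2,4]) (Leaf [1,-4,2,2,3,2,5,3,2,13,-1,4,14,4,-2,27,-1,4])))
(Leaf [1,-4,4,13,-4,4,14,4,-4,27,-4,4]))) (Split 2 332 0 (Split 14 289 164 (Leaf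
[1,-2,1,2,2,-1,3,-2,-2,5,4,1,14,4,1]) (Leaf [1,-2,1,2,2,-1,3,-7,-7,5,9,6,14,9,6])) (Leaf
[1,-4,-1,2,4,2,5,4,2,10,0,1,14,4,2,17,0,1]))) (Split 25 86 321 (Leaf [6,4,4,12,4,4,22,4,4,25,4,4])
(Leaf [6,3,3,8,-5,5,11,-5,5,12,3,3,22,-2,8,25,-2,8]))))) (Split 2 321 (-86) (Split 6 0 332 (Leaf
[1,-4,2,2,4,-2,4,4,0,6,4,0,11,0,2,14,4,0,21,0,2]) (Leaf
[1,-3,2,2,3,-2,4,0,3,5,3,-3,6,0,3,11,0,2,14,3,0,21,0,2])) (Split 8 235 235 (Split 8 332 0 (Leaf
[1,-3,1,2,3,-1,4,3,-1,8,3,-1]) (Leaf [1,-4,-1,2,4,1,4,4,1,8,4,1])) (Split 14 321 (-86) (Leaf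
[1,-3,0,2,3,0,4,0,3,5,3,-3,8,0,3,14,3,-3]) (Leaf [1,-4,-1,2,4,1,4,1,4,5,3,-3,6,1,4,14,4,1])))))))
(Split 5 321 86 (Split 5 289 (-164) (Leaf [2,3,0,4,1,1,5,2,-1,6,-2,1,7,3,0]) (Leaf
[2,4,0,5,4,0,6,-4,0,7,4,0])) (Split 8 235 235 (Leaf [1,-4,0,2,4,0,5,4,0,6,-4,0,8,4,0]) (Split 7
289 (-164) (Split 8 164 289 (Leaf [1,-4,-1,2,5,0,5,5,0,6,-5,0,7,1,-1,8,4,1]) (Leaf
[2,1,0,5,1,0,7,1,-6,8,-1,6,10,0,6,14,1,0,17,0,6])) (Split 2 289 (-164) (Leaf
[1,-2,3,2,2,-3,5,2,0,11,0,3,14,2,0,21,0,3]) (Leaf [2,6,1,5,6,1,6,-6,-1,7,6,1]))))))) (Split 6 0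
332 (Split 3 (-289) 164 (Split 14 289 (-164) (Leaf [3,-7,5,4,1,1,5,6,-6,6,1,1,14,7,-5]) (Split 6
86 321 (Leaf [3,-3,-3,4,3,3,6,3,3,14,3,3]) (Leaf [3,-2,-2,4,1,3,5,1,-1,6,1,3,14,2,2]))) (Split 6
86 321 (Leaf [3,-4,-4,4,4,4,6,4,4,14,4,4]) (Leaf [3,-2,-2,4,0,4,5,2,-2,6,0,4,14,2,2]))) (Leaf
[2,3,0,4,-1,4,5,4,-4,6,-4,4,7,3,0]))"

lemma check_1100: "check edges [] (start cE cN cN cW) tree_1100"
  by code_simp

definition tree_1110 :: tree where
  "tree_1110 =
Split 22 321 86 (Split 5 321 86 (Split 1 (-86) 321 (Split 2 321 (-86) (Leaf
[1,1,4,2,-1,-4,3,-3,-3,5,2,-1,14,2,-1]) (Split 1 86 321 (Split 6 (-86) 321 (Split 10 86 321 (Split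
25 (-86) 321 (Split 13 (-86) 321 (Split 6 86 321 (Leaf [6,2,4,13,2,4,25,2,4]) (Split 13 164 289
(Leaf [6,2,3,13,2,3,25,2,3]) (Leaf [1,1,0,6,1,8,7,1,0,10,1,0,13,1,8,18,1,0,22,1,0,25,2,8])))
(Split 18 321 (-86) (Leaf [10,4,-1,13,-4,1,14,4,-1,18,4,-1,22,4,-1]) (Leaf
[10,3,1,11,1,-1,13,-4,0,14,4,0,18,3,1,22,4,0]))) (Split 13 86 321 (Split 3 (-332) 0 (Split 4 321
(-86) (Split 7 332 0 (Leaf [1,4,-1,3,-4,2,4,4,-2,7,4,-2,10,0,1,17,0,1]) (Split 9 (-235) 235 (Split
7 289 164 (Split 3 (-289) 164 (Split 9 (-164) 289 (Leaf [1,4,1,3,-3,2,4,3,-2,7,4,1,9,1,3,25,1,3])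
(Leaf [1,4,1,3,-7,4,4,7,-4,7,4,1,9,-3,5,25,-3,5])) (Leaf [1,3,1,3,-3,-1,4,3,1,7,3,1])) (Leaf
[1,2,4,3,-2,0,4,2,0,7,2,4,9,0,4,25,0,4])) (Split 9 (-321) 86 (Split 3 (-289) 164 (Split 6 86 321
(Leaf [3,-5,3,4,5,-3,6,2,3,9,-5,3,13,2,3,25,-3,6]) (Leaf
[3,-2,1,5,2,-1,6,-1,2,9,-2,1,13,1,1,25,-1,2])) (Leaf [3,-4,1,5,4,-1,9,-4,1,13,4,-1])) (Leaf
[3,-7,-2,4,3,3,5,4,-1,6,3,3,9,-7,-2,13,7,2])))) (Leaf [3,-2,0,4,1,3,5,1,-3,6,1,3,14,2,0])) (Split
27 235 235 (Leaf [1,4,-1,10,3,0,11,1,-1,18,3,0,22,4,-1,27,4,-1]) (Split 7 321 (-86) (Split 27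
(-86) 321 (Leaf [1,3,2,3,-3,-2,4,3,2,6,1,3,7,2,-1,13,1,3,27,1,3]) (Leaf
[1,1,1,3,-4,-1,4,4,1,6,1,3,7,3,-2,13,-2,3,14,3,0,27,-2,3])) (Leaf [1,3,1,3,-3,-1,4,3,1,7,3,1]))))
(Split 18 321 (-86) (Split 26 321 86 (Leaf [18,4,-2,22,4,-2,26,4,-2]) (Split 17 (-86) 321 (Leaf
[1,3,1,10,3,1,17,3,1]) (Split 0 (-235) 235 (Split 0 (-86) 321 (Leaf
[0,1,4,10,2,0,13,-1,4,14,2,0,17,1,4,26,-1,4]) (Leaf
[0,-1,2,13,-1,2,17,-1,2,18,2,-1,22,2,-1,26,1,1])) (Split 0 (-321) 86 (Leaf
[0,-2,1,1,1,1,10,1,1,13,-2,1,17,-1,2,18,2,-1,22,2,-1]) (Leaf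
[0,-7,-2,1,7,2,3,-7,-2,4,3,3,5,4,-1,6,3,3]))))) (Split 6 86 321 (Split 14 289 (-164) (Leaf
[11,4,-4,13,-4,4,14,4,-4,22,4,-4]) (Split 23 235 235 (Leaf
[1,4,0,7,4,0,10,3,1,11,1,-1,18,3,1,23,4,0]) (Split 14 332 0 (Split 3 (-332) 0 (Leaf
[3,-3,1,5,3,-1,14,3,-1]) (Leaf [3,-2,-1,4,2,1,6,2,1,11,2,-2,13,-2,2,14,4,-1,22,2,-2])) (Split 23
86 321 (Leaf [6,2,3,10,5,2,13,-3,1,14,5,2,18,5,2,22,3,-1,23,2,3]) (Leaf
[3,-3,0,4,3,0,6,2,3,10,2,2,13,-3,1,14,5,2,18,2,2,22,3,-1,23,-1,3]))))) (Leaf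
[6,-2,4,13,-2,4,25,-2,4]))))) (Split 17 0 332 (Split 17 164 289 (Leaf
[1,4,-1,11,4,-1,17,4,-1,22,4,-1,26,4,-1]) (Split 10 (-86) 321 (Leaf [1,2,3,10,2,3,17,2,3]) (Split
22 321 (-86) (Split 0 (-235) 235 (Leaf
[0,1,3,10,-2,3,11,3,-3,13,0,3,14,1,0,17,1,3,22,3,-3,26,3,0]) (Split 0 (-321) 86 (Split 3 (-289)
164 (Leaf [0,-7,4,1,8,0,3,-7,2,5,7,-2,10,-2,4,11,3,-2,13,0,2,17,1,4,22,3,-2,26,3,0]) (Leaf
[0,-2,1,1,10,13,3,-6,-6,4,6,6,6,2,6,7,4,0,10,-8,14,11,12,-7,13,0,7,17,4,14,22,12,-7,26,12,0]))
(Leaf [0,-7,-2,1,7,2,3,-7,-2,4,3,3,5,4,-1,6,3,3]))) (Leaf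
[1,2,3,10,-2,3,11,4,0,17,2,3,22,4,0,26,4,0])))) (Split 7 289 (-164) (Split 4 321 (-86) (Split 3
(-321) (-86) (Leaf [1,4,-1,2,3,-3,3,-4,1,4,7,-4,7,7,-4]) (Leaf
[1,1,1,2,3,-3,3,-1,-1,4,4,-2,7,4,-2])) (Leaf [3,-2,0,4,1,3,5,1,-3,6,1,3,14,2,0])) (Split 3 (-332)
0 (Split 0 (-235) 235 (Split 14 289 164 (Split 14 332 0 (Leaf [3,-4,2,5,4,-2,14,4,-2]) (Split 0
(-164) 289 (Leaf [0,6,7,3,-10,4,4,8,1,5,2,-5,7,8,1,10,-2,6,14,8,2,17,-2,6]) (Split 3 (-289) 164
(Leaf [0,-4,5,1,2,0,3,-4,5,5,4,-5,10,-2,5,17,-2,5]) (Leaf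
[0,-2,5,3,-10,3,5,10,-3,10,-2,5,14,8,2,17,-2,5])))) (Leaf
[0,0,3,3,-1,0,4,1,0,7,1,0,10,-1,3,14,0,3,17,-1,3])) (Split 0 (-321) 86 (Split 17 (-164) 289 (Leaf
[0,-3,1,1,2,3,3,-3,1,5,3,-1,10,-1,4,17,-1,4]) (Leaf [0,-6,2,1,2,3,3,-6,2,5,6,-2,10,-4,5,17,-4,5]))
(Leaf [0,-7,-2,1,7,2,3,-7,-2,4,3,3,5,4,-1,6,3,3]))) (Split 3 (-321) (-86) (Leaf
[1,4,1,3,-4,-1,4,4,1,7,4,1]) (Leaf [1,4,4,3,-4,-4,4,4,4,7,4,4])))))) (Leaf
[1,4,0,3,-4,0,4,1,1,5,3,-1,6,-3,1,7,4,0])) (Split 14 332 0 (Split 3 (-332) 0 (Leaf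
[3,-3,1,5,3,-1,14,3,-1]) (Split 14 289 (-164) (Leaf [1,-4,4,2,4,-4,5,4,-4,14,4,-4]) (Leaf
[1,-5,5,2,5,-5,3,-5,-2,5,10,-3,14,10,-3]))) (Split 10 86 321 (Split 9 (-235) 235 (Split 9 0 332
(Split 7 321 86 (Split 6 (-86) 321 (Leaf [2,3,-1,5,3,-1,6,2,6,7,3,-1,9,5,5,14,5,5,25,5,5]) (Leaf
[2,4,-1,5,4,-1,6,-4,1,7,4,-1])) (Leaf [1,1,4,7,1,4,9,1,4,25,1,4])) (Split 3 (-332) 0 (Split 4 321
(-86) (Split 6 0 332 (Split 25 (-86) 321 (Leaf [3,-3,1,5,3,-1,6,2,3,9,2,3,14,5,2,25,2,3]) (Split 3
(-321) 86 (Split 14 321 86 (Leaf [3,-4,2,5,4,-2,14,4,-2]) (Split 9 (-164) 289 (Leaf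
[3,-4,2,5,4,-2,6,3,7,9,3,7,14,7,5,25,3,7]) (Split 3 (-263) 203 (Leaf
[3,-7,6,4,6,-3,5,1,-3,6,2,5,9,-4,8,14,3,2,25,-4,8]) (Leaf
[3,-9,4,4,6,-3,5,3,-1,6,2,4,9,-4,7,14,5,3,25,-4,7])))) (Leaf
[3,-6,-2,4,3,3,5,3,-1,6,3,3,14,6,2]))) (Split 25 0 332 (Split 7 332 0 (Leaf
[2,3,-1,5,3,-1,6,-1,3,7,3,-1,9,2,2,14,2,2,25,2,2]) (Leaf
[1,0,2,2,3,-1,5,3,-1,6,-1,2,7,3,1,9,2,3,14,2,1,25,2,3])) (Leaf
[3,-10,4,5,10,-4,6,-3,7,9,-3,7,14,7,3,25,-3,7]))) (Leaf
[2,2,0,3,-2,-1,4,2,7,5,2,-6,6,0,7,7,2,0,14,2,1])) (Split 6 (-86) 321 (Leaf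
[3,-5,-2,4,3,3,5,2,-1,6,3,3,14,5,2]) (Leaf [1,0,4,2,4,-4,3,0,-4,4,1,1,5,3,-1,6,-3,1,7,4,0]))))
(Split 22 321 (-86) (Split 9 (-321) 86 (Split 18 321 86 (Leaf
[9,-7,4,10,4,-1,11,3,-3,18,4,-1,22,7,-4]) (Leaf [9,-4,2,10,1,1,11,3,-3,18,1,1,22,4,-2])) (Split 18
321 (-86) (Split 9 (-321) (-86) (Leaf [9,-2,0,10,2,0,18,4,-2,22,4,-2,26,2,-2]) (Leaf
[9,-1,-1,10,1,1,18,4,-2,22,4,-2,26,3,-3])) (Leaf [9,-4,-1,10,4,1,18,4,1,22,4,1]))) (Split 18 321
(-86) (Split 9 (-321) 86 (Split 17 (-86) 321 (Leaf [1,2,4,10,2,4,17,2,4]) (Leaf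
[1,-3,6,9,-5,3,10,2,3,17,-3,6,18,5,-3,22,5,-3])) (Leaf [9,-3,-1,10,3,1,18,3,1,22,3,1])) (Leaf
[9,-3,-1,10,3,1,18,3,1,22,3,1])))) (Split 10 (-86) 321 (Split 17 (-86) 321 (Split 17 164 289 (Leaf
[1,2,3,10,2,3,17,2,3]) (Leaf [1,0,3,10,0,3,17,0,3])) (Leaf [1,-2,4,10,-2,4,17,-2,4])) (Split 26
321 86 (Leaf [10,-4,1,11,4,-1,22,4,-1,26,4,-1]) (Split 17 86 321 (Split 13 86 321 (Leaf
[1,0,4,2,2,-1,3,-2,0,5,4,-1,10,-2,4,13,4,-1,17,2,3,26,4,-1]) (Split 16 (-235) 235 (Split 6 (-164)
289 (Leaf [6,2,15,10,-9,9,11,9,-9,12,5,5,13,-3,10,16,2,15,22,14,-4,26,11,6]) (Leaf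
[1,0,1,2,4,-1,5,4,-1,6,-4,1,7,4,0,10,0,1,16,0,1])) (Split 10 (-203) 263 (Split 16 (-289) 164
(Split 6 86 321 (Split 2 321 86 (Leaf
[1,-3,11,2,10,0,4,10,0,6,1,6,10,-7,14,11,4,-3,12,2,2,13,-1,4,16,-9,6,17,7,11,22,6,-1,26,5,3])
(Leaf
[1,-6,9,2,17,10,4,17,10,6,9,16,10,-9,18,11,15,-4,13,-3,11,14,12,5,16,-8,6,17,11,19,22,15,-4,26,
12,7])) (Leaf
[1,5,24,2,10,3,4,10,3,6,-4,14,10,-14,29,11,19,-5,13,-4,14,16,-14,11,17,15,27,22,19,-5,26,15,9]))
(Leaf [1,0,6,2,4,1,3,-3,0,4,7,1,10,-3,6,16,-7,-1,17,4,7])) (Leaf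
[10,-4,1,11,4,-1,22,4,-1,26,4,-1])))) (Leaf [1,-2,4,10,-2,4,17,-2,4])))))))) (Split 7 289 164
(Split 5 321 (-86) (Split 6 (-86) 321 (Leaf [2,2,-1,4,3,3,5,-1,-4,6,1,4,7,2,-1]) (Leaf
[2,3,-3,5,3,-3,6,-3,3,7,3,-3])) (Split 14 332 0 (Leaf [1,-4,2,2,4,-2,5,4,-2,14,4,-2]) (Split 2 321
86 (Leaf [1,-3,1,2,3,-1,5,3,-1,14,3,-1]) (Split 6 (-86) 321 (Split 6 0 332 (Leaf
[1,-4,-1,2,4,1,4,1,1,5,3,0,6,1,1,14,4,1]) (Split 7 321 86 (Leaf
[1,-4,-1,2,5,0,5,5,0,6,-1,1,7,1,-1,14,4,1]) (Split 14 289 164 (Leaf [1,-4,0,2,4,0,5,4,0,14,4,0])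
(Split 17 (-86) 321 (Split 10 (-86) 321 (Leaf
[1,-15,-4,2,20,11,5,20,11,6,-2,3,7,2,-3,10,3,10,14,18,14,17,3,10]) (Leaf
[1,-5,-1,2,9,5,4,5,5,5,4,0,6,0,3,7,5,2,10,-1,2,14,4,3,17,-1,2])) (Leaf
[1,-5,-1,2,9,5,4,5,5,5,4,0,6,0,3,7,5,2,10,-1,2,14,4,3,17,-1,2]))))) (Leaf
[1,-4,-1,2,11,0,5,11,0,6,-7,1,7,7,-1,14,4,1]))))) (Split 2 321 86 (Leaf
[1,-3,1,2,3,-1,5,3,-1,14,3,-1]) (Split 6 0 332 (Leaf
[1,-7,0,2,6,3,4,4,4,5,2,-1,6,5,1,7,-1,3,14,7,0]) (Split 2 263 203 (Split 5 321 (-86) (Leaf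
[2,6,3,4,5,5,5,1,-2,6,-1,2,7,6,3]) (Split 2 289 164 (Leaf [1,-3,0,2,3,0,5,3,0,14,3,0]) (Leaf
[1,-1,0,2,3,2,4,2,2,5,1,0,7,2,2,14,1,0]))) (Leaf [2,3,3,4,3,3,7,3,3])))))) (Split 26 321 86 (Split
2 321 (-86) (Split 18 321 (-86) (Leaf [18,4,-2,22,4,-2,26,4,-2]) (Split 1 0 332 (Leaf
[1,4,4,2,-1,-4,3,-4,-4,4,3,0,7,3,0]) (Split 18 321 86 (Split 22 321 (-86) (Leaf
[18,4,-2,22,4,-2,26,4,-2]) (Split 1 (-86) 321 (Leaf
[1,0,2,2,0,-2,3,-1,-1,5,1,-1,6,0,1,10,0,1,14,1,0,18,3,0,22,3,0,25,0,1,26,3,-1]) (Leaf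
[1,-1,1,2,1,-1,5,1,-1,6,0,1,10,0,1,14,1,0,18,4,0,22,4,0,25,0,1,26,4,-1]))) (Leaf
[1,-2,4,2,2,-4,5,2,0,10,0,4,14,2,0,18,0,4,21,0,4])))) (Split 18 321 86 (Split 26 289 (-164) (Leaf
[18,4,-3,22,4,-3,26,4,-3]) (Split 18 321 (-86) (Leaf [18,4,-2,22,4,-2,26,4,-2]) (Split 22 289
(-164) (Leaf [18,3,-2,22,3,-2,26,3,-2]) (Leaf [18,5,-1,22,5,-1,26,5,-1])))) (Split 10 (-86) 321
(Split 14 332 0 (Split 7 321 86 (Split 3 (-321) (-86) (Split 13 0 332 (Split 25 0 332 (Split 8 235
235 (Split 22 321 (-86) (Leaf
[2,4,1,5,4,1,6,0,8,7,4,-1,8,16,-7,10,2,7,11,14,-14,13,4,9,17,0,2,18,2,5,22,16,-9,25,20,0]) (Leaf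
[8,4,0,10,1,3,11,3,-3,18,1,3,22,4,0,25,4,0])) (Split 7 321 (-86) (Split 17 86 321 (Leaf
[2,8,2,5,8,2,7,2,-8,8,0,12,10,3,11,13,5,3,14,3,-1,17,6,10,25,2,4,26,3,-1]) (Split 17 (-164) 289
(Split 22 321 (-86) (Leaf
[2,8,2,5,8,2,7,9,-5,8,0,6,10,2,7,11,4,-4,13,2,5,14,6,-3,17,-1,7,18,3,0,22,7,-4,25,9,1]) (Leaf
[2,7,2,5,7,2,7,8,-7,8,0,11,10,3,11,11,2,-2,13,2,4,14,5,-2,17,-1,9,18,4,2,22,6,0,25,8,4])) (Leaf
[7,3,-2,8,0,2,10,0,2,17,-3,2,18,3,0,22,3,0,25,3,0]))) (Split 2 321 86 (Leaf
[2,6,0,5,6,0,7,6,0,10,1,2,11,4,-4,13,1,2,14,5,-2,18,1,2,22,5,-2,25,6,0]) (Leaf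
[2,14,8,5,14,8,7,14,8,10,1,4,11,8,-8,13,5,12,14,9,-4,18,1,4,22,9,-4,25,14,8])))) (Split 27 235 235
(Split 27 321 86 (Split 6 86 321 (Leaf
[2,3,0,4,3,0,6,3,0,10,0,1,11,2,-2,12,1,1,14,2,-1,17,0,1,22,3,-1,27,3,-1]) (Split 25 (-86) 321
(Leaf [2,2,-2,5,2,-2,6,-1,4,13,1,2,25,-1,4,27,2,-2]) (Leaf
[2,7,-4,4,3,0,5,4,-4,6,-2,8,13,2,4,25,-5,8,27,7,-4]))) (Split 1 86 321 (Leaf
[1,4,-1,10,1,2,11,3,-3,18,1,2,22,4,-1,27,4,-1]) (Split 2 321 86 (Split 22 321 (-86) (Leaf
[2,3,-3,5,3,-3,11,3,-3,14,3,-3,22,3,-3,27,3,-3]) (Split 10 86 321 (Leaf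
[1,-1,3,2,6,-3,5,6,-3,10,3,2,11,2,-2,14,6,-3,18,3,2,22,5,0,27,5,0]) (Leaf
[1,-1,2,2,5,-2,5,5,-2,10,0,4,11,4,-4,14,5,-2,18,0,4,22,4,0,27,4,0]))) (Split 13 164 289 (Leaf
[2,4,2,5,4,2,13,4,2,27,4,2]) (Split 10 0 332 (Split 6 (-164) 289 (Split 6 (-86) 321 (Split 4 321
(-86) (Split 6 86 321 (Leaf
[1,-1,4,2,3,-3,3,-26,7,4,29,-10,6,28,-7,13,1,4,14,27,-11,25,-1,3,27,2,1]) (Split 22 321 (-86)
(Split 23 235 235 (Split 25 (-86) 321 (Leaf [6,0,3,13,0,3,25,0,3]) (Leaf
[6,0,14,10,1,3,11,6,-6,13,-7,17,14,7,-3,18,4,2,23,10,-4,25,-10,18,26,3,-1])) (Leaf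
[6,0,4,13,0,4,22,0,-4,23,0,4])) (Split 26 321 (-86) (Split 25 (-86) 321 (Leaf
[6,0,4,13,0,4,25,0,4]) (Split 1 (-164) 289 (Split 14 289 (-164) (Leaf
[1,0,3,2,2,-2,4,2,-2,13,0,3,14,0,-3,25,-2,2,27,2,1]) (Split 27 263 203 (Leaf
[2,5,-3,4,5,-3,6,0,5,13,0,5,25,-5,8,27,5,-3]) (Split 10 164 289 (Leaf
[1,0,2,2,7,4,5,7,4,10,4,2,11,2,-2,13,1,6,14,6,-2,18,4,2,22,6,0,27,7,6]) (Leaf
[1,-1,8,2,14,8,5,14,8,10,3,12,11,7,-7,13,3,11,14,11,-3,18,12,7,22,19,0,26,9,-5,27,13,16])))) (Leaf
[1,-7,3,2,7,-3,4,3,-5,5,4,2,13,-3,5,14,7,-3,25,-3,5]))) (Leaf [18,4,2,22,4,2,26,4,2])))) (Leaf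
[2,10,6,4,10,6,6,5,18,13,5,18,25,-5,12,27,10,6])) (Leaf [6,-3,7,13,-3,7,25,-3,7])) (Leaf
[6,-3,3,13,-3,3,25,-3,3])) (Leaf [10,-5,5,11,5,-5,18,-1,4,22,4,-1,26,4,-1])))))) (Split 6 (-86)
321 (Split 25 (-86) 321 (Split 13 164 289 (Leaf [6,3,4,13,3,4,25,3,4]) (Leaf
[6,1,3,13,1,3,25,1,3])) (Split 23 235 235 (Split 10 164 289 (Split 8 235 235 (Leaf
[8,3,0,10,2,1,11,1,-1,18,2,1,23,3,0]) (Split 23 289 164 (Leaf
[6,3,1,10,2,1,11,3,-3,13,-2,3,14,5,-2,18,2,1,23,5,-2,25,-2,3]) (Split 8 164 289 (Split 18 307 127
(Leaf [18,4,-1,23,4,-1,25,-4,1,26,4,-1]) (Leaf [8,5,7,10,5,7,18,9,6,23,9,6,25,-4,1,26,4,-1]))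
(Leaf [6,3,1,8,-5,3,13,-2,4,14,5,-3,25,-2,4])))) (Split 26 321 (-86) (Leaf
[10,-3,3,11,3,-3,23,3,-3,25,-3,3,26,3,-3]) (Leaf [10,-1,1,11,1,-1,18,2,1,23,3,0,25,-3,0,26,3,0])))
(Split 26 321 (-86) (Split 27 86 321 (Split 1 (-86) 321 (Split 10 164 289 (Split 22 321 (-86)
(Split 23 86 321 (Leaf [1,8,15,6,2,5,10,8,15,13,2,5,18,5,3,22,3,-2,23,2,5,26,-3,-12,27,8,15])
(Leaf [1,3,12,2,4,0,4,4,0,6,2,7,10,3,12,13,2,7,22,2,-7,23,-2,7,26,-3,-12,27,7,12])) (Leaf
[1,1,2,10,1,2,18,2,1,22,2,1,26,1,-1,27,1,2])) (Leaf
[1,2,7,10,1,8,11,1,-1,22,1,-1,26,-1,-8,27,2,7])) (Split 2 321 86 (Leaf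
[1,-3,1,2,3,-1,5,3,-1,14,3,-1]) (Split 13 86 321 (Split 14 321 (-86) (Leaf
[1,-3,2,2,6,3,5,6,3,13,3,5,14,3,-2,27,3,5]) (Leaf [1,-6,1,2,9,5,5,9,5,13,3,6,14,6,-1,27,3,6]))
(Leaf [1,-3,3,13,-3,3,14,3,-3,27,-3,3])))) (Split 1 86 321 (Split 4 332 0 (Leaf
[1,2,3,3,-3,1,4,3,-1,7,3,-1,10,-1,4,26,1,-4,27,-1,4]) (Leaf
[1,9,8,3,-14,-6,4,14,6,6,2,9,7,12,-3,13,-3,11,14,5,-2,27,-3,11])) (Leaf
[1,-1,3,10,-1,3,26,1,-3,27,-1,3]))) (Split 22 321 (-86) (Split 6 164 289 (Leaf
[3,-4,1,4,5,0,6,5,0,11,1,-1,13,0,2,14,5,-2,21,1,1,22,0,-2]) (Split 23 0 332 (Split 18 289 164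
(Leaf [6,1,2,13,1,2,18,4,0,22,3,-2,23,1,2,26,4,0]) (Leaf
[6,2,5,13,2,5,18,4,4,22,2,-1,23,2,5,26,4,4])) (Leaf
[3,-4,1,4,5,0,6,1,9,13,-3,10,14,4,-1,21,1,1,22,3,-10,23,-4,9]))) (Leaf [18,4,2,22,4,2,26,4,2])))))
(Split 7 332 0 (Split 2 321 86 (Leaf [2,3,-1,5,3,-1,6,-3,1,7,3,-1]) (Split 7 289 (-164) (Leaf
[2,2,1,5,2,1,6,-2,3,7,2,-3,13,0,4,27,0,4]) (Split 27 164 289 (Split 13 164 289 (Leaf
[2,5,3,5,5,3,6,-2,1,7,2,-1,13,3,4,27,3,4]) (Leaf [2,5,3,5,5,3,6,-4,1,7,4,-1,13,1,4,27,1,4])) (Leaf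
[2,2,1,5,2,1,6,-3,1,7,3,-1,13,-1,2,27,-1,2])))) (Leaf [2,4,1,5,4,1,6,-4,-1,7,4,1]))))) (Leaf
[11,2,-2,12,1,1,13,-3,1,14,2,-2,22,3,-1])) (Split 27 235 235 (Leaf
[1,0,2,2,3,-3,3,1,-4,5,2,1,11,2,-2,12,1,1,14,1,0,22,3,-1,27,3,-1]) (Split 1 86 321 (Leaf
[1,2,3,3,-2,-3,4,2,0,5,0,3,7,2,0,13,0,3,27,0,3]) (Leaf
[1,-1,4,2,1,-1,3,1,-4,5,0,3,13,0,3,27,0,3])))) (Split 23 235 235 (Split 1 86 321 (Leaf
[1,4,0,7,4,0,10,1,3,11,3,-3,18,1,3,23,4,0]) (Split 25 0 332 (Leaf
[1,-2,8,2,6,2,5,6,2,7,4,10,10,1,2,11,3,-3,13,0,11,14,6,-9,18,1,2,22,4,-1,25,4,10]) (Split 1 0 332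
(Leaf [1,2,2,7,2,2,10,1,3,11,1,-1,18,2,1,23,3,0,25,-1,2,26,1,-2]) (Leaf
[1,-3,7,2,7,2,5,7,2,7,4,9,10,1,4,11,3,-3,13,0,8,14,7,-6,18,5,3,23,8,0,25,-4,9,26,4,-1])))) (Split
1 0 332 (Leaf [1,1,3,3,-1,0,4,1,0,7,1,3,10,0,3,18,0,3,23,0,3]) (Leaf
[1,-2,5,2,2,0,5,2,0,7,0,5,10,0,4,12,0,1,14,2,-1,18,0,4,23,0,5])))) (Split 10 86 321 (Split 17
(-86) 321 (Split 1 (-86) 321 (Leaf [1,2,4,10,2,4,17,2,4]) (Leaf
[1,-15,-4,2,15,4,5,15,6,10,0,2,14,15,6,18,0,2,21,0,2])) (Split 21 (-86) 321 (Leaf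
[5,3,2,10,3,2,14,3,2,18,3,2,21,3,2]) (Split 23 235 235 (Split 7 321 (-86) (Split 6 (-86) 321 (Leaf
[6,2,3,7,1,-3,10,2,3,14,2,3,17,-1,3,18,3,0,23,3,0]) (Leaf
[2,2,0,5,2,0,6,-1,2,7,3,-2,10,1,2,14,1,2,17,-1,2,18,2,0,23,2,0])) (Split 23 332 0 (Leaf
[2,12,3,5,7,12,7,12,3,10,7,4,13,0,8,14,7,4,18,7,4,21,-5,9,23,12,-5,25,0,8]) (Leaf
[2,7,3,5,7,3,7,19,6,10,4,6,11,3,-3,14,7,3,17,-12,-3,18,16,9,23,19,6]))) (Split 23 0 332 (Split 6
(-86) 321 (Leaf [6,1,3,10,1,3,14,1,3,18,1,3,23,1,3]) (Split 7 289 (-164) (Leaf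
[3,-2,0,5,2,0,6,-2,4,7,2,-4,10,-2,4,14,0,4,17,-2,4]) (Split 7 321 (-86) (Leaf
[2,4,1,5,4,1,6,-4,7,7,6,-2,10,0,8,14,0,8,17,-2,3,18,2,5,23,2,5]) (Split 2 289 164 (Leaf
[2,5,1,5,5,1,6,-3,4,7,5,1,10,2,5,14,2,5,18,2,5,23,2,5]) (Leaf
[2,3,2,5,3,2,6,-1,2,7,3,2,10,2,4,14,2,4,18,2,4,23,2,4]))))) (Split 6 86 321 (Leaf
[3,-5,0,4,5,0,6,4,6,10,-1,5,13,0,1,14,4,5,18,-1,5,22,1,0,23,-2,5,25,1,1]) (Leaf
[6,-2,6,10,0,4,13,-2,2,14,0,4,18,0,4,22,3,-1,23,-3,5,25,1,1])))))) (Split 22 332 0 (Split 22 289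
(-164) (Leaf [10,-4,4,11,4,-4,22,4,-4,26,4,-4]) (Leaf [10,-2,2,11,2,-2,18,2,1,22,4,-1,26,4,-1]))
(Leaf [6,0,2,10,-1,3,11,1,-1,14,0,2,18,3,2,22,4,1,25,0,2,26,4,-1])))) (Leaf
[10,-3,1,11,3,-1,22,3,-1,26,3,-1])))) (Split 9 (-235) 235 (Split 1 86 321 (Split 7 332 0 (Split 4
321 (-86) (Split 3 (-321) 86 (Leaf [1,4,-1,3,-4,2,4,4,-2,7,4,-2,10,0,1,17,0,1]) (Leaf
[1,4,1,3,-4,-1,4,4,-1,5,0,2,7,4,-1,13,0,2,17,0,2,26,0,2])) (Split 4 332 0 (Leaf
[1,4,0,3,-4,0,4,4,0,6,0,2,7,4,-2,13,0,2,17,0,2,26,0,2]) (Leaf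
[1,5,2,3,-5,-2,4,5,2,6,0,4,7,5,-2,13,0,4,17,0,4,26,0,4]))) (Split 4 321 (-86) (Split 25 (-86) 321
(Leaf [1,4,4,7,4,4,9,4,4,25,4,4]) (Split 9 (-164) 289 (Leaf [1,3,3,9,3,3,17,3,3,26,3,3]) (Split 3
(-321) 86 (Split 7 321 86 (Leaf [1,3,0,3,-4,2,4,4,-2,7,3,0,9,-1,2,25,-1,2]) (Leaf
[1,1,1,3,-2,1,4,2,-1,7,1,1,9,-1,2,25,-1,2])) (Leaf [1,4,2,3,-4,-2,4,4,2,7,4,2])))) (Leaf
[1,3,1,3,-3,-1,4,3,1,7,3,1]))) (Split 1 (-164) 289 (Split 17 (-86) 321 (Split 17 86 321 (Leaf
[1,3,3,9,3,3,17,3,3,26,3,3]) (Leaf [1,0,3,9,0,3,17,0,3,26,0,3])) (Split 9 0 332 (Leaf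
[1,0,3,9,1,2,10,-1,1,17,0,3,26,1,2]) (Split 18 289 164 (Split 9 (-164) 289 (Leaf
[1,-1,4,9,-1,4,17,-1,4,26,-1,4]) (Split 18 321 (-86) (Leaf
[1,-1,2,9,-1,2,17,-1,2,18,2,-1,22,2,-1,26,1,1]) (Split 22 289 (-164) (Leaf
[1,-1,4,9,-8,11,11,7,-7,17,-1,4,22,7,-7,26,-1,4]) (Leaf
[1,-5,9,9,-5,9,17,-5,9,18,3,0,22,3,0,26,-2,9])))) (Leaf
[1,-1,5,9,-3,7,11,2,-2,17,-1,5,18,-1,3,22,1,1,26,-2,8])))) (Split 2 332 0 (Split 2 289 (-164)
(Leaf [1,-2,2,2,2,-2,3,-2,-2,5,4,0,14,4,0]) (Leaf [1,-3,0,2,3,0,5,3,0,14,3,0])) (Leaf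
[1,-3,0,2,3,1,5,3,1,13,0,1,14,3,0,17,0,1,26,0,1])))) (Split 13 (-86) 321 (Split 25 (-164) 289
(Split 6 (-86) 321 (Split 13 0 332 (Split 9 (-321) 86 (Split 3 (-321) 86 (Split 13 164 289 (Split
2 321 (-86) (Leaf [1,0,3,2,0,-3,3,-2,-2,5,2,-1,9,-2,1,13,2,-1]) (Split 4 289 (-164) (Split 25
(-86) 321 (Leaf [6,3,4,13,3,4,25,3,4]) (Leaf [3,-4,2,4,1,-4,5,3,2,9,-4,2,13,3,2,25,-1,4])) (Split
6 0 332 (Leaf [6,3,4,13,3,4,25,3,4]) (Split 25 (-86) 321 (Leaf [6,2,3,13,2,3,25,2,3]) (Split 4 321
(-86) (Split 7 332 0 (Leaf [3,-2,-1,5,2,1,6,0,2,7,0,-2,9,-2,-1,13,2,3,17,0,2,26,0,2]) (Split 1 86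
321 (Leaf [1,5,2,3,-11,1,4,7,-3,5,4,2,7,5,2,9,-6,3,13,4,2,25,-2,5]) (Split 2 321 86 (Leaf
[1,-5,3,2,10,-1,4,7,-3,5,3,2,7,5,2,9,-5,3,13,3,2,25,-2,5]) (Leaf
[2,7,4,3,-9,5,4,10,-4,5,6,3,7,7,4,9,-9,5,13,6,3,25,-3,8])))) (Leaf
[3,-3,-3,4,3,3,6,3,3,9,-3,-3,13,3,3])))))) (Split 25 (-86) 321 (Leaf [6,1,4,13,1,4,25,1,4]) (Split
6 164 289 (Leaf [6,3,3,13,3,3,25,3,3]) (Split 6 0 332 (Leaf [6,3,11,13,3,11,25,3,11]) (Leaf
[6,-1,4,13,-1,4,25,-1,4]))))) (Leaf [3,-3,-3,5,3,3,9,-3,-3,13,3,3])) (Leaf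
[3,-3,-3,5,3,3,9,-3,-3,13,3,3])) (Split 25 0 332 (Split 25 164 289 (Leaf [6,3,4,13,3,4,25,3,4])
(Leaf [6,1,4,13,1,4,25,1,4])) (Split 6 86 321 (Split 14 321 86 (Leaf
[3,-10,0,4,10,0,6,7,12,11,4,-4,12,2,2,13,-9,14,14,14,-4,22,6,-2,25,-3,12]) (Split 4 289 (-164)
(Leaf [3,-3,-1,4,4,-3,5,-1,4,6,2,3,13,-2,6,14,3,1,25,-2,6]) (Leaf [3,-3,-3,4,3,3,6,3,3,14,3,3])))
(Leaf [6,-1,4,13,-1,4,25,-1,4])))) (Split 2 321 86 (Split 7 321 86 (Leaf
[2,3,-1,5,3,-1,6,-3,1,7,3,-1]) (Split 1 86 321 (Leaf [1,4,1,3,-4,-1,5,4,1,6,-4,-1,7,4,1]) (Split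
25 (-86) 321 (Split 13 86 321 (Leaf
[1,-2,8,2,11,-3,3,-8,-8,5,19,5,6,-5,8,7,9,5,9,-10,0,13,14,13,25,4,13]) (Split 16 (-235) 235 (Leaf
[1,0,3,2,4,-1,5,4,-1,6,-4,7,7,4,2,10,0,3,13,0,6,16,0,9,26,0,6]) (Split 25 86 321 (Split 16 (-332)
0 (Split 18 332 0 (Leaf
[1,0,2,2,3,-1,3,-2,-2,5,5,1,6,-5,9,7,3,1,9,-2,0,13,0,10,16,-7,3,18,7,-3,22,7,-3,25,5,7]) (Leaf
[1,0,9,2,11,-3,5,11,5,6,-11,18,7,11,6,10,0,9,13,0,23,16,-12,4,18,12,5,21,0,8,22,12,-3,25,12,20]))
(Leaf [2,6,-1,5,6,2,6,-9,15,7,6,-6,13,-3,17,16,-11,-5,17,0,5,18,11,0,21,0,3,22,11,-3,25,8,14]))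
(Leaf [6,-2,4,13,-2,4,25,-2,4])))) (Leaf
[1,-1,2,2,3,-1,3,-2,-2,5,5,1,6,-5,-1,7,2,1,9,-3,0,25,-3,0])))) (Split 7 332 0 (Leaf
[2,3,2,5,3,2,6,-3,1,7,3,-1,13,0,3,17,0,3,26,0,3]) (Leaf
[2,4,2,5,4,2,6,-4,-1,7,4,1,13,0,1,17,0,1,26,0,1])))) (Split 4 321 (-86) (Split 9 (-289) 164 (Split
3 (-289) 164 (Leaf [3,-4,2,4,4,-2,9,-4,2,25,-4,2]) (Leaf [3,-4,-1,4,4,1,9,-4,-1,25,-4,-1])) (Leaf
[3,-4,-1,4,4,1,9,-4,-1,25,-4,-1])) (Leaf [3,-4,-2,4,4,2,9,-4,-2,25,-4,-2]))) (Split 6 86 321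
(Split 14 289 164 (Split 22 321 (-86) (Leaf [11,3,-3,13,-3,3,14,3,-3,22,3,-3]) (Leaf
[11,2,-2,12,2,2,13,-4,0,14,2,-2,22,4,0])) (Split 11 321 86 (Leaf
[11,4,-1,13,-4,1,14,4,-1,22,4,-1]) (Split 25 0 332 (Split 22 289 (-164) (Split 13 (-203) 263
(Split 25 86 321 (Leaf [6,2,2,11,4,-3,13,-2,5,14,4,-3,22,4,-3,25,2,2]) (Split 13 (-164) 289 (Leaf
[3,-3,-3,4,3,0,5,0,3,6,4,7,13,1,7,14,3,3,25,1,7]) (Leaf
[3,-2,-2,4,2,0,5,0,2,6,3,5,11,8,-6,13,-7,11,14,10,-4,22,8,-6,25,1,5]))) (Leaf
[11,3,-2,13,-3,2,14,3,-2,22,3,-2])) (Leaf [6,6,10,11,9,5,13,-3,5,14,9,5,22,9,5,25,6,10])) (Leaf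
[3,-5,-5,4,6,0,5,-1,5,6,3,5,13,-3,5,14,5,5,25,-3,5])))) (Split 16 (-235) 235 (Split 16 0 332 (Leaf
[6,4,10,10,0,5,11,5,-5,12,3,3,13,-4,7,14,5,0,16,4,10,22,8,-2,26,4,5]) (Leaf
[6,-7,25,10,0,2,11,7,-2,13,-14,25,14,7,0,16,-7,25,18,1,0,22,8,-2,26,-6,23])) (Split 18 321 86
(Split 25 86 321 (Split 16 (-321) (-86) (Split 13 (-164) 289 (Leaf
[6,-3,11,13,-3,11,16,-8,2,18,8,-2,22,8,-2,25,5,9]) (Split 22 289 (-164) (Leaf
[6,-7,2,11,14,-14,13,-21,16,14,14,-14,16,-7,2,18,7,-2,22,21,-16]) (Leaf
[11,3,0,13,-3,0,14,3,0,22,3,0]))) (Split 1 0 332 (Leaf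
[1,2,2,3,-2,-2,4,2,2,7,2,-2,16,0,-4,17,0,4]) (Leaf
[1,-3,7,2,3,0,4,1,0,5,2,1,11,4,0,13,-5,8,14,7,-7,16,-5,-6,17,0,7,18,5,-1,21,0,1,22,9,-2,25,4,6])))
(Leaf [6,-2,4,13,-2,4,25,-2,4])) (Split 10 0 332 (Leaf
[10,1,3,11,3,-3,13,-4,0,14,4,0,18,1,3,22,4,0]) (Leaf
[10,-3,3,11,3,-3,18,-1,4,22,2,1,26,2,1]))))))))) (Split 6 86 321 (Split 25 (-164) 289 (Leaf
[6,3,3,12,3,3,22,3,3,25,3,3]) (Split 4 321 (-86) (Split 14 332 0 (Split 3 (-332) 0 (Leaf
[3,-4,2,4,4,-2,6,4,-1,13,0,1,14,4,-2,25,0,1]) (Split 27 235 235 (Leaf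
[2,7,-4,4,7,-4,6,2,3,12,2,3,22,2,3,25,-5,7,27,7,-4]) (Leaf
[1,0,4,3,-4,-2,4,4,2,6,4,2,12,0,4,14,4,-2,22,0,4,27,0,4]))) (Split 3 (-332) 0 (Split 9 (-235) 235
(Split 14 289 164 (Split 3 (-289) 164 (Split 9 (-164) 289 (Leaf
[3,-3,2,4,3,-2,6,4,1,9,1,3,14,4,1,25,1,3]) (Leaf [3,-6,3,4,6,-3,6,3,1,9,-3,4,14,3,1,25,-3,4]))
(Leaf [3,-4,-1,4,4,1,6,4,1,14,4,1])) (Leaf [3,-2,1,4,2,-1,6,2,3,9,0,4,14,2,3,25,0,4])) (Split 9
(-289) 164 (Leaf [3,-5,2,4,5,-2,6,1,2,9,-5,2,12,1,2,22,1,2,25,-4,4]) (Leaf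
[3,-4,-4,4,4,4,6,4,4,9,-4,-4,12,4,4,22,4,4]))) (Leaf [3,-3,-3,4,3,3,6,3,3,14,3,3]))) (Split 27 235
235 (Leaf [2,5,0,4,4,1,5,1,-1,6,2,4,12,3,3,22,3,3,25,-2,3,27,5,0]) (Split 14 321 (-86) (Leaf
[1,0,6,3,-7,-2,4,7,2,6,7,2,12,0,6,14,7,-4,22,0,6,27,0,6]) (Leaf [3,-3,-1,4,3,1,6,3,1,14,3,1])))))
(Split 25 (-164) 289 (Split 25 86 321 (Split 6 (-164) 289 (Leaf [6,4,4,12,4,4,22,4,4,25,4,4])
(Split 7 289 (-164) (Leaf [2,3,-2,5,3,-2,6,-2,3,7,3,-2,12,1,1,22,1,1,25,1,1]) (Split 5 289 (-164)
(Leaf [2,3,0,4,1,1,5,2,-1,6,-2,1,7,3,0]) (Split 2 289 (-164) (Leaf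
[2,3,-2,5,3,-2,6,-2,3,7,3,-2,12,1,1,22,1,1,25,1,1]) (Leaf [2,7,1,5,7,1,6,-7,-1,7,7,1]))))) (Split
12 0 332 (Leaf [6,0,3,12,1,2,13,-1,1,22,1,2,25,0,3]) (Split 6 (-164) 289 (Leaf
[6,-1,6,12,-1,6,22,-1,6,25,-1,6]) (Split 7 289 (-164) (Leaf
[2,5,-4,5,5,-4,6,-6,8,7,5,-4,12,-1,4,22,-1,4,25,-1,4]) (Split 2 321 (-86) (Leaf
[2,4,-2,5,4,-2,6,-5,6,7,4,-2,12,-1,4,22,-1,4,25,-1,4]) (Split 5 289 (-164) (Leaf
[2,4,0,4,2,2,5,2,-2,6,-2,2,7,4,0]) (Leaf [2,6,1,5,6,1,6,-6,-1,7,6,1]))))))) (Split 12 0 332 (Split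
6 (-164) 289 (Leaf [6,0,3,12,1,2,13,-1,1,22,1,2,25,0,3]) (Leaf
[6,-6,8,12,1,1,13,-7,7,22,1,1,25,-6,8])) (Split 26 332 0 (Split 6 (-86) 321 (Split 10 (-86) 321
(Split 12 (-164) 289 (Leaf [6,0,4,12,0,4,22,0,4,25,0,4]) (Split 18 321 86 (Leaf
[6,-4,5,12,-4,5,18,3,-1,22,-1,4,25,-4,5,26,3,-1]) (Split 27 235 235 (Split 4 332 0 (Leaf
[2,3,-1,4,3,-1,6,-1,4,12,-1,4,22,-1,4,25,-4,5,27,3,-1]) (Leaf
[2,3,0,4,2,1,5,1,-1,6,-1,1,25,-3,0,27,3,0])) (Leaf
[1,0,4,6,-6,10,10,1,4,12,-7,10,14,1,0,18,4,3,22,-3,13,25,-6,10,26,3,-1,27,0,4])))) (Leaf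
[3,-4,0,4,4,0,10,-4,0,25,-4,0,26,4,0])) (Leaf [6,-4,7,12,-1,4,13,-3,3,22,-1,4,25,-4,7])) (Split 12
(-164) 289 (Leaf [6,-1,4,12,-1,4,22,-1,4,25,-1,4]) (Split 18 321 (-86) (Split 26 321 86 (Leaf
[6,-2,3,12,-2,3,18,2,-1,22,0,2,25,-2,3,26,2,-1]) (Split 6 (-86) 321 (Split 3 (-332) 0 (Split 0
(-235) 235 (Split 0 (-164) 289 (Leaf [0,3,3,12,3,3,17,3,3,22,3,3,26,3,3]) (Split 17 (-164) 289
(Leaf [0,3,3,12,3,3,17,3,3,22,3,3,26,3,3]) (Leaf [0,-2,3,12,-2,3,17,-2,3,18,2,-1,22,0,2,26,0,2])))
(Split 4 321 (-86) (Split 9 (-235) 235 (Split 1 86 321 (Split 9 (-164) 289 (Leaf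
[1,3,3,9,3,3,17,3,3,26,3,3]) (Leaf
[0,-2,-2,1,2,3,3,-7,3,4,7,-3,6,0,6,9,-5,6,12,-2,4,17,0,1,18,1,0,22,-1,4,25,-7,9,26,1,1])) (Split 9
(-86) 321 (Leaf
[1,-2,9,2,2,0,5,2,0,6,-6,12,9,3,9,12,-9,12,14,5,0,17,0,9,18,7,-4,22,-2,8,25,-6,12,26,7,5]) (Split
17 (-86) 321 (Leaf
[1,-2,8,2,4,0,5,4,0,6,-14,18,9,-2,8,12,-10,18,17,2,8,18,6,-3,22,-4,15,25,-14,18,26,8,5]) (Leaf
[1,-1,2,6,-2,3,9,-1,2,12,-2,3,17,-1,2,18,2,-1,22,0,2,25,-2,3,26,1,1])))) (Split 9 (-289) 164 (Leaf
[3,-3,1,4,3,-1,6,-1,4,9,-3,1,12,-1,4,22,-1,4,25,-4,5]) (Leaf [3,-4,-1,4,4,1,9,-4,-1,25,-4,-1])))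
(Split 1 0 332 (Leaf [1,1,1,3,-1,-1,4,1,1,6,-1,4,12,-1,4,17,1,1,22,-1,4,25,-2,3,26,1,1]) (Leaf
[1,-1,1,2,1,0,3,-1,-1,4,2,1,6,0,4,12,-2,4,14,2,0,17,0,1,18,1,0,22,-1,4,25,-2,3,26,1,1])))) (Leaf
[1,0,1,3,-1,-1,4,1,1,6,0,4,12,-1,4,14,1,0,17,0,1,22,-1,4,25,-1,3,26,0,1])) (Leaf
[6,-4,7,12,-1,4,13,-3,3,22,-1,4,25,-4,7]))) (Leaf [18,3,2,22,3,2,26,3,2])))))))"

lemma check_1110: "check edges [] (start cE cN cE cW) tree_1110"
  by code_simp

definition tree_1111 :: tree where
  "tree_1111 =
Split 1 (-86) 321 (Split 17 0 332 (Split 1 64 326 (Split 17 164 289 (Leaf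
[1,3,0,11,3,0,17,3,0,22,3,0,26,3,0]) (Split 10 (-86) 321 (Leaf [1,2,4,10,2,4,17,2,4]) (Split 10
(-203) 263 (Split 26 289 (-164) (Leaf
[1,1,1,6,0,3,10,-2,4,11,3,-3,12,0,3,17,1,1,22,3,0,25,0,3,26,3,-3]) (Split 22 289 (-164) (Split 10
(-127) 307 (Leaf [1,2,3,10,2,3,17,2,3]) (Split 17 86 321 (Leaf
[1,1,2,10,-3,5,11,4,-3,17,1,2,22,4,-3,26,4,-3]) (Split 1 127 307 (Split 7 289 164 (Split 11 332 0
(Leaf [10,-3,3,11,3,-3,22,3,-3,26,3,-3]) (Split 13 (-164) 289 (Split 6 (-86) 321 (Split 23 235 235
(Leaf [1,3,4,6,1,3,7,2,-3,10,-4,7,11,7,-3,13,1,3,17,1,7,22,4,-3,23,3,0,26,5,0]) (Leaf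
[1,4,6,2,1,0,4,1,0,6,1,6,10,-3,5,11,7,1,13,1,6,17,5,6,22,7,-5,23,0,6,26,8,1])) (Split 2 332 0
(Leaf [2,2,-1,5,2,-1,6,-2,3,7,2,-3,10,-2,2,11,2,-2,13,0,2,17,0,2,22,2,-2,26,2,0]) (Leaf
[2,10,4,4,4,4,5,6,0,6,-5,9,7,9,-5,10,-8,8,11,8,-8,13,1,9,17,1,9,22,8,-8,26,9,1]))) (Split 0 (-235)
235 (Leaf [0,0,4,10,0,4,11,4,-4,13,-4,4,14,4,0,17,0,4,22,4,-4]) (Leaf
[0,-3,0,1,3,0,11,3,0,13,-3,0,22,3,0])))) (Split 23 235 235 (Split 23 289 164 (Split 10 (-164) 289
(Leaf [1,4,6,7,3,-1,10,1,7,11,3,-1,17,1,7,23,3,-1]) (Leaf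
[1,4,6,7,3,-1,10,-10,15,11,14,-9,17,1,7,22,11,-8,23,3,-1,26,11,-8])) (Leaf
[1,4,6,7,4,3,10,-4,6,11,8,0,17,0,3,22,4,-3,23,4,3,26,4,-3])) (Split 23 164 289 (Split 10 (-164)
289 (Leaf [1,2,3,7,1,2,10,-1,3,11,3,0,17,1,1,22,2,-2,23,1,2,26,2,-2]) (Leaf
[1,1,2,7,1,2,10,-2,2,11,3,0,22,2,-2,23,1,2,26,2,-2])) (Leaf
[2,1,0,4,1,0,6,0,6,13,0,6,17,1,0,22,1,-6,23,-1,6,26,1,0])))) (Leaf
[1,0,4,10,-5,8,11,5,-4,17,0,4,22,5,-4,26,5,-4])))) (Split 11 289 (-164) (Leaf
[10,-1,2,11,1,-2,18,2,2,22,3,0,26,3,0]) (Split 1 164 289 (Leaf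
[1,8,1,11,8,1,17,8,1,22,8,1,26,8,1]) (Leaf [1,3,8,10,-4,7,11,7,1,17,3,8,22,7,1,26,7,1]))))) (Split
22 321 (-86) (Leaf [10,-3,2,11,3,-2,22,3,-2,26,3,-2]) (Leaf
[6,0,1,10,-4,0,11,4,0,12,0,1,22,4,1,25,0,1,26,4,0]))))) (Split 2 321 86 (Split 16 (-235) 235
(Split 10 (-86) 321 (Split 17 164 289 (Leaf [1,3,4,10,3,4,17,3,4]) (Leaf [1,1,3,10,1,3,17,1,3]))
(Split 6 (-164) 289 (Split 22 321 (-86) (Split 13 0 332 (Leaf
[6,1,2,10,-2,2,11,2,-2,13,1,2,16,1,2,22,2,-2,26,3,0]) (Leaf
[6,1,7,10,-4,7,11,8,-7,13,-3,7,14,4,0,16,1,7,22,8,-7,26,5,0])) (Split 26 332 0 (Leaf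
[1,-2,6,2,4,-1,4,1,0,5,3,-1,6,1,5,10,-5,8,11,3,-2,12,4,4,17,2,5,22,7,2,25,0,5,26,7,-3]) (Leaf
[1,0,10,2,4,-1,5,4,-1,6,1,6,10,-6,10,11,6,0,12,5,5,16,1,6,17,4,9,22,11,5,26,11,5]))) (Leaf
[1,0,1,2,4,-1,5,4,-1,6,-4,1,7,4,0,10,0,1,16,0,1]))) (Split 17 86 321 (Split 10 (-86) 321 (Leaf
[1,2,4,10,2,4,17,2,4]) (Split 4 321 86 (Split 16 (-332) 0 (Leaf
[1,-4,7,2,7,-2,4,7,-2,10,-4,7,16,-7,2,17,3,5]) (Leaf
[1,-1,6,2,4,-1,4,4,-1,10,-4,6,11,3,0,16,-4,-2,17,3,5,22,3,0,25,0,3,26,3,-3])) (Split 6 86 321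
(Leaf [2,4,0,4,4,4,6,4,4,12,4,4,17,4,0,21,0,4,22,4,0,26,4,0]) (Leaf
[2,3,0,4,-2,8,5,5,-5,6,-2,8,12,3,3,17,3,0,21,0,3,22,3,0,26,3,0])))) (Split 10 0 332 (Leaf
[1,2,4,10,2,4,17,2,4]) (Leaf [1,-1,3,10,-1,3,17,-1,3])))) (Split 10 (-164) 289 (Leaf
[1,-3,1,2,5,5,3,5,5,10,2,6,17,2,6]) (Split 17 86 321 (Split 22 321 86 (Split 22 289 (-164) (Leaf
[2,1,1,3,1,1,10,-2,3,11,3,-2,17,1,1,22,3,-2,26,3,-2]) (Leaf [10,-3,0,11,3,0,22,3,0,26,3,0])) (Leaf
[1,-2,1,2,6,6,3,6,6,6,0,5,10,-5,7,11,9,0,12,0,5,17,4,7,22,9,5,25,0,5,26,9,0])) (Leaf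
[1,-3,1,10,-3,1,17,-3,1]))))) (Split 4 321 86 (Split 25 0 332 (Split 10 0 332 (Split 17 (-86) 321
(Split 10 164 289 (Leaf [1,3,4,10,3,4,17,3,4]) (Leaf [1,1,4,10,1,4,17,1,4])) (Split 18 321 86
(Split 22 321 86 (Split 6 (-86) 321 (Split 13 0 332 (Leaf [6,1,3,13,1,3,25,1,3]) (Split 0 (-235)
235 (Leaf [0,0,4,1,3,11,7,12,0,10,5,11,13,-2,4,14,2,0,17,-9,15,18,14,-4,22,14,-4,25,12,0]) (Leaf
[0,-8,0,1,3,10,6,3,12,7,2,-2,10,4,9,13,-6,13,14,1,-1,17,-7,12,18,11,-3,22,11,-3,25,5,10]))) (Split
13 64 326 (Split 2 321 86 (Split 19 235 235 (Leaf
[5,4,0,6,-2,3,7,4,0,13,2,3,17,-4,0,19,4,0,25,2,3]) (Split 2 307 (-127) (Leaf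
[1,3,10,2,1,-10,5,1,0,7,4,0,10,4,9,13,0,1,14,1,-1,18,4,-1,19,0,10,22,4,-1,25,4,0]) (Leaf
[2,6,0,5,6,0,6,-3,5,7,6,0,13,3,5,25,3,5]))) (Leaf
[2,12,7,3,3,7,5,9,0,6,-5,8,7,17,-2,10,3,7,13,4,8,17,-5,9,18,8,-2,22,8,-2,25,12,6])) (Leaf
[6,-2,3,7,3,-1,13,-2,3,17,-3,1,18,3,-1,22,3,-1,25,1,2]))) (Split 7 321 86 (Leaf
[6,0,3,7,3,-1,12,0,3,17,-3,1,18,3,-1,22,3,2,25,3,2]) (Leaf
[1,1,2,7,5,3,10,1,2,17,-4,-1,18,5,3,22,5,3,25,5,3]))) (Split 2 321 86 (Split 7 326 64 (Leaf
[2,11,-3,3,10,10,4,1,-3,7,11,-3,10,6,14,11,4,-4,18,6,14,21,0,10,22,10,0,25,10,0]) (Leaf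
[1,1,2,7,5,3,10,1,2,17,-4,-1,18,5,3,22,5,3,25,5,3])) (Leaf
[2,3,4,3,3,7,7,5,0,10,3,7,17,-2,4,18,5,3,21,0,3,22,5,0,25,5,0])))) (Split 22 321 (-86) (Split 13
(-164) 289 (Split 7 326 64 (Leaf
[1,1,3,6,0,2,7,3,-2,10,-2,5,11,3,-2,13,0,2,17,-2,5,22,3,-2,25,3,0]) (Split 1 64 326 (Split 11 326
64 (Leaf [10,-3,3,11,3,-3,22,3,-3,26,3,-3]) (Split 23 235 235 (Split 23 321 86 (Leaf
[1,1,1,7,2,-2,10,-1,3,11,2,-2,17,-1,3,23,2,-2]) (Split 1 164 289 (Leaf
[1,4,2,7,4,2,11,4,2,23,4,2]) (Split 17 (-164) 289 (Split 10 (-164) 289 (Leaf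
[1,-3,11,10,-3,11,17,-3,11]) (Leaf [1,-3,4,10,-3,4,17,-3,4])) (Leaf [1,-3,4,10,-3,4,17,-3,4]))))
(Leaf
[1,7,5,2,2,0,5,2,0,6,0,15,7,9,5,10,-1,1,11,8,4,13,2,15,22,28,-16,23,-20,20,25,29,0,26,1,-1])))
(Leaf [1,-2,4,10,-2,4,17,-2,4]))) (Split 0 (-235) 235 (Leaf
[0,-1,3,10,-1,3,11,5,-3,13,-5,3,14,4,0,17,-1,3,22,5,-3]) (Leaf
[0,-3,0,1,1,3,10,-2,3,11,3,0,13,-3,0,17,-2,3,22,3,0]))) (Split 1 86 321 (Split 22 321 86 (Leaf
[1,3,5,7,5,0,10,-2,5,11,5,0,17,-2,5,22,5,0,25,5,0]) (Split 6 (-164) 289 (Leaf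
[1,1,0,6,1,4,7,1,0,11,1,0,12,1,4,22,2,4,25,2,4]) (Leaf
[1,3,5,2,2,0,5,2,0,6,-2,3,7,7,0,10,-2,5,11,5,0,12,0,3,17,-2,5,22,5,3,25,5,3]))) (Leaf
[1,-2,4,10,-2,4,17,-2,4])))) (Split 17 (-86) 321 (Split 6 (-86) 321 (Split 10 (-86) 321 (Split 1
86 321 (Leaf [1,2,4,10,2,4,17,2,4]) (Split 10 164 289 (Leaf [1,3,4,10,3,4,17,3,4]) (Leaf
[1,0,3,10,0,3,17,0,3]))) (Split 2 321 86 (Split 1 64 326 (Split 26 321 (-86) (Leaf
[1,0,2,2,3,-1,4,3,-1,6,1,4,10,-4,6,11,4,-4,12,1,4,17,3,1,22,5,0,25,-2,5,26,7,-5]) (Split 22 321 86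
(Split 26 321 86 (Leaf [10,-3,1,11,3,-1,22,3,-1,26,3,-1]) (Split 11 321 86 (Leaf
[10,-3,1,11,3,-1,22,3,-1,26,3,-1]) (Split 0 (-235) 235 (Leaf
[0,0,6,10,-7,2,11,7,-2,13,0,6,17,0,6,22,7,-2,26,7,4]) (Split 22 321 (-86) (Split 23 235 235 (Split
13 0 332 (Split 23 289 164 (Leaf
[1,2,4,6,1,3,7,3,-2,10,-3,5,11,5,-1,13,1,3,17,-1,6,23,5,-1,25,-1,2,26,2,1]) (Split 13 164 289
(Leaf [1,1,2,6,5,3,10,-4,-1,11,5,3,13,5,3,17,1,2,23,5,3,26,5,3]) (Leaf
[1,2,4,6,5,18,10,-8,-2,11,10,6,13,5,18,17,2,4,23,10,6,25,-5,12,26,10,6]))) (Leaf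
[0,-8,0,1,4,7,6,3,11,10,-4,7,11,8,0,13,-5,11,17,-4,7,23,8,0,25,-5,11])) (Split 23 86 321 (Split 13
86 321 (Leaf [1,1,2,6,3,5,10,-5,-1,11,6,3,13,3,5,17,1,2,22,3,-2,23,3,5,26,6,3]) (Leaf
[0,-4,0,1,3,6,6,2,7,10,-3,5,11,6,1,13,-2,7,17,-1,6,22,4,-6,23,2,7,26,2,1])) (Leaf
[1,6,12,2,18,-5,4,18,-5,6,0,17,10,-4,6,11,10,6,13,0,17,17,24,7,22,28,-16,23,-18,22,26,28,1])))
(Leaf [1,1,2,10,-4,-1,11,5,3,17,1,2,22,5,3,26,5,3]))))) (Split 11 332 0 (Split 26 289 164 (Leaf
[10,-2,1,11,2,-1,18,1,1,22,3,0,26,3,0]) (Split 22 289 164 (Leaf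
[10,-2,1,11,2,-1,18,2,2,22,4,1,26,4,1]) (Leaf [10,-1,1,11,1,-1,18,7,7,22,8,6,26,8,6]))) (Leaf
[1,13,25,6,1,4,10,-9,16,11,22,9,12,1,4,17,13,25,22,23,13,25,1,4,26,22,9])))) (Leaf
[1,-4,1,10,-4,1,17,-4,1])) (Split 3 0 332 (Leaf [2,1,3,3,1,3,10,1,3,17,1,3]) (Leaf
[2,-1,4,3,-1,4,10,-1,4,17,-1,4])))) (Split 26 321 (-86) (Split 10 0 332 (Leaf
[1,1,4,2,2,0,3,1,1,5,1,-1,6,-1,1,10,2,5,17,3,4,25,-1,1,26,1,-1]) (Leaf
[2,10,1,3,0,11,5,10,-10,6,-10,17,7,3,-1,10,-7,18,11,7,-7,12,0,7,17,7,2,22,7,0,25,-7,16,26,14,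
-16])) (Split 10 86 321 (Leaf [1,2,4,10,2,4,17,2,4]) (Split 10 (-86) 321 (Split 1 164 289 (Leaf
[1,2,3,10,2,3,17,2,3]) (Leaf [1,0,3,10,0,3,17,0,3])) (Split 11 326 64 (Split 22 321 86 (Leaf
[10,-4,1,11,4,-1,22,4,-1,26,4,-1]) (Leaf
[2,4,0,5,4,0,6,-4,7,7,2,-2,10,-7,2,11,7,-2,12,0,7,17,2,2,22,7,5,25,-2,5,26,9,0])) (Split 22 321
(-86) (Split 1 64 326 (Split 7 326 64 (Leaf
[6,-2,3,7,2,-3,10,-3,3,11,3,-3,13,-2,3,17,-2,3,22,3,-3,26,1,0]) (Split 26 326 64 (Leaf
[10,-3,3,11,3,-3,22,3,-3,26,3,-3]) (Split 11 289 164 (Leaf [10,-3,3,11,3,-3,22,3,-3,26,3,-3])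
(Split 23 235 235 (Split 1 164 289 (Split 23 289 164 (Leaf [1,4,-1,7,4,-1,11,4,-1,23,4,-1]) (Leaf
[1,4,2,7,4,2,11,4,2,23,4,2])) (Split 10 (-164) 289 (Leaf [1,-1,3,10,-1,3,17,-1,3]) (Leaf
[1,-3,4,10,-3,4,17,-3,4]))) (Split 23 164 289 (Split 2 321 86 (Split 1 164 289 (Split 2 321 (-86)
(Leaf [1,9,12,2,3,-2,5,3,-2,6,-3,5,7,11,6,10,-2,3,11,11,9,13,0,3,17,1,4,22,3,-2,23,8,11,26,3,1])
(Leaf [1,5,7,2,3,0,5,3,0,6,-3,3,7,8,4,10,-2,2,11,7,5,13,0,3,17,0,3,22,2,-2,23,5,7,26,2,1])) (Leaf
[1,6,19,2,3,-1,5,3,-1,6,-3,5,7,11,6,10,-6,10,11,12,9,13,0,4,17,-2,12,22,4,-2,23,8,11,26,4,2]))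
(Leaf [2,0,5,3,0,5,7,2,1,10,-2,4,11,2,1,17,-2,4,23,2,1])) (Leaf
[6,-3,3,13,-3,3,22,3,-3,23,-3,3])))))) (Leaf [1,-4,1,10,-4,1,17,-4,1])) (Split 1 164 289 (Split 26
332 0 (Leaf [2,4,0,5,4,0,6,-4,7,7,1,-1,10,-16,3,11,16,-3,12,0,7,17,3,1,22,16,4,25,-3,6,26,19,-2])
(Leaf [1,3,5,10,-2,3,11,5,2,17,3,5,22,5,2,26,5,2])) (Leaf
[1,-1,6,10,-4,5,11,3,1,17,-1,6,22,3,1,26,3,1])))))))) (Split 23 235 235 (Split 10 86 321 (Split 7
321 (-86) (Leaf [2,2,0,3,2,3,7,4,-3,10,2,3,17,-2,3,18,4,0,21,0,3,23,4,-3]) (Split 18 332 0 (Split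
9 (-235) 235 (Leaf [1,1,4,7,3,1,9,0,3,10,1,1,17,-2,3,18,4,-2,23,4,-2,25,-1,3,26,1,0]) (Split 22
321 86 (Split 9 (-332) 0 (Leaf
[1,0,2,7,1,0,9,-12,5,10,12,-3,17,-1,2,18,13,-5,22,11,-3,23,2,-2,25,-1,2]) (Split 22 289 (-164)
(Split 18 289 (-164) (Leaf [9,-1,-1,10,1,1,18,7,-5,22,7,-5,26,6,-6]) (Leaf
[9,-2,-1,10,2,1,18,3,0,23,3,0,25,-3,0,26,1,-1])) (Leaf [9,-2,-1,10,2,1,18,3,0,22,3,0,26,1,-1])))
(Leaf [18,3,0,22,-1,4,23,4,-4,25,-4,4,26,3,0]))) (Split 23 321 (-86) (Leaf
[2,2,0,3,2,3,7,2,0,10,2,3,18,4,2,21,0,3,22,1,1,23,3,-2,25,-1,2,26,2,-1]) (Leaf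
[1,1,3,2,2,0,3,2,2,7,14,4,10,3,5,17,-11,-1,18,14,6,21,0,2,23,14,4])))) (Split 11 326 64 (Leaf
[7,2,-2,10,-1,3,11,1,-3,17,-2,2,18,1,1,23,2,-2]) (Split 1 86 321 (Split 23 321 86 (Leaf
[1,1,1,7,3,-3,10,-2,4,11,3,-3,17,-2,4,23,3,-3]) (Split 7 321 86 (Leaf
[1,1,1,7,3,-3,10,-2,4,11,3,-3,17,-2,4,23,3,-3]) (Split 26 326 64 (Leaf
[1,1,1,7,1,1,10,-1,3,11,2,-2,23,2,-2,25,-1,3,26,1,-3]) (Split 22 321 86 (Split 18 326 (-64) (Split
10 (-86) 321 (Split 1 164 289 (Leaf [1,4,2,7,4,2,11,4,2,23,4,2]) (Split 17 (-203) 263 (Split 11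
321 86 (Leaf [1,1,1,7,2,-2,10,-1,3,11,2,-2,17,-1,3,23,2,-2]) (Split 0 (-235) 235 (Leaf
[0,5,5,7,7,4,12,5,5,17,-2,1,18,2,-1,23,7,4]) (Split 7 263 203 (Leaf
[1,0,3,7,2,-1,10,0,3,17,-2,4,18,2,-1,23,2,-1]) (Split 6 86 321 (Leaf
[0,-2,0,1,0,3,6,2,0,10,0,3,17,-2,3,18,2,0,23,2,0]) (Split 25 (-64) 326 (Split 13 86 321 (Split 5
321 (-86) (Leaf [2,1,0,3,0,4,5,1,-4,6,-1,4,7,3,-3,10,0,4,17,-2,3,18,2,1,23,2,1]) (Split 6 (-86)
321 (Leaf [6,2,3,13,2,3,25,2,3]) (Split 2 321 (-86) (Split 19 235 235 (Leaf
[1,0,3,5,2,0,6,-2,0,7,2,0,10,0,3,17,-2,3,19,2,0]) (Leaf [1,0,3,2,0,-3,10,0,3,19,0,3])) (Leaf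
[2,7,2,5,7,2,6,-3,5,7,7,2,13,4,7,25,4,7])))) (Leaf [6,-1,3,13,-1,3,25,-1,3])) (Split 9 (-235) 235
(Leaf [1,2,5,7,4,1,9,2,5,17,-2,4,18,5,-2,22,1,-3,23,4,1,26,3,2]) (Split 23 289 164 (Leaf
[7,3,-2,17,-3,2,18,3,-2,23,3,-2]) (Split 11 289 164 (Split 9 (-326) 64 (Leaf
[1,3,9,7,5,5,9,-4,3,10,0,3,11,7,3,17,-2,4,18,2,-1,23,9,2,25,-4,3]) (Split 9 (-332) 0 (Leaf
[9,-4,0,11,4,0,23,4,0,25,-4,0]) (Leaf [9,-5,-2,11,5,2,18,1,-1,23,6,1,25,-6,-1,26,1,-1]))) (Leaf
[1,3,7,7,5,3,10,0,3,11,3,4,17,-2,4,18,2,-1,23,5,3]))))))))) (Leaf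
[7,4,-2,17,-4,2,18,4,-2,23,4,-2]))) (Leaf [1,1,2,7,2,1,10,-1,1,11,2,1,17,-1,1,23,2,1])) (Leaf
[1,2,4,7,11,6,10,-1,3,11,3,1,17,-9,-2,18,8,5,23,11,6])) (Leaf
[7,3,0,17,-3,0,18,3,0,22,-1,4,23,4,-4,25,-1,4]))))) (Leaf [1,-2,4,10,-2,4,17,-2,4])))) (Split 13
(-86) 321 (Split 12 0 332 (Split 6 (-86) 321 (Split 22 321 (-86) (Leaf
[6,1,3,12,4,0,13,-3,3,22,4,-2,23,0,2,25,1,1]) (Split 23 86 321 (Leaf [6,2,4,12,2,4,23,2,4]) (Leaf
[6,3,11,12,5,8,13,-2,3,22,7,2,23,-2,6,25,5,5]))) (Split 7 289 (-164) (Split 27 235 235 (Leaf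
[2,4,0,5,4,0,12,4,0,22,4,0,27,4,0]) (Leaf [2,2,0,5,2,0,6,-2,4,7,2,-4,13,0,4,27,0,4])) (Split 5 289
(-164) (Leaf [2,3,0,4,2,2,5,1,-2,6,-1,2,7,3,0]) (Split 19 235 235 (Leaf
[5,4,0,12,4,0,19,4,0,22,4,0,26,4,0]) (Split 23 64 326 (Split 2 289 (-164) (Split 10 (-86) 321
(Split 19 (-86) 321 (Leaf [1,1,3,2,-1,-3,10,1,3,19,1,3]) (Leaf
[1,1,4,2,1,-2,10,1,4,17,2,2,19,-1,2])) (Leaf [1,-2,3,2,0,-3,10,-2,3,17,-2,0,19,0,3])) (Split 23
164 289 (Leaf [2,7,1,5,7,1,7,7,1,12,7,1,23,7,1]) (Split 6 (-127) 307 (Leaf [6,1,3,12,1,3,23,1,3])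
(Leaf [2,7,1,5,7,1,6,-4,6,7,7,1,12,3,7,23,3,7])))) (Split 22 321 86 (Leaf
[6,-2,2,13,-2,2,22,3,-1,23,-3,1,25,1,1]) (Split 6 (-164) 289 (Leaf
[6,-1,4,12,1,2,13,-2,2,22,1,2,25,-1,4]) (Leaf
[6,-7,11,12,1,3,13,-8,8,22,4,2,23,-3,1,25,-4,10])))))))) (Split 10 (-86) 321 (Split 25 (-86) 321
(Split 6 86 321 (Leaf [6,2,4,13,2,4,25,2,4]) (Split 6 (-86) 321 (Split 13 164 289 (Leaf
[6,3,4,13,3,4,25,3,4]) (Leaf [6,0,3,13,0,3,25,0,3])) (Split 23 164 289 (Split 7 332 0 (Split 2 321
86 (Leaf [2,3,-1,5,3,-1,6,-3,1,7,3,-1]) (Split 18 321 86 (Leaf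
[2,3,2,3,1,4,5,2,-2,6,-3,4,7,6,-3,10,1,4,12,-1,1,13,0,1,17,-3,5,18,4,-1,22,3,0,25,3,1]) (Leaf
[2,9,5,3,3,11,5,6,-6,6,-6,6,7,9,-4,10,3,11,17,0,9,18,3,2,23,3,2]))) (Split 13 64 326 (Split 22 321
86 (Split 2 321 86 (Split 5 321 86 (Leaf [2,3,-1,5,3,-1,6,-3,1,7,3,-1]) (Split 19 235 235 (Split
19 289 164 (Leaf [5,3,-3,6,-3,3,7,3,-3,17,-3,3,19,3,-3]) (Split 26 289 164 (Leaf
[5,8,-5,6,-6,9,7,4,1,13,2,4,17,-4,-1,19,8,-5,25,-2,10,26,4,-6]) (Leaf
[5,11,6,6,-5,5,7,4,1,13,6,11,17,-4,-1,19,11,6,25,-1,6,26,7,5]))) (Split 2 289 (-164) (Leaf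
[1,1,4,2,0,-4,7,1,0,10,1,4,18,1,0,19,0,4,23,1,0]) (Split 13 164 289 (Split 19 86 321 (Split 2 321
(-86) (Split 7 289 164 (Leaf [2,3,-3,5,3,-3,6,-3,3,7,3,-3]) (Leaf
[1,3,11,2,9,-4,5,12,7,6,-3,5,7,12,7,10,3,11,13,9,12,19,3,11,25,9,12])) (Leaf
[2,5,2,5,5,2,6,-1,2,7,5,2,13,4,4,25,4,4])) (Leaf
[1,4,15,2,25,-3,5,21,12,7,29,12,10,4,15,13,21,12,18,8,0,19,-4,15,22,7,-2,23,1,2,25,28,10])) (Leaf
[1,3,11,2,19,-2,5,19,9,6,-26,45,7,22,9,10,3,11,13,-7,54,18,3,0,19,0,11,23,3,0,25,-7,54])))))
(Split 5 332 0 (Split 10 164 289 (Split 2 289 164 (Leaf [2,4,1,4,2,2,5,2,-1,6,-2,1,7,4,1]) (Leaf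
[2,8,6,3,3,4,4,3,3,5,2,-1,6,-2,1,7,5,2,10,3,4,17,3,4])) (Leaf
[2,7,4,3,0,7,5,7,-3,6,-7,3,7,9,-1,10,0,7,17,-2,5,18,2,2,23,2,2])) (Leaf
[2,4,2,5,4,2,6,-4,-1,7,4,2,12,0,1,23,0,1]))) (Leaf [6,-1,4,12,-1,4,22,-1,4,25,-1,4])) (Leaf
[6,-3,1,13,-3,1,25,-3,1]))) (Split 22 321 (-86) (Leaf [6,-3,3,13,-3,3,22,3,-3,23,-3,3]) (Leaf
[6,-2,4,12,-2,4,22,3,1,23,-5,3,25,3,1]))))) (Split 3 86 321 (Split 2 321 (-86) (Leaf
[1,-5,5,2,5,-5,3,8,-2,10,3,3,18,3,3,21,3,3]) (Leaf [1,-1,1,2,3,1,3,3,1,10,2,2,17,2,2])) (Split 27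
235 235 (Split 2 321 86 (Leaf [2,4,-1,4,4,-1,25,-4,1,27,4,-1]) (Split 22 321 86 (Leaf
[2,5,5,3,5,5,10,2,8,11,3,-3,17,-5,8,18,7,0,22,10,-3,27,10,-3]) (Leaf
[2,5,3,3,1,4,4,4,-1,6,0,2,10,1,4,12,0,2,17,-2,4,18,3,0,22,3,2,25,-4,3,27,7,-1]))) (Split 27 (-86)
321 (Split 10 86 321 (Split 9 (-235) 235 (Split 7 321 (-86) (Split 2 321 86 (Leaf
[2,4,-2,4,4,-2,7,4,-2]) (Split 6 (-86) 321 (Split 4 326 (-64) (Split 2 289 164 (Leaf
[2,3,-2,4,3,-2,7,3,-2]) (Split 10 203 263 (Leaf [2,3,3,3,3,3,10,3,3,17,3,3]) (Leaf
[2,4,3,3,2,4,4,2,-1,7,2,-1,10,2,4,17,2,4]))) (Leaf [2,11,6,4,11,6,6,3,11,7,8,-5,13,3,11,27,3,11]))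
(Split 18 321 86 (Leaf [6,-2,3,7,2,-3,12,-2,3,17,-2,3,18,2,-3]) (Leaf
[2,9,5,3,4,7,5,5,-2,6,-7,11,7,7,-4,10,4,7,13,-2,9,18,4,7,22,4,0,23,0,7,27,2,9])))) (Split 4 321
(-86) (Split 3 (-86) 321 (Split 2 332 0 (Split 1 164 289 (Split 7 289 164 (Leaf
[2,7,-3,3,1,1,4,6,-4,7,7,-3,9,1,1,25,1,1]) (Leaf [1,5,7,2,2,-1,3,2,1,4,0,-2,7,7,6,9,7,8,25,7,8]))
(Leaf [1,-3,2,2,3,-2,3,3,1,4,0,-3,9,0,3,25,0,3])) (Leaf [2,3,3,3,3,3,10,3,3,17,3,3])) (Split 9
(-86) 321 (Split 2 332 0 (Leaf [1,1,3,2,3,-2,4,3,-2,7,4,1,9,1,3,25,1,3]) (Leaf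
[2,7,3,3,4,5,4,3,-2,7,7,2,9,4,5,25,4,4,27,0,1])) (Split 19 235 235 (Leaf
[1,1,4,4,5,-5,9,-5,5,10,6,-1,17,1,4,19,5,-5,25,-5,5]) (Split 4 289 (-164) (Leaf
[3,-2,4,4,2,-4,9,-2,4,25,-2,4]) (Split 2 332 0 (Split 7 326 64 (Leaf [2,1,-4,4,1,-4,7,1,-4])
(Split 1 164 289 (Split 19 64 326 (Leaf
[1,6,3,3,-6,11,4,10,-4,7,6,3,9,-4,7,10,4,7,19,4,7,25,-4,7]) (Split 22 332 0 (Split 18 321 (-86)
(Leaf [1,5,5,9,-4,7,10,9,-2,17,5,5,18,4,-7,22,4,-7]) (Leaf
[1,7,4,3,-3,5,4,3,-5,7,7,4,9,-3,7,10,7,2,18,7,2,22,7,-3,23,0,5,25,4,4])) (Split 18 326 (-64)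
(Split 0 (-235) 235 (Leaf
[0,0,19,2,19,-9,4,7,-2,7,19,10,12,-2,11,13,2,8,18,12,-7,19,-12,7,22,10,4,25,12,12]) (Split 6 0 332
(Split 0 (-289) 164 (Leaf
[0,-3,7,2,9,-4,3,-1,2,4,2,-1,7,6,3,9,-1,2,12,-3,7,18,8,-5,19,-8,5,22,5,2,25,4,4]) (Leaf
[0,-3,-4,1,3,4,6,3,4,9,3,4,25,3,4])) (Leaf
[1,3,2,3,-4,6,6,-2,5,7,3,2,9,-3,5,10,2,3,12,-2,5,18,6,-3,19,-4,6,22,4,2,25,1,7]))) (Leaf
[1,3,3,7,3,3,10,3,3,18,3,3,22,3,3,25,3,3])))) (Leaf [1,-2,5,2,6,-3,4,6,-3,7,4,2,9,-2,5,25,-2,5])))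
(Split 2 289 164 (Split 7 289 164 (Split 7 332 0 (Leaf [2,3,-1,4,3,-1,7,3,-1]) (Leaf
[2,11,3,4,11,3,7,11,3])) (Leaf [2,3,3,4,3,3,7,3,3])) (Split 27 164 289 (Split 7 332 0 (Leaf
[2,9,7,3,6,8,4,3,-1,7,3,-1,9,6,8,27,6,8]) (Leaf [2,3,3,4,3,3,7,3,3])) (Leaf
[2,-2,4,3,-2,4,9,-2,4,27,-2,4])))))))) (Split 7 321 86 (Split 2 321 86 (Split 2 289 (-164) (Leaf
[2,3,-3,4,3,-3,7,3,-3]) (Leaf [2,4,0,4,4,0,7,4,0])) (Leaf [2,4,2,4,4,2,7,4,2])) (Split 2 321 (-86)
(Split 19 235 235 (Leaf [1,2,7,4,6,0,7,2,7,9,2,7,19,6,0,25,-4,7,26,6,0]) (Split 19 (-164) 289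
(Split 1 164 289 (Split 19 (-86) 321 (Leaf [1,4,7,2,-1,-4,10,4,7,17,3,3,19,1,4]) (Leaf
[1,2,4,2,1,-1,10,2,4,17,3,3,19,-1,1])) (Leaf
[1,1,8,2,6,-4,4,7,0,7,7,4,9,0,4,10,1,4,19,1,4,25,0,4])) (Leaf
[1,1,4,2,2,-1,10,1,4,17,3,3,19,-2,1]))) (Leaf [2,4,2,4,4,2,7,4,2]))))) (Split 22 321 86 (Split 18
326 (-64) (Split 0 (-235) 235 (Split 9 (-289) 164 (Split 0 (-164) 289 (Leaf
[0,3,3,9,-15,4,10,15,-4,12,3,3,17,3,3,18,12,-7,22,15,-4]) (Split 18 289 (-164) (Leaf
[0,-1,3,9,-4,1,10,4,-1,12,-1,3,17,-1,3,18,5,-4,22,4,-1]) (Leaf [9,-4,1,10,4,-1,18,4,-1,22,4,-1])))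
(Leaf [0,1,3,9,-7,-1,10,7,1,13,1,3,17,1,3,18,6,-2,22,6,-2])) (Split 9 (-332) 0 (Split 9 (-289) 164
(Split 1 86 321 (Split 18 289 (-164) (Split 19 235 235 (Leaf
[4,4,-1,9,-4,1,10,4,-1,19,4,-1,25,-4,1]) (Split 19 86 321 (Split 6 0 332 (Split 0 (-326) 64 (Split
3 (-164) 289 (Leaf [3,3,2,10,3,2,19,3,2]) (Split 4 289 (-164) (Leaf
[0,-6,3,1,2,4,3,-8,11,4,10,-8,6,3,5,9,-25,19,10,19,-4,12,-3,8,17,-4,7,18,21,-14,19,2,3,22,18,-6,
25,-7,13]) (Leaf
[0,-15,8,1,5,9,4,7,12,6,6,14,9,-48,23,10,53,-14,12,-9,22,17,-10,17,18,56,-43,19,7,12,22,47,-21,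
25,-1,2]))) (Leaf [0,-2,-4,1,2,4,6,2,4,9,2,4,25,2,4])) (Leaf
[1,3,5,6,-3,6,9,-12,9,10,15,-4,12,-3,6,17,3,5,18,12,-9,22,9,-3,25,-3,6])) (Leaf
[3,-1,4,9,-7,5,10,6,-1,18,7,-5,19,-1,4,22,7,-5]))) (Leaf [9,-4,1,10,4,-1,18,4,-1,22,4,-1])) (Leaf
[1,-1,2,9,-2,1,10,1,1,17,-1,2,18,2,-1,22,2,-1])) (Leaf [9,-4,1,10,4,-1,18,4,-1,22,4,-1])) (Split
22 289 (-164) (Split 6 0 332 (Leaf
[1,0,1,2,1,0,4,1,0,6,1,3,9,-5,-2,10,5,3,13,1,3,17,1,1,18,13,-7,22,13,-10,23,0,3,26,9,-9]) (Leaf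
[6,-4,10,13,-4,10,22,0,-11,23,0,11,25,-4,-1])) (Leaf [9,-2,-1,10,2,1,18,3,0,22,3,0,26,1,-1]))))
(Split 22 289 (-164) (Split 9 (-289) 164 (Leaf [9,-11,8,10,2,1,11,9,-9,18,2,1,22,11,-8]) (Leaf
[6,0,3,9,-3,-1,10,3,1,13,0,3,18,3,1,22,3,-2,23,0,3])) (Split 18 321 86 (Leaf
[9,-3,0,10,3,0,18,3,0,22,3,0]) (Leaf [9,-4,-4,10,4,4,18,4,4,22,4,4])))) (Split 18 289 (-164)
(Split 9 (-289) 164 (Split 6 86 321 (Split 12 (-164) 289 (Leaf [6,4,4,12,4,4,22,4,4,25,4,4])
(Split 25 (-164) 289 (Leaf [6,3,3,12,3,3,22,3,3,25,3,3]) (Split 0 (-235) 235 (Split 0 (-164) 289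
(Leaf [0,1,3,12,1,3,17,1,3,18,-1,-3]) (Leaf [0,-2,3,12,-2,3,17,-2,3,18,2,-3])) (Split 0 (-326) 64
(Split 2 321 86 (Leaf
[0,-13,7,2,11,-3,4,11,-3,6,4,6,9,-5,1,10,5,-1,12,-9,13,17,-2,4,18,7,-5,22,-2,8,25,-7,9]) (Leaf
[0,-11,6,2,6,3,3,-1,5,4,7,-2,6,3,5,9,-7,5,10,6,0,12,-8,11,17,-5,9,18,11,-9,22,3,2,25,-4,7])) (Leaf
[0,-3,-4,1,1,4,2,2,0,4,2,0,6,3,4,9,1,4,25,1,4]))))) (Split 12 (-164) 289 (Leaf
[6,-1,4,12,-1,4,22,-1,4,25,-1,4]) (Split 25 (-164) 289 (Leaf [6,-1,4,12,-1,4,22,-1,4,25,-1,4])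
(Leaf [6,-3,4,9,-2,0,10,2,0,12,-3,4,18,2,0,22,-1,4,25,-3,4])))) (Leaf
[9,-3,-3,10,3,3,18,3,3,22,3,3])) (Leaf [9,-4,-4,10,4,4,18,4,4,22,4,4])))) (Split 2 321 86 (Split 0
(-235) 235 (Split 18 289 (-164) (Split 0 (-164) 289 (Leaf [0,1,3,12,1,3,17,1,3,18,-1,-3]) (Split
12 (-86) 321 (Leaf [0,2,4,12,2,4,17,2,4,18,-2,-4]) (Leaf [0,-2,4,12,-2,4,17,-2,4,18,2,-4])))
(Split 6 (-86) 321 (Split 7 321 86 (Split 2 321 (-86) (Leaf [2,4,-2,4,4,-2,7,4,-2]) (Split 4 321
(-86) (Leaf [2,4,-2,4,4,-2,7,4,-2]) (Leaf [2,15,0,4,15,0,6,1,4,7,14,-4,13,1,4,27,1,4]))) (Split 23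
64 326 (Split 0 (-164) 289 (Leaf [0,2,4,7,2,4,12,2,4,23,2,4]) (Split 12 (-164) 289 (Leaf
[0,2,3,7,2,3,12,2,3,23,2,3]) (Split 26 326 64 (Split 18 332 0 (Split 22 332 0 (Leaf
[18,3,-1,22,3,-1,26,3,-1]) (Leaf
[0,-6,11,2,4,-1,4,4,-1,7,-2,10,12,-6,11,18,18,-6,22,12,5,25,-6,11,26,18,-6])) (Leaf
[1,1,4,7,1,4,10,1,4,18,1,4,23,1,4])) (Split 13 64 326 (Split 18 321 (-86) (Split 22 332 0 (Leaf
[0,-3,13,7,2,4,12,-6,7,13,3,6,17,-5,9,18,12,-5,22,4,-2,23,2,4,26,7,4]) (Leaf
[0,-5,9,12,-6,8,13,1,1,17,-5,9,18,13,-5,22,7,3,26,8,4])) (Leaf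
[0,2,3,7,2,3,13,2,3,18,2,3,23,2,3,26,2,3])) (Leaf
[0,-5,10,2,3,-1,4,3,-1,7,-2,9,13,-5,10,25,-5,10]))))) (Split 0 (-86) 321 (Leaf
[0,1,3,7,1,3,13,1,3,25,1,3]) (Leaf [0,-7,18,2,3,-1,4,3,-1,7,-4,17,12,-7,18,23,-7,18])))) (Split 7
332 0 (Leaf [2,4,-2,5,4,-2,6,-4,2,7,4,-2]) (Leaf [0,3,3,6,-4,-1,7,3,3,12,-1,2,23,-1,2])))) (Split
1 86 321 (Split 19 235 235 (Split 7 321 86 (Leaf [4,3,-1,7,3,-1,17,-3,1,19,3,-1]) (Split 19 321 86
(Leaf [4,3,-1,19,3,-1,25,-3,1,26,3,-1]) (Split 4 326 (-64) (Split 0 (-326) 64 (Split 5 289 164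
(Leaf [0,-4,2,5,4,-2,17,-4,2,19,4,-2]) (Split 26 289 164 (Leaf [4,4,-2,19,4,-2,25,-4,2,26,4,-2])
(Split 13 164 289 (Leaf [5,4,2,13,4,2,19,4,2,26,4,2]) (Split 6 0 332 (Leaf
[0,-6,3,4,6,-3,5,5,4,6,2,4,13,1,11,17,-6,3,19,11,1,25,-4,7,26,5,4]) (Leaf
[4,2,-1,5,12,9,6,-9,18,13,3,27,19,14,8,25,-11,19,26,14,8]))))) (Split 5 332 0 (Leaf
[0,-4,-1,4,2,1,5,4,-2,6,0,3,17,-4,-1,19,6,-1,25,-2,2,26,2,-2]) (Leaf
[0,-5,-2,1,1,1,5,5,2,10,1,1,17,-4,-1,19,5,2]))) (Leaf
[1,1,2,4,5,3,7,5,3,10,1,2,17,-4,-1,19,5,3])))) (Split 6 (-86) 321 (Split 3 (-86) 321 (Split 19 86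
321 (Leaf [3,2,4,10,2,4,19,2,4]) (Leaf [1,-1,2,2,2,-1,3,0,7,10,-1,9,17,1,1,19,-2,8])) (Split 19 86
321 (Split 7 326 64 (Split 4 332 0 (Leaf [2,3,-1,4,3,-1,7,3,-1]) (Leaf
[0,-4,-4,1,2,4,2,15,-4,4,15,2,5,2,-2,6,2,6,7,13,-4,10,2,4,19,2,4])) (Split 5 332 0 (Split 0 (-332)
0 (Leaf [0,-3,1,2,3,-1,5,3,-1]) (Leaf
[0,-15,-6,1,5,9,2,10,-3,3,-3,5,4,7,7,5,12,-5,6,3,11,10,2,14,19,6,10,25,-4,4,26,4,-4])) (Split 0
(-326) 64 (Split 5 326 64 (Leaf [0,-3,2,2,3,-2,5,3,-2]) (Split 4 326 (-64) (Split 11 326 64 (Split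
12 (-164) 289 (Leaf [0,-5,3,1,2,3,5,3,5,10,0,11,11,2,-8,12,-2,8,17,-3,6,19,3,5]) (Leaf
[0,-28,15,1,7,12,2,7,-2,5,12,6,10,-9,33,11,16,-21,12,-16,21,17,-14,25,19,5,8])) (Split 23 64 326
(Split 12 (-64) 326 (Leaf [6,2,3,12,2,3,23,2,3]) (Split 18 326 (-64) (Split 6 86 321 (Split 2 332
0 (Leaf [0,-4,2,2,4,-2,4,4,-2,6,4,-1,13,0,1,25,0,1]) (Split 17 (-164) 289 (Leaf
[0,-15,8,1,5,9,2,10,1,3,-5,9,4,15,-8,6,16,-4,10,0,18,13,1,4,17,0,18,25,1,4]) (Split 12 (-164) 289
(Leaf [6,2,3,12,2,3,23,2,3]) (Split 18 289 (-164) (Leaf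
[0,-15,8,2,8,1,3,-2,5,4,10,-4,6,11,-2,10,-2,5,12,-4,6,17,-7,9,18,5,-4,23,1,2]) (Leaf
[0,-18,9,2,10,1,3,-3,8,4,13,-7,6,15,-4,10,-3,8,12,-3,5,17,-8,10,18,5,-2,23,2,3]))))) (Split 13 64
326 (Split 2 321 (-86) (Split 26 326 64 (Leaf [1,0,4,2,0,-4,4,1,-2,10,0,4,19,1,2,25,-1,2,26,1,-2])
(Split 22 321 (-86) (Leaf
[1,9,16,2,-3,-13,5,6,3,6,0,8,7,6,3,10,0,11,11,9,5,13,6,11,19,9,16,22,3,-6,23,6,11,26,9,5]) (Split
26 289 164 (Leaf [1,8,15,2,-4,-15,4,3,-2,7,4,0,10,0,11,11,8,4,19,7,13,22,7,2,23,1,2,26,7,2])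
(Split 11 289 164 (Leaf [0,-2,1,1,3,6,2,-1,-7,5,3,1,10,0,5,11,3,1,13,1,2,19,4,8,22,3,1,26,4,3])
(Leaf
[0,-4,2,1,19,33,2,-8,-31,4,4,-2,5,7,4,7,7,4,10,0,18,11,19,15,13,3,6,19,19,33,22,16,9,23,3,6,26,
19,15]))))) (Split 26 326 64 (Leaf
[1,3,5,2,6,0,3,-8,14,4,17,-9,7,9,5,10,-5,19,19,3,5,25,-8,14,26,8,-14]) (Split 22 321 (-86) (Split
7 289 164 (Leaf [2,3,0,5,4,2,6,0,6,7,3,0,13,4,8,18,2,-1,19,1,2,22,-1,-7,23,3,6,26,3,1]) (Split 5
289 164 (Leaf
[0,-2,1,1,8,14,2,13,0,5,17,6,6,0,32,7,19,15,10,0,10,11,8,4,13,15,39,19,4,6,22,-11,-43,23,19,47,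
26,4,-4]) (Leaf
[1,4,7,2,5,0,5,9,7,6,0,15,7,9,7,10,0,5,11,4,2,13,9,22,19,4,7,22,-5,-20,23,9,22,26,4,2]))) (Split
22 321 86 (Split 9 (-235) 235 (Split 9 (-220) 249 (Split 4 289 (-164) (Leaf
[1,7,4,3,-13,24,4,18,-15,7,7,4,9,1,26,10,-7,2,19,5,9,25,-11,19,26,12,7]) (Leaf
[1,4,7,2,8,0,3,-8,14,4,20,-7,7,12,7,9,2,19,10,-6,2,19,4,7,25,-8,14,26,10,5])) Opt) (Split 9 (-326)
64 Opt (Leaf [0,-13,7,2,9,0,3,-4,6,5,24,13,9,-11,-20,10,7,26,13,11,20,17,-4,7,19,11,19]))) (Split
12 (-164) 289 (Leaf [6,0,4,12,0,4,22,0,4,25,0,4]) (Split 0 (-289) 164 (Leaf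
[0,-8,6,2,4,0,3,0,2,4,4,-2,6,0,5,10,0,2,12,-8,11,17,-4,6,18,6,-3,22,-2,8,25,-4,7,26,2,1]) (Leaf
[0,-13,-3,1,5,3,2,8,0,4,4,-2,5,4,2,6,0,13,11,5,3,12,-9,12,22,-4,15,25,-4,15]))))))) (Leaf
[6,-2,3,13,-2,3,25,-2,3]))) (Split 2 332 0 (Leaf
[1,13,23,2,15,-8,3,-1,1,4,16,-9,7,28,15,10,12,24,18,12,24,23,12,24]) (Leaf
[1,4,7,2,1,5,3,-4,8,4,5,-3,7,9,5,10,0,15,17,-4,7,18,4,8,23,4,8])))) (Split 6 86 321 (Leaf
[0,-4,2,2,4,-2,4,4,-2,6,2,3,12,-2,5,23,-2,5]) (Leaf [6,-1,3,12,-1,3,23,-1,3])))) (Split 2 321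
(-86) (Leaf [1,1,2,2,1,-1,4,2,1,7,2,1,10,1,2,19,1,2]) (Leaf [2,4,2,4,4,2,7,4,2])))) (Split 2 321
(-86) (Leaf [0,-5,-2,1,2,4,2,3,-2,5,5,2,10,2,4,19,2,4]) (Leaf [0,-3,-1,2,3,1,5,3,1]))))) (Leaf
[3,-2,4,10,-2,4,19,-2,4]))) (Split 5 321 86 (Leaf [2,3,-1,5,3,-1,6,-3,1,7,3,-1]) (Split 7 321 86
(Leaf [2,4,-1,5,4,-1,6,-4,1,7,4,-1]) (Split 19 0 332 (Split 2 332 0 (Split 11 326 64 (Leaf
[1,1,2,2,5,-2,5,5,3,6,-6,0,7,6,0,10,0,5,11,1,-3,12,-1,3,19,0,5]) (Split 12 (-164) 289 (Split 23
164 289 (Split 19 164 289 (Split 1 164 289 (Split 2 321 (-86) (Leaf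
[1,3,4,2,-1,-4,5,2,0,6,-2,0,7,2,0,10,3,4,19,3,4]) (Leaf
[1,9,11,2,9,-1,5,12,7,6,-13,-3,7,18,10,10,3,8,11,6,3,12,-1,4,19,3,8,23,5,7])) (Leaf
[1,0,11,2,3,-1,5,7,4,6,-8,-2,7,7,4,10,0,11,13,-1,2,17,-4,6,19,4,5,25,-1,2])) (Leaf
[1,4,7,2,5,-2,5,5,3,6,-6,-1,7,9,5,10,0,5,11,4,2,12,-1,2,19,0,5,23,3,4])) (Leaf
[1,1,2,2,2,-1,5,3,1,6,-6,10,7,3,1,10,1,2,12,-3,11,19,1,2,23,-3,11])) (Leaf
[1,8,14,2,9,-4,5,13,6,6,-20,-5,7,17,10,10,0,10,11,8,4,12,-8,-4,13,1,5,19,4,10,25,-3,5,26,4,0])))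
(Leaf [2,4,1,5,4,1,6,-4,-1,7,4,1])) (Leaf [1,0,1,2,1,0,3,-2,7,10,-2,8,17,1,1,19,-3,7])))))) (Leaf
[1,-2,4,10,-2,4,17,-2,4]))) (Split 17 (-164) 289 (Leaf [2,0,3,3,0,3,10,0,3,17,0,3]) (Split 5 326
64 (Split 0 (-235) 235 (Leaf [0,0,4,3,-1,4,5,1,-4,10,0,4,14,1,0,17,0,4]) (Split 3 (-164) 289 (Leaf
[2,0,3,3,0,3,10,0,3,17,0,3]) (Split 0 (-321) 86 (Leaf
[0,-3,2,2,1,1,3,-2,3,5,3,-2,10,-2,3,17,-2,3]) (Leaf
[0,-3,-1,2,-2,8,3,-6,8,4,1,1,5,3,-1,6,0,2,7,1,-1,10,-6,8,17,-6,8])))) (Split 3 (-164) 289 (Leaf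
[2,0,4,3,0,4,10,0,4,17,0,4]) (Split 4 289 (-164) (Split 7 321 86 (Leaf
[3,-2,3,4,2,-3,7,2,-3,10,-2,3,17,-2,3]) (Split 10 (-47) 329 (Split 9 (-235) 235 (Leaf
[2,-2,8,3,-5,10,4,3,-2,7,3,2,9,0,4,10,-5,6,17,-5,6,25,0,4]) (Split 18 326 (-64) (Split 9 (-326) 64
(Split 22 332 0 (Leaf [2,-5,19,3,-5,19,9,-6,3,10,1,16,17,-5,19,18,6,-3,22,6,-3]) (Split 9 (-307)
127 (Split 25 (-164) 289 (Split 22 321 86 (Leaf
[2,-1,5,3,-4,7,4,3,-2,7,2,1,9,-4,3,10,0,4,17,-3,4,18,3,0,22,3,0,25,-1,3]) (Leaf
[2,-2,8,3,-6,11,4,4,-3,7,2,2,9,-5,3,10,-1,8,17,-4,6,18,3,2,22,3,2,25,-2,5])) (Leaf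
[2,-1,4,3,-6,8,4,5,-4,9,-5,4,10,-1,4,17,-1,4,25,-5,4])) (Leaf
[2,-1,4,3,-2,3,4,1,1,7,1,1,9,-2,-1,10,0,4,17,-2,3,18,2,1,22,2,1]))) (Leaf
[2,-1,6,3,-2,3,5,1,3,9,-1,-3,10,-1,6,13,1,3,17,-1,6])) (Leaf
[2,-6,23,3,-14,29,4,8,-6,7,8,4,10,-14,29,17,-14,19,18,2,10,22,2,0,23,0,10,26,2,0]))) (Leaf
[2,-1,4,3,-1,4,10,-1,4,17,-1,4]))) (Split 7 321 86 (Leaf
[2,-1,6,3,-5,7,4,4,-1,7,4,-1,10,-5,7,17,-5,7]) (Leaf [2,2,3,4,2,3,7,2,3])))))))) (Split 26 332 0
(Split 7 332 0 (Split 2 332 0 (Leaf [2,3,-1,4,3,-1,7,3,-1]) (Leaf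
[2,4,2,3,-1,4,4,5,-2,7,5,-2,10,-1,4,17,2,2,26,3,-2,27,-3,2])) (Leaf
[1,0,3,7,4,4,10,0,3,25,4,4,26,0,-3,27,-4,-1])) (Split 0 (-235) 235 (Leaf
[0,0,3,13,0,3,17,4,4,26,4,4,27,-4,-1]) (Leaf
[0,-2,0,6,0,2,7,2,0,13,-2,2,17,1,1,25,2,2,26,1,1,27,-5,-1]))))))) (Split 2 321 86 (Split 7 321
(-86) (Leaf [2,4,-2,4,4,-2,7,4,-2]) (Split 7 321 86 (Split 4 289 (-164) (Leaf
[2,3,-3,4,3,-3,7,3,-3]) (Split 2 289 (-164) (Leaf [2,3,-2,4,3,-2,7,3,-2]) (Leaf
[2,6,-1,4,6,-1,7,6,-1]))) (Split 26 321 86 (Split 22 321 86 (Leaf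
[10,-4,1,11,4,-1,22,4,-1,26,4,-1]) (Split 11 321 86 (Leaf [10,-3,1,11,3,-1,22,3,-1,26,3,-1]) (Leaf
[1,-1,5,7,-1,5,10,-7,2,11,6,3,22,6,3,25,-1,5,26,7,-2]))) (Split 22 332 0 (Split 11 289 164 (Split
22 289 (-164) (Leaf [10,-3,3,11,3,-3,22,3,-3,26,3,-3]) (Leaf [10,-3,1,11,3,-1,22,3,-1,26,3,-1]))
(Split 6 0 332 (Split 23 0 332 (Split 0 (-235) 235 (Leaf
[0,2,8,7,2,5,10,-8,-2,11,8,2,13,2,8,17,0,3,22,6,-3,23,2,5,26,8,5]) (Split 13 164 289 (Leaf
[1,-2,4,6,5,12,10,-16,-4,11,14,8,13,5,12,17,-2,4,22,9,-4,23,5,12,26,14,8]) (Leaf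
[0,-4,0,1,1,3,6,5,12,10,-15,-4,11,16,7,13,1,12,17,-3,3,22,11,-5,23,5,12,26,12,7]))) (Split 22 321
(-86) (Leaf
[1,-19,19,2,15,-4,4,15,-4,6,4,17,7,-4,15,10,-19,19,13,4,17,22,15,-36,23,-15,36,26,19,-19]) (Leaf
[1,-7,7,2,4,-1,4,4,-1,10,-24,-6,11,17,13,17,-3,6,22,21,12,23,-4,1,26,21,12]))) (Split 1 164 289
(Split 23 127 307 (Split 22 289 (-164) (Leaf
[1,5,7,6,-2,4,7,7,4,10,-2,3,11,7,4,13,-2,4,17,-2,3,22,2,-4,23,5,8]) (Split 6 (-164) 289 (Split 26
289 164 (Leaf [10,-3,1,11,3,-1,22,3,-1,26,3,-1]) (Split 22 329 (-47) (Split 22 307 (-127) (Leaf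
[1,6,8,6,-1,6,7,8,5,10,-2,3,11,8,5,13,-1,6,17,-2,3,22,1,-6,23,7,11]) (Split 7 289 164 (Split 2 321
(-86) (Leaf
[1,3,4,2,1,-1,5,1,-1,6,-1,4,7,5,2,10,-4,-1,11,7,5,13,0,3,17,-1,1,22,3,-1,23,4,6,26,3,2]) (Leaf
[1,3,4,2,1,0,5,1,0,6,-1,4,7,5,2,10,-5,-1,11,8,5,13,0,4,17,-1,2,22,4,-1,23,4,6,26,4,3])) (Leaf
[1,7,10,6,-1,5,7,9,7,10,-6,0,11,13,10,13,-1,5,17,-2,3,22,5,-2,23,8,12,26,4,3]))) (Leaf
[10,-4,-1,11,4,1,22,4,1,26,4,1]))) (Leaf
[1,9,12,2,8,-2,5,8,-2,6,-9,2,7,17,10,11,9,12,12,-1,0,23,8,12]))) (Leaf [6,-2,5,12,-2,5,23,-2,5]))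
(Leaf [1,-3,2,10,-3,2,17,-3,2])))) (Split 11 332 0 (Split 22 289 164 (Leaf
[10,-2,1,11,2,-1,18,2,2,22,4,1,26,4,1]) (Leaf
[6,0,1,10,-2,1,11,2,-1,12,0,1,18,5,5,22,7,5,25,0,1,26,7,4])) (Leaf
[1,0,1,10,-4,-1,11,4,2,17,0,1,22,4,2,26,4,2])))))) (Split 3 0 332 (Split 3 86 321 (Leaf
[1,-3,3,2,1,1,3,1,1,10,-2,4,17,-2,4]) (Leaf [1,-2,2,2,0,2,3,0,2,10,-2,4,17,-2,4])) (Leaf
[1,-3,3,2,-1,4,3,-1,4,10,-4,7,17,-4,7]))))) (Split 22 332 0 (Split 0 (-235) 235 (Split 0 86 321
(Leaf [0,4,0,6,-4,4,7,4,0,12,3,3,13,-3,1,22,3,-1,23,0,4]) (Split 10 86 321 (Leaf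
[6,0,1,10,3,0,13,-3,1,14,3,0,18,3,0,22,3,-1,23,0,1]) (Leaf
[0,-1,3,10,-1,3,11,3,-3,12,1,1,13,-4,2,14,2,0,17,-1,3,22,4,-2]))) (Leaf
[0,-3,0,6,0,1,13,-3,1,17,-3,0,18,3,0,22,3,-1,23,0,1])) (Leaf
[6,-1,2,12,3,3,13,-4,-1,22,3,3,25,-1,2])))))) (Split 7 326 64 (Split 2 321 (-86) (Split 22 321
(-86) (Split 13 86 321 (Split 6 86 321 (Leaf [4,1,4,6,1,4,13,1,4,21,1,4,22,-1,-4]) (Leaf
[2,3,-1,4,1,1,5,2,-2,6,-2,2,7,3,-1])) (Leaf [4,0,4,6,0,4,12,1,1,13,-1,3,21,0,4,22,1,-3])) (Split 6
86 321 (Split 7 289 (-164) (Leaf [2,-1,-4,6,1,4,7,-1,-4,12,1,4,21,1,4]) (Split 25 (-64) 326 (Leaf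
[4,0,3,6,3,4,12,3,4,21,0,3,22,3,1,25,3,1]) (Split 21 (-86) 321 (Leaf [4,3,3,6,3,3,12,3,3,21,3,3])
(Split 19 235 235 (Leaf [4,3,2,6,2,3,12,2,3,19,4,0,21,-1,2,22,3,1,25,-1,1,26,4,0]) (Split 19 (-86)
321 (Split 10 (-164) 289 (Split 4 263 203 (Split 2 289 (-164) (Leaf [1,1,4,2,-1,-4,10,1,4,19,1,4])
(Split 7 332 0 (Split 6 164 289 (Split 4 289 164 (Leaf [2,3,-1,4,3,-1,7,3,-1]) (Split 7 329 (-47)
(Leaf [2,2,-1,4,5,3,6,3,4,7,2,-1,12,3,4,21,3,4]) (Leaf [2,3,0,4,6,4,6,3,4,7,3,0,12,3,4,21,3,4])))
(Leaf [2,4,-1,4,4,2,6,0,3,7,4,-1,12,0,3,21,0,3])) (Leaf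
[1,1,4,2,4,-2,4,5,2,7,5,2,10,1,4,19,1,4]))) (Leaf [4,2,4,6,2,4,12,2,4,21,2,4])) (Leaf
[1,-6,6,2,6,-6,4,9,8,6,7,12,10,-15,14,11,9,-8,12,7,12,19,3,14,22,16,4,25,-2,4,26,18,0])) (Leaf
[1,0,2,2,5,-3,4,5,3,6,0,4,7,5,-1,10,0,2,12,0,4,18,4,0,19,-4,2,21,4,4])))))) (Leaf
[2,4,-2,4,1,1,5,3,-3,6,-3,3,7,4,-2]))) (Split 6 (-86) 321 (Split 27 235 235 (Split 21 (-86) 321
(Leaf [4,1,3,6,1,3,12,1,3,21,1,3]) (Split 22 289 164 (Split 6 86 321 (Leaf
[2,8,0,4,4,7,6,4,7,12,4,6,13,0,1,21,-4,7,22,8,-1,27,8,0]) (Leaf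
[2,6,0,4,0,10,6,0,10,12,0,9,13,0,1,21,-6,10,22,6,-1,27,6,0])) (Leaf
[2,5,0,4,3,2,5,2,-2,6,3,11,12,5,9,22,5,9,25,0,9,27,5,0]))) (Split 7 321 (-86) (Split 13 64 326
(Split 26 326 64 (Split 27 0 332 (Leaf [2,3,1,4,2,2,5,1,-1,6,1,4,7,1,-2,13,2,3,27,2,3]) (Split 18
321 86 (Leaf [4,4,4,6,2,8,7,2,-4,12,0,5,13,2,3,18,4,-1,21,4,4,26,4,-1,27,-2,4]) (Leaf
[1,0,6,4,7,7,6,3,11,7,4,-4,10,0,6,12,0,3,13,3,8,18,7,4,21,7,7,26,7,-2,27,-4,10]))) (Leaf
[6,1,4,7,-1,-4,13,1,4,17,1,4,26,1,4])) (Split 27 86 321 (Split 2 332 0 (Leaf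
[2,14,1,4,14,8,6,4,14,7,10,-6,12,6,7,13,-2,7,21,0,7,22,6,0,27,4,7]) (Leaf
[2,8,3,4,8,8,6,3,11,7,5,-3,12,5,5,13,-2,6,21,0,5,22,5,0,27,3,6])) (Leaf
[6,-1,4,7,1,-4,13,-1,4,27,-1,4]))) (Leaf [2,4,2,4,4,2,7,4,2]))) (Leaf
[2,2,1,4,-1,4,5,3,-3,6,-3,3,7,2,1]))) (Split 21 (-86) 321 (Split 6 0 332 (Leaf
[4,2,4,6,2,4,12,2,4,21,2,4]) (Leaf [2,2,1,4,-1,4,5,3,-3,6,-3,3,7,2,1])) (Split 19 235 235 (Split 6
0 332 (Split 22 321 86 (Leaf [4,3,7,6,3,7,12,3,5,13,0,2,19,7,0,21,-4,7,22,7,-2,26,7,0]) (Split 6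
86 321 (Leaf [4,3,2,6,3,4,12,3,4,19,4,0,21,-1,2,22,4,2,25,0,2,26,4,0]) (Leaf
[4,0,2,5,2,-2,6,0,4,12,2,2,19,2,0,22,2,2,25,0,2,26,2,0]))) (Leaf
[2,2,1,4,-1,4,5,3,-3,6,-3,3,7,2,1])) (Split 2 289 (-164) (Split 19 64 326 (Split 10 (-164) 289
(Leaf [1,1,4,4,1,4,7,1,4,10,1,4,19,1,4]) (Leaf [1,-3,4,2,4,-3,4,1,1,7,1,1,10,-3,4,19,-3,4])) (Leaf
[1,0,3,2,2,-2,4,2,2,6,0,1,7,2,1,10,0,3,12,0,1,18,1,0,19,-1,3,21,1,1])) (Leaf
[2,4,2,4,4,2,7,4,2]))))))) (Split 10 (-86) 321 (Split 10 86 321 (Split 14 321 86 (Split 2 332 0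
(Leaf [1,-3,1,2,3,-1,5,3,-1,14,3,-1]) (Leaf [1,-4,-1,2,4,4,3,4,4,10,0,3,17,0,3])) (Split 5 321 86
(Split 2 332 0 (Leaf [1,-3,1,2,3,-1,5,3,-1,14,3,-1]) (Leaf [1,-4,-1,2,4,4,3,4,4,10,0,3,17,0,3]))
(Split 19 235 235 (Split 10 164 289 (Split 19 321 86 (Leaf [5,3,-1,10,3,-1,14,3,-1,19,3,-1]) (Leaf
[5,4,2,10,4,2,14,4,2,19,4,2])) (Split 19 332 0 (Leaf
[1,0,1,5,4,-2,10,4,-1,14,4,-2,17,0,1,19,4,-2]) (Split 17 0 332 (Split 2 289 (-164) (Split 1 (-203)
263 (Split 17 86 321 (Leaf [1,-2,5,2,4,-3,5,4,-3,10,2,2,14,4,-3,17,2,2]) (Split 1 (-164) 289 (Leaf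
[1,1,4,10,1,4,17,1,4]) (Leaf [1,-4,3,2,4,-3,5,4,-3,14,4,-3]))) (Leaf
[1,-4,3,2,4,-3,5,4,-3,14,4,-3])) (Leaf [1,-2,3,2,4,2,5,4,2,10,2,5,14,4,2,17,2,5])) (Split 19 289
164 (Leaf [1,-2,4,5,4,1,10,2,5,14,4,1,17,-2,4,19,4,1]) (Split 1 (-127) 307 (Leaf
[1,-3,7,10,-3,7,17,-3,7]) (Leaf [1,-2,3,5,4,2,10,2,5,14,4,2,17,-2,3,19,4,2])))))) (Split 2 332 0
(Split 19 64 326 (Split 2 321 (-86) (Leaf [1,-1,1,2,1,-1,3,3,3,10,2,4,19,2,4]) (Leaf
[1,-4,-1,2,4,1,5,5,3,10,1,2,14,5,3,19,1,2])) (Leaf [1,-3,3,2,3,-3,10,-3,3,19,-3,3])) (Leaf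
[1,-4,-1,2,4,4,3,4,4,10,0,3,17,0,3]))))) (Split 17 86 321 (Split 2 321 (-86) (Split 16 (-235) 235
(Leaf [1,-4,4,2,4,-4,5,4,-4,6,0,4,10,0,4,14,4,0,16,0,4]) (Split 4 326 (-64) (Split 16 (-321) (-86)
(Leaf [2,30,-16,4,30,-16,7,11,-11,16,-19,5,17,19,-5]) (Leaf
[2,4,-2,4,4,-2,7,3,-3,16,-1,-1,17,1,1])) (Split 16 (-321) 86 (Leaf
[1,-3,5,2,6,-2,4,3,1,5,3,-3,6,0,3,10,0,5,14,3,0,16,-3,2,17,3,3]) (Leaf
[2,4,1,4,4,1,16,-4,-1,17,4,1])))) (Leaf [1,-1,1,2,3,3,3,3,3,10,2,4,17,2,4])) (Leaf
[1,-2,4,10,-2,4,17,-2,4]))) (Split 2 321 86 (Split 16 (-235) 235 (Split 6 86 321 (Leaf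
[1,-4,1,2,4,-1,4,4,0,6,4,1,10,-1,1,12,1,1,14,3,0,16,0,1,21,0,1,22,1,0,26,1,0]) (Split 16 0 332
(Leaf [1,-2,3,2,11,-3,5,11,-3,6,-2,9,7,9,0,10,-5,9,11,6,-6,12,6,6,14,3,0,16,7,9,22,12,0,26,12,0])
(Leaf [1,-8,2,2,8,-2,3,3,3,5,5,-5,6,-2,5,10,-2,5,14,3,0,16,-2,5]))) (Split 4 321 86 (Split 16
(-321) (-86) (Leaf [1,-4,1,2,4,-1,4,4,-1,10,-4,1,16,-4,1]) (Leaf
[1,-2,0,2,2,0,4,2,0,10,-3,0,11,1,0,16,-2,-1,22,1,0,25,0,1,26,1,-1])) (Leaf
[1,-3,0,2,3,0,4,2,1,5,1,-1,6,0,1,10,-2,0,14,1,0,16,-2,0]))) (Leaf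
[1,-4,-1,2,3,3,3,3,3,10,-1,2,17,-1,2])))"

text \<open>The optimal configuration has this pattern, hence the nonempty list of target
  cones.\<close>

lemma check_1111: "check edges contact_cones (start cE cN cE cN) tree_1111"
  by code_simp

subsection \<open>Cycles of rhombi\<close>

text \<open>Equivalent to a side with half base \<open>d0 / 2\<close> and height
  \<open>1/2 - d0 / 2\<close> having length \<open>d0\<close>.\<close>

lemma d0_quad: "d0\<^sup>2 = 1/2 - d0"
  by (simp only: d0_sq) (simp add: d0_eq field_simps)

lemma d0_frac: "36602/100000 < d0" "d0 < 36603/100000"
  using d0_bounds by simp_all

text \<open>The function \<open>z \<mapsto> sqrt (d\<^sup>2 - (1/2 - d/2 - z)\<^sup>2)\<close> is concave with value \<open>d/2\<close> at 0; \<open>6/5\<close> and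
  \<open>48/25 = 6/5 + 18/25\<close> are slopes of secants to the right and to the left of 0. It matters that both exceed 1.\<close>

lemma side_bound:
  assumes "0 \<le> a" "a\<^sup>2 + b\<^sup>2 \<ge> d0\<^sup>2" and z: "z = (1/2 - d0 / 2) - b" "z \<le> 77/1000"
    and e: "0 \<le> e" "- z \<le> e" "e \<le> 146/10000"
  shows "d0 / 2 + 6/5 * z - 18/25 * e \<le> a"
proof -
  have b: "b\<^sup>2 = ((1/2 - d0 / 2) - z)\<^sup>2" using z by simp
  have K: "(1/2 - d0 / 2)\<^sup>2 = 3/4 * d0\<^sup>2"
  proof -
    have "(1/2 - d0 / 2)\<^sup>2 = 1/4 - 1/2 * d0 + 1/4 * d0\<^sup>2"
      by (simp add: power2_eq_square field_simps)
    also have "\<dots> = 3/4 * d0\<^sup>2"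
      by (simp only: d0_quad) (simp add: field_simps)
    finally show ?thesis .
  qed
  \<comment> \<open>The squares of the line with slope \<open>m\<close> and of the concave function
    differ by this product. It contains the factor \<open>z\<close> because the two agree at
    0.\<close>
  have key: "d0 / 2 + m * z \<le> a" if "z * ((1 + m\<^sup>2) * z - (1 - d0 - m * d0)) \<le> 0" for m
  proof (rule power2_le_imp_le)
    have "(d0 / 2 + m * z)\<^sup>2 = d0\<^sup>2 - b\<^sup>2 + z * ((1 + m\<^sup>2) * z - (1 - d0 - m * d0))"
      using K unfolding b by (simp add: power2_eq_square algebra_simps)
    then show "(d0 / 2 + m * z)\<^sup>2 \<le> a\<^sup>2" using that assms(2) by linarith
  qed (rule assms(1))
  show ?thesis
  \<comment> \<open>The ranges are chosen for the slopes: 2.44 * 0.077 < 1 - 2.2 \<open>d0\<close>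
    on the right, and 4.6864 * 0.0146 < 2.92 \<open>d0\<close> - 1 on the left.\<close>
  proof (cases "0 \<le> z")
    case True
    have "z * ((1 + (6/5)\<^sup>2) * z - (1 - d0 - 6/5 * d0)) \<le> 0"
      using True z(2) d0_frac by (intro mult_nonneg_nonpos) (auto simp: power2_eq_square)
    from key[OF this] show ?thesis using e by simp
  next
    case False
    have "z * ((1 + (48/25)\<^sup>2) * z - (1 - d0 - 48/25 * d0)) \<le> 0"
      using False e d0_frac by (intro mult_nonpos_nonneg) (auto simp: power2_eq_square)
    from key[OF this] have "d0 / 2 + 48/25 * z \<le> a" .
    moreover have "18/25 * (- z) \<le> 18/25 * e" using e by simp
    ultimately show ?thesis by linarith
  qed
qed

text \<open>\<open>(p, q)\<close> is the short diagonal of a rhombus, \<open>(a\<^sub>k, b\<^sub>k)\<close> are its sides, and the long diagonal is the complement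
  \<open>(q', 1 - p')\<close> of the short diagonal of the next rhombus. So if \<open>p' > d\<close>, the long diagonal is too short, and
  \<open>p - d\<close> must exceed \<open>p' - d\<close> by a factor; four rhombi form a cycle, which leaves only \<open>p = d\<close>.\<close>

locale rhombus =
  fixes a1 b1 a2 b2 a3 b3 a4 b4 p q p' q' :: real
  assumes pos: "0 \<le> a1" "0 \<le> a2" "0 \<le> a3" "0 \<le> a4"
    and far: "d0\<^sup>2 \<le> a1\<^sup>2 + b1\<^sup>2" "d0\<^sup>2 \<le> a2\<^sup>2 + b2\<^sup>2" "d0\<^sup>2 \<le> a3\<^sup>2 + b3\<^sup>2" "d0\<^sup>2 \<le> a4\<^sup>2 + b4\<^sup>2"
    and tall: "218/908 \<le> b1" "218/908 \<le> b2" "218/908 \<le> b3" "218/908 \<le> b4"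
    and short_diag: "p = a1 + a2" "p = a3 + a4" "q = b2 - b1" "q = b3 - b4"
    and long_diag: "b1 + b3 = 1 - p'" "b2 + b4 = 1 - p'" "\<bar>a3 - a1\<bar> = \<bar>q'\<bar>"
begin

lemma width: "p' \<le> 52/100"
  using tall long_diag by simp

text \<open>Sides 1 and 3 meet at one end of the short diagonal, sides 2 and 4 at the other. From
  each pair the side with the smaller \<open>b\<close> is used. As \<open>b2 - b1\<close> and
  \<open>b3 - b4\<close> both equal \<open>q\<close>, the deficits \<open>z1\<close> and
  \<open>z2\<close> of these two add up to at least \<open>p' - d0 + \<bar>q\<bar>\<close>. If the
  chosen sides do not share an end of the long diagonal, one of them is replaced by the other of its
  pair, at the cost of \<open>\<bar>q'\<bar>\<close>. The two error terms 18/25 \<open>e\<close> of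
  \<open>side_bound\<close> give 36/25 \<open>e\<close>.\<close>

lemma
  assumes e: "0 \<le> e" "d0 - p' \<le> 2 * e" "e \<le> 146/10000"
  shows growth: "p - d0 \<ge> 6/5 * (p' - d0 + \<bar>q\<bar>) - \<bar>q'\<bar> - 36/25 * e" (is ?growth)
    and rigid: "e = 0 \<Longrightarrow> p = d0 \<Longrightarrow> q = 0 \<Longrightarrow> p' = d0 \<Longrightarrow> q' = 0 \<Longrightarrow>
      a1 = d0 / 2 \<and> a2 = d0 / 2 \<and> a3 = d0 / 2 \<and> a4 = d0 / 2 \<and>
      b1 = (1/2 - d0 / 2) \<and> b2 = (1/2 - d0 / 2) \<and> b3 = (1/2 - d0 / 2) \<and> b4 = (1/2 - d0 / 2)"
proof -
  define z1 where "z1 = (1/2 - d0 / 2) - min b1 b3"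
  define z2 where "z2 = (1/2 - d0 / 2) - min b2 b4"
  have m1: "218/908 \<le> min b1 b3" "min b1 b3 \<le> b1" "min b1 b3 \<le> b3"
    and m2: "218/908 \<le> min b2 b4" "min b2 b4 \<le> b2" "min b2 b4 \<le> b4"
    using tall by simp_all
  have z1: "z1 \<le> 77/1000" using m1(1) d0_frac unfolding z1_def by linarith
  have z1': "- z1 \<le> e" using m1 long_diag(1) e(2) unfolding z1_def by linarith
  have z2: "z2 \<le> 77/1000" using m2(1) d0_frac unfolding z2_def by linarith
  have z2': "- z2 \<le> e" using m2 long_diag(2) e(2) unfolding z2_def by linarith
  have A: "(b1 \<le> b3 \<and> d0 / 2 + 6/5 * z1 - 18/25 * e \<le> a1) \<or> (b3 \<le> b1 \<and> d0 / 2 + 6/5 * z1 - 18/25 * e \<le> a3)"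
    using side_bound[OF pos(1) far(1), of z1 e] side_bound[OF pos(3) far(3), of z1 e] z1 z1' e
    by (auto simp: z1_def min_def)
  have B: "(b2 \<le> b4 \<and> d0 / 2 + 6/5 * z2 - 18/25 * e \<le> a2) \<or> (b4 \<le> b2 \<and> d0 / 2 + 6/5 * z2 - 18/25 * e \<le> a4)"
    using side_bound[OF pos(2) far(2), of z2 e] side_bound[OF pos(4) far(4), of z2 e] z2 z2' e
    by (auto simp: z2_def min_def)
  have q': "\<bar>a2 - a4\<bar> = \<bar>q'\<bar>" using short_diag long_diag(3) by linarith
  have zz: "p' - d0 + \<bar>q\<bar> \<le> z1 + z2"
    using long_diag(1,2) short_diag(3,4) m1 m2 unfolding z1_def z2_def by linarith
  have w: "6/5 * (p' - d0 + \<bar>q\<bar>) \<le> 6/5 * z1 + 6/5 * z2"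
    using zz by simp
  have "a1 \<le> a3 + \<bar>q'\<bar>" "a3 \<le> a1 + \<bar>q'\<bar>" "a2 \<le> a4 + \<bar>q'\<bar>" "a4 \<le> a2 + \<bar>q'\<bar>"
    using q' long_diag(3) by linarith+
  then show ?growth
    using A B w short_diag(1,2) by (elim disjE conjE) linarith+
  assume r: "e = 0" "p = d0" "q = 0" "p' = d0" "q' = 0"
  then have "0 \<le> z1" "0 \<le> z2" using z1' z2' by auto
  moreover have "z1 + z2 \<le> 0"
    using A B q' long_diag(3) short_diag(1,2) r by (simp only: abs_zero abs_eq_0) linarith
  ultimately have z0: "z1 = 0" "z2 = 0" by auto
  have "b1 = (1/2 - d0 / 2) \<and> b3 = (1/2 - d0 / 2)"
    using z0(1) long_diag(1) r(4) m1 unfolding z1_def by linarith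
  moreover have "b2 = (1/2 - d0 / 2) \<and> b4 = (1/2 - d0 / 2)"
    using z0(2) long_diag(2) r(4) m2 unfolding z2_def by linarith
  ultimately have "b1 = (1/2 - d0 / 2)" "b2 = (1/2 - d0 / 2)" "b3 = (1/2 - d0 / 2)" "b4 = (1/2 - d0 / 2)"
    by blast+
  then show "a1 = d0 / 2 \<and> a2 = d0 / 2 \<and> a3 = d0 / 2 \<and> a4 = d0 / 2 \<and>
      b1 = (1/2 - d0 / 2) \<and> b2 = (1/2 - d0 / 2) \<and> b3 = (1/2 - d0 / 2) \<and> b4 = (1/2 - d0 / 2)"
    using A B q' long_diag(3) short_diag(1,2) r z0
    by (simp only: abs_zero abs_eq_0) linarith
qed

end

text \<open>The exact bound is the root of \<open>d0\<^sup>2 - q\<^sup>2\<close>, close to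
  \<open>d0\<close> minus \<open>q\<^sup>2\<close> / (2 \<open>d0\<close>). The coefficient 1.43
  exceeds 1 / (2 \<open>d0\<close>) by enough to absorb the term of fourth order in the given range
  of \<open>q\<close>.\<close>

lemma diag_bound:
  assumes "0 \<le> p" "d0\<^sup>2 \<le> p\<^sup>2 + q\<^sup>2" "\<bar>q\<bar> \<le> 1414/10000"
  shows "d0 - p \<le> 143/100 * q\<^sup>2"
proof (rule ccontr)
  assume "\<not> ?thesis"
  then have "p < d0 - 143/100 * q\<^sup>2" by simp
  then have "p\<^sup>2 < (d0 - 143/100 * q\<^sup>2)\<^sup>2"
    using assms(1) by (intro power_strict_mono) auto
  also have "\<dots> = d0\<^sup>2 - q\<^sup>2 * (286/100 * d0 - (143/100)\<^sup>2 * q\<^sup>2)"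
    by (simp add: power2_eq_square algebra_simps)
  also have "\<dots> \<le> d0\<^sup>2 - q\<^sup>2 * 1"
  proof -
    have "q\<^sup>2 \<le> (1414/10000)\<^sup>2" using power_mono[OF assms(3), of 2] by simp
    then have "1 \<le> 286/100 * d0 - (143/100)\<^sup>2 * q\<^sup>2" using d0_frac by (simp add: power2_eq_square)
    then show ?thesis by (intro diff_left_mono mult_left_mono) auto
  qed
  finally show False using assms(2) by simp
qed

text \<open>Adding \<open>growth\<close> over the cycle puts the same excesses and tilts on both
  sides, with the larger factor on the right. First the tilts are forced to vanish; then no short
  diagonal can be shorter than \<open>d0\<close>, and the sum leaves none longer.\<close>

lemma rhombus_cycle:
  fixes a1 b1 a2 b2 a3 b3 a4 b4 p q :: "nat \<Rightarrow> real"
  assumes R: "\<And>k j. (k, j) \<in> {(0, 1), (1, 2), (2, 3), (3, 0)} \<Longrightarrow>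
      rhombus (a1 k) (b1 k) (a2 k) (b2 k) (a3 k) (b3 k) (a4 k) (b4 k) (p k) (q k) (p j) (q j)"
    and D: "\<And>k. k < 4 \<Longrightarrow> d0\<^sup>2 \<le> (p k)\<^sup>2 + (q k)\<^sup>2 \<and> \<bar>q k\<bar> \<le> 271/1000 * p k"
    and k: "k < 4"
  shows "p k = d0 \<and> q k = 0 \<and>
    a1 k = d0 / 2 \<and> a2 k = d0 / 2 \<and> a3 k = d0 / 2 \<and> a4 k = d0 / 2 \<and>
    b1 k = 1/2 - d0 / 2 \<and> b2 k = 1/2 - d0 / 2 \<and> b3 k = 1/2 - d0 / 2 \<and> b4 k = 1/2 - d0 / 2"
proof -
  have next_ex: "\<exists>j<4::nat. (k, j) \<in> {(0, 1), (1, 2), (2, 3), (3, 0)}"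
    and prev_ex: "\<exists>j<4::nat. (j, k) \<in> {(0, 1), (1, 2), (2, 3), (3, 0)}" if "k < 4" for k :: nat
  proof -
    have "k = 0 \<or> k = 1 \<or> k = 2 \<or> k = 3" using that by auto
    then show "\<exists>j<4::nat. (k, j) \<in> {(0, 1), (1, 2), (2, 3), (3, 0)}"
      "\<exists>j<4::nat. (j, k) \<in> {(0, 1), (1, 2), (2, 3), (3, 0)}" by auto
  qed
  have w: "p k \<le> 52/100" if "k < 4" for k
  proof -
    obtain j :: nat where "(j, k) \<in> {(0, 1), (1, 2), (2, 3), (3, 0)}" using prev_ex[OF \<open>k < 4\<close>] by blast
    then show ?thesis by (rule rhombus.width[OF R])
  qed
  have p0: "0 \<le> p k" if "k < 4" for k using D[OF that] by auto
  have Q: "\<bar>q k\<bar> \<le> 1410/10000" if "k < 4" for k using D[OF that] w[OF that] by auto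
  have lo: "d0 - p k \<le> 143/100 * (q k)\<^sup>2" if "k < 4" for k
    using D[OF that] Q[OF that] p0[OF that] by (intro diag_bound) auto
  \<comment> \<open>Half of the possible shortfall in \<open>diag_bound\<close>, the value used for
    \<open>e\<close> in \<open>growth\<close>. From 0.271 * 0.52 < 0.141 it is at most 0.0146, and
    it is of second order in \<open>q\<close>, hence a small multiple of
    \<open>\<bar>q\<bar>\<close>.\<close>
  define s where "s k = (143/200) * (q k)\<^sup>2" for k
  have s: "0 \<le> s k" "d0 - p k \<le> 2 * s k" "s k \<le> 146/10000" "s k \<le> 101/1000 * \<bar>q k\<bar>" if "k < 4" for k
  proof -
    show "0 \<le> s k" by (simp add: s_def)
    show "d0 - p k \<le> 2 * s k" using lo[OF that] by (simp add: s_def)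
    have "(q k)\<^sup>2 \<le> (1410/10000)\<^sup>2" using power_mono[OF Q[OF that], of 2] by simp
    then show "s k \<le> 146/10000" by (simp add: s_def power2_eq_square)
    have "(q k)\<^sup>2 = \<bar>q k\<bar> * \<bar>q k\<bar>" by (simp add: power2_eq_square)
    also have "\<dots> \<le> 1410/10000 * \<bar>q k\<bar>" using Q[OF that] by (intro mult_right_mono) auto
    finally show "s k \<le> 101/1000 * \<bar>q k\<bar>" by (simp add: s_def)
  qed
  have g: "p k - d0 \<ge> 6/5 * (p j - d0) + 6/5 * \<bar>q k\<bar> - \<bar>q j\<bar> - 36/25 * s j"
    if "(k, j) \<in> {(0, 1), (1, 2), (2, 3), (3, 0)}" for k j
  proof -
    have "j < 4" using that by auto
    from rhombus.growth[OF R[OF that] s(1-3)[OF this]]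
    show ?thesis by (simp only: distrib_left)
  qed
  define e where "e k = p k - d0" for k
  define u where "u k = \<bar>q k\<bar>" for k
  have u: "0 \<le> u k" "s k \<le> 101/1000 * u k" "- e k \<le> 2 * s k" if "k < 4" for k
    using s[OF that] by (simp_all add: u_def e_def)
  have g': "e 0 \<ge> 6/5 * e 1 + 6/5 * u 0 - u 1 - 36/25 * s 1"
    "e 1 \<ge> 6/5 * e 2 + 6/5 * u 1 - u 2 - 36/25 * s 2"
    "e 2 \<ge> 6/5 * e 3 + 6/5 * u 2 - u 3 - 36/25 * s 3"
    "e 3 \<ge> 6/5 * e 0 + 6/5 * u 3 - u 0 - 36/25 * s 0"
    using g[of 0 1] g[of 1 2] g[of 2 3] g[of 3 0] by (simp_all add: e_def u_def)
  have lt: "(0::nat) < 4" "(1::nat) < 4" "(2::nat) < 4" "(3::nat) < 4" by simp_all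
  \<comment> \<open>The sum of \<open>g'\<close> bounds 1/5 of the sum of the \<open>e\<close> plus
    1/5 of that of the \<open>u\<close> by 36/25 of that of the \<open>s\<close>. With
    \<open>e \<ge> -2 s\<close> and \<open>s \<le> 0.101 u\<close> the claim follows from (2/5 +
    36/25) * 0.101 < 1/5.\<close>
  have "u 0 + u 1 + u 2 + u 3 \<le> 0"
    using g' u(2,3)[OF lt(1)] u(2,3)[OF lt(2)] u(2,3)[OF lt(3)] u(2,3)[OF lt(4)] by linarith
  then have "u 0 = 0 \<and> u 1 = 0 \<and> u 2 = 0 \<and> u 3 = 0"
    using u(1)[OF lt(1)] u(1)[OF lt(2)] u(1)[OF lt(3)] u(1)[OF lt(4)] by linarith
  moreover have four: "k = 0 \<or> k = 1 \<or> k = 2 \<or> k = 3" if "k < 4" for k :: nat using that by auto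
  ultimately have u0: "u k = 0" if "k < 4" for k using four[OF that] by (elim disjE) simp_all
  then have q0: "q k = 0" if "k < 4" for k using that by (simp add: u_def)
  have s0: "s k = 0" if "k < 4" for k using q0[OF that] by (simp add: s_def)
  have e0: "0 \<le> e k" if "k < 4" for k using u(3)[OF that] s0[OF that] by simp
  have "e 0 + e 1 + e 2 + e 3 \<le> 0"
    using g' u0[OF lt(1)] u0[OF lt(2)] u0[OF lt(3)] u0[OF lt(4)] s0[OF lt(1)] s0[OF lt(2)] s0[OF lt(3)] s0[OF lt(4)]
    by linarith
  then have "e 0 = 0 \<and> e 1 = 0 \<and> e 2 = 0 \<and> e 3 = 0"
    using e0[OF lt(1)] e0[OF lt(2)] e0[OF lt(3)] e0[OF lt(4)] by linarith
  then have pd: "p k = d0" if "k < 4" for k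
    using four[OF that] by (elim disjE) (simp_all add: e_def)
  obtain j :: nat where j: "j < 4" "(k, j) \<in> {(0, 1), (1, 2), (2, 3), (3, 0)}" using next_ex[OF k] by blast
  show ?thesis
    using rhombus.rigid[OF R[OF j(2)], of 0] pd[OF k] q0[OF k] pd[OF j(1)] q0[OF j(1)] by simp
qed

subsection \<open>Symmetries and the remaining configuration\<close>

definition quarter :: "real \<times> real \<Rightarrow> real \<times> real" where
  "quarter p = (- snd p, fst p)"

definition mirror :: "real \<times> real \<Rightarrow> real \<times> real" where
  "mirror p = (- fst p, snd p)"

text \<open>A quarter turn takes the label \<open>(b, -a)\<close> to \<open>(a, b)\<close>, so the
  labels turn with the plane and the vacancy stays at the origin.\<close>

definition rot :: "(int \<Rightarrow> int \<Rightarrow> real \<times> real) \<Rightarrow> int \<Rightarrow> int \<Rightarrow> real \<times> real" where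
  "rot f a b = quarter (f b (- a))"

definition reflect :: "(int \<Rightarrow> int \<Rightarrow> real \<times> real) \<Rightarrow> int \<Rightarrow> int \<Rightarrow> real \<times> real" where
  "reflect f a b = mirror (f (- a) b)"

lemma valid_rot: "valid b (- a) \<longleftrightarrow> valid a b" and valid_refl: "valid (- a) b \<longleftrightarrow> valid a b"
  by (auto simp: valid_def)

lemma grid_per:
  assumes "grid f"
  shows "f (a + 3) b = f a b + (1, 0)" "f a (b + 3) = f a b + (0, 1)"
  using assms by (simp_all add: grid_def)

lemma grid_order:
  assumes "grid f" "valid a b" "valid a' b'" "(a, b) \<noteq> (a', b')" "f a' b' - f a b = (u, v)"
  shows "d0 \<le> norm (u, v)" "\<bar>u\<bar> \<le> v \<Longrightarrow> b < b'" "\<bar>v\<bar> \<le> u \<Longrightarrow> a < a'"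
    "\<bar>u\<bar> \<le> - v \<Longrightarrow> b' < b" "\<bar>v\<bar> \<le> - u \<Longrightarrow> a' < a"
proof -
  have G: "d0 \<le> norm (f y z - f w x)" "\<bar>fst (f y z - f w x)\<bar> \<le> snd (f y z - f w x) \<longrightarrow> x < z"
    "\<bar>snd (f y z - f w x)\<bar> \<le> fst (f y z - f w x) \<longrightarrow> w < y"
    if "valid w x" "valid y z" "(w, x) \<noteq> (y, z)" for w x y z
    using assms(1) that unfolding grid_def by blast+
  have r: "f a b - f a' b' = (- u, - v)" using arg_cong[OF assms(5), of uminus] by simp
  have ne: "(a', b') \<noteq> (a, b)" using assms(4) by metis
  note G1 = G[OF assms(2,3,4), unfolded assms(5)] and G2 = G[OF assms(3,2) ne, unfolded r]
  show "d0 \<le> norm (u, v)" "\<bar>u\<bar> \<le> v \<Longrightarrow> b < b'" "\<bar>v\<bar> \<le> u \<Longrightarrow> a < a'"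
    using G1 by simp_all
  show "\<bar>u\<bar> \<le> - v \<Longrightarrow> b' < b" "\<bar>v\<bar> \<le> - u \<Longrightarrow> a' < a"
    using G2 by simp_all
qed

lemma gridI:
  assumes "\<And>a b. f (a + 3) b = f a b + (1, 0)" "\<And>a b. f a (b + 3) = f a b + (0, 1)"
    and "\<And>a b a' b' u v. valid a b \<Longrightarrow> valid a' b' \<Longrightarrow> (a, b) \<noteq> (a', b') \<Longrightarrow> f a' b' - f a b = (u, v) \<Longrightarrow>
      d0 \<le> norm (u, v) \<and> (\<bar>u\<bar> \<le> v \<longrightarrow> b < b') \<and> (\<bar>v\<bar> \<le> u \<longrightarrow> a < a')"
  shows "grid f"
  unfolding grid_def using assms(1,2)
proof (intro conjI allI impI)
  fix a b a' b' assume v: "valid a b" "valid a' b'" "(a, b) \<noteq> (a', b')"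
  note h = assms(3)[OF v, of "fst (f a' b' - f a b)" "snd (f a' b' - f a b)", simplified prod.collapse, OF refl]
  show "d0 \<le> norm (f a' b' - f a b)" using h by blast
  show "b < b'" if "\<bar>fst (f a' b' - f a b)\<bar> \<le> snd (f a' b' - f a b)" using h that by blast
  show "a < a'" if "\<bar>snd (f a' b' - f a b)\<bar> \<le> fst (f a' b' - f a b)" using h that by blast
qed simp_all

lemma grid_rot: "grid f \<Longrightarrow> grid (rot f)"
proof (rule gridI)
  assume g: "grid f"
  show "rot f (a + 3) b = rot f a b + (1, 0)" for a b
    using grid_per(2)[OF g, of b "- a - 3"] by (simp add: rot_def quarter_def prod_eq_iff)
  show "rot f a (b + 3) = rot f a b + (0, 1)" for a b
    using grid_per(1)[OF g, of b "- a"] by (simp add: rot_def quarter_def prod_eq_iff)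
  fix a b a' b' u v
  assume v: "valid a b" "valid a' b'" "(a, b) \<noteq> (a', b')" and d: "rot f a' b' - rot f a b = (u, v)"
  have e: "f b' (- a') - f b (- a) = (v, - u)"
    using d by (simp add: rot_def quarter_def prod_eq_iff)
  have v': "valid b (- a)" "valid b' (- a')" "(b, - a) \<noteq> (b', - a')" using v by (auto simp: valid_rot)
  show "d0 \<le> norm (u, v) \<and> (\<bar>u\<bar> \<le> v \<longrightarrow> b < b') \<and> (\<bar>v\<bar> \<le> u \<longrightarrow> a < a')"
    using grid_order[OF g v' e] by (auto simp: norm_prod_def add.commute)
qed

lemma grid_refl: "grid f \<Longrightarrow> grid (reflect f)"
proof (rule gridI)
  assume g: "grid f"
  show "reflect f (a + 3) b = reflect f a b + (1, 0)" for a b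
    using grid_per(1)[OF g, of "- a - 3" b] by (simp add: reflect_def mirror_def prod_eq_iff)
  show "reflect f a (b + 3) = reflect f a b + (0, 1)" for a b
    using grid_per(2)[OF g, of "- a" b] by (simp add: reflect_def mirror_def prod_eq_iff)
  fix a b a' b' u v
  assume v: "valid a b" "valid a' b'" "(a, b) \<noteq> (a', b')" and d: "reflect f a' b' - reflect f a b = (u, v)"
  have e: "f (- a') b' - f (- a) b = (- u, v)"
    using d by (simp add: reflect_def mirror_def prod_eq_iff)
  have v': "valid (- a) b" "valid (- a') b'" "(- a, b) \<noteq> (- a', b')" using v by (auto simp: valid_refl)
  show "d0 \<le> norm (u, v) \<and> (\<bar>u\<bar> \<le> v \<longrightarrow> b < b') \<and> (\<bar>v\<bar> \<le> u \<longrightarrow> a < a')"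
    using grid_order[OF g v' e] by (auto simp: norm_prod_def)
qed

inductive sym_image :: "(int \<Rightarrow> int \<Rightarrow> real \<times> real) \<Rightarrow> (int \<Rightarrow> int \<Rightarrow> real \<times> real) \<Rightarrow> bool" for f where
  sym_id: "sym_image f f"
| sym_rot: "sym_image f g \<Longrightarrow> sym_image f (rot g)"
| sym_refl: "sym_image f g \<Longrightarrow> sym_image f (reflect g)"

text \<open>\<open>True\<close> means flat, \<open>False\<close> steep. On the diagonal both hold,
  so the flags form a relation.\<close>

definition corner :: "real \<times> real \<Rightarrow> bool \<Rightarrow> bool" where
  "corner w b \<longleftrightarrow> (if b then \<bar>snd w\<bar> \<le> fst w else \<bar>fst w\<bar> \<le> snd w)"

text \<open>The four neighbours of the vacancy, in cyclic order, are joined by diagonal steps; each of them is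
  steep or flat. The four flags record this relative to the direction of rotation.\<close>

definition turns :: "(int \<Rightarrow> int \<Rightarrow> real \<times> real) \<Rightarrow> bool \<Rightarrow> bool \<Rightarrow> bool \<Rightarrow> bool \<Rightarrow> bool" where
  "turns f i j k l \<longleftrightarrow> corner (f 1 0 - f 0 (-1)) i \<and>
     corner (quarter (f 1 0 - f 0 1)) j \<and>
     corner (f 0 1 - f (-1) 0) k \<and>
     corner (quarter (f 0 (-1) - f (-1) 0)) l"

lemma corner_swap: "corner (a, b) l \<Longrightarrow> corner (b, a) (\<not> l)"
  by (cases l) (simp_all add: corner_def)

lemma turns_rot:
  assumes "turns f i j k l"
  shows "turns (rot f) l i j k"
proof -
  have "rot f 1 0 - rot f 0 (-1) = quarter (f 0 (-1) - f (-1) 0)"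
    "quarter (rot f 1 0 - rot f 0 1) = f 1 0 - f 0 (-1)"
    "rot f 0 1 - rot f (-1) 0 = quarter (f 1 0 - f 0 1)"
    "quarter (rot f 0 (-1) - rot f (-1) 0) = f 0 1 - f (-1) 0"
    by (simp_all add: rot_def quarter_def prod_eq_iff)
  then show ?thesis using assms by (simp add: turns_def)
qed

text \<open>A reflection reverses the cyclic order and exchanges the coordinates of each rotated
  side, hence the negations.\<close>

lemma turns_refl:
  assumes "turns f i j k l"
  shows "turns (reflect f) (\<not> l) (\<not> k) (\<not> j) (\<not> i)"
proof -
  have "reflect f 1 0 - reflect f 0 (-1) = prod.swap (quarter (f 0 (-1) - f (-1) 0))"
    "quarter (reflect f 1 0 - reflect f 0 1) = prod.swap (f 0 1 - f (-1) 0)"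
    "reflect f 0 1 - reflect f (-1) 0 = prod.swap (quarter (f 1 0 - f 0 1))"
    "quarter (reflect f 0 (-1) - reflect f (-1) 0) = prod.swap (f 1 0 - f 0 (-1))"
    by (simp_all add: reflect_def quarter_def mirror_def prod_eq_iff)
  moreover have "corner (prod.swap w) (\<not> l)" if "corner w l" for w l
    using corner_swap[of "fst w" "snd w" l] that by (simp add: prod.swap_def)
  ultimately show ?thesis using assms by (simp add: turns_def)
qed

text \<open>Under cyclic shifts and reversal with complementation the sixteen patterns form four
  orbits; listed are representatives.\<close>

lemma turns_cases:
  assumes "turns f i j k l"
  obtains g where "sym_image f g"
    "turns g True False True False \<or> turns g True True False False \<or> turns g True True True False \<or> turns g True True True True"
proof -
  note s = sym_id[of f] sym_refl[OF sym_id[of f]]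
  note s1 = s[THEN sym_rot] note s2 = s1[THEN sym_rot] note s3 = s2[THEN sym_rot]
  note t = assms turns_refl[OF assms]
  note t1 = t[THEN turns_rot] note t2 = t1[THEN turns_rot] note t3 = t2[THEN turns_rot]
  define Q where "Q g \<longleftrightarrow> turns g True False True False \<or> turns g True True False False \<or>
    turns g True True True False \<or> turns g True True True True" for g
  have "Q f \<or> Q (rot f) \<or> Q (rot (rot f)) \<or> Q (rot (rot (rot f))) \<or>
    Q (reflect f) \<or> Q (rot (reflect f)) \<or> Q (rot (rot (reflect f))) \<or> Q (rot (rot (rot (reflect f))))"
    using t t1 t2 t3 unfolding Q_def by (cases i; cases j; cases k; cases l) simp_all
  then show thesis
    using that s s1 s2 s3 unfolding Q_def[symmetric] by blast
qed

section \<open>The numbered points and their initial cones\<close>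

definition label :: "int \<Rightarrow> int \<times> int" where
  "label v = (if v = 0 then (-1, -1) else if v = 1 then (0, -1) else if v = 2 then (1, -1)
     else if v = 3 then (-1, 0) else if v = 4 then (1, 0) else if v = 5 then (-1, 1)
     else if v = 6 then (0, 1) else (1, 1))"

definition cfg :: "(int \<Rightarrow> int \<Rightarrow> real \<times> real) \<Rightarrow> int \<Rightarrow> real \<times> real" where
  "cfg f v = f (fst (label v)) (snd (label v))"

lemma grid_shift:
  assumes "grid f"
  shows "f (a + 3 * i) (b + 3 * j) = f a b + rv (i, j)"
proof -
  have 1: "f (a + 3 * i) b = f a b + rv (i, 0)" for a b i
  proof (induction i rule: int_induct[where k = 0])
    case (step1 i)
    then show ?case using grid_per(1)[OF assms, of "a + 3 * i" b] by (simp add: rv_Pair algebra_simps)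
  next
    case (step2 i)
    then show ?case using grid_per(1)[OF assms, of "a + 3 * (i - 1)" b] by (simp add: rv_Pair algebra_simps prod_eq_iff)
  qed (simp add: rv_Pair prod_eq_iff)
  have 2: "f a (b + 3 * i) = f a b + rv (0, i)" for a b i
  proof (induction i rule: int_induct[where k = 0])
    case (step1 i)
    then show ?case using grid_per(2)[OF assms, of a "b + 3 * i"] by (simp add: rv_Pair algebra_simps)
  next
    case (step2 i)
    then show ?case using grid_per(2)[OF assms, of a "b + 3 * (i - 1)"] by (simp add: rv_Pair algebra_simps prod_eq_iff)
  qed (simp add: rv_Pair prod_eq_iff)
  show ?thesis by (simp add: 1 2 rv_Pair prod_eq_iff)
qed

fun edge_ok :: "edge \<Rightarrow> cone \<Rightarrow> bool" where
  "edge_ok (i, j, z) c \<longleftrightarrow> (let (a, b) = label i; (a', b') = label j; x = a' + 3 * fst z; y = b' + 3 * snd z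
     in valid a b \<and> valid x y \<and>
       (x - a, y - b, c) \<in> {(1, 0, cE), (0, 1, cN), (1, 1, cNE), (-1, 1, cNW)})"

lemma edges_ok: "list_all2 edge_ok edges (start cNE cNW cNE cNW)"
  by code_simp

text \<open>An equal label excludes two opposite quarter planes, a larger one excludes the quarter
  pointing backwards. Neighbours in a row or column keep one quarter, diagonal neighbours
  two.\<close>

lemma edge_ok_cone:
  assumes g: "grid f" and e: "edge_ok e c"
  shows "in_cone c (edge_vec (cfg f) e) \<and> d0 \<le> norm (edge_vec (cfg f) e)"
proof -
  obtain i j z where ez: "e = (i, j, z)" by (cases e)
  obtain a b where li: "label i = (a, b)" by (cases "label i")
  obtain a' b' where lj: "label j = (a', b')" by (cases "label j")
  define x y where "x = a' + 3 * fst z" and "y = b' + 3 * snd z"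
  have v: "valid a b" "valid x y"
    and s: "(x - a, y - b, c) \<in> {(1, 0, cE), (0, 1, cN), (1, 1, cNE), (-1, 1, cNW)}"
    using e by (simp_all add: ez li lj x_def y_def Let_def)
  have ne: "(a, b) \<noteq> (x, y)" using s by auto
  obtain p q where pq: "f x y - f a b = (p, q)" by (cases "f x y - f a b")
  have ev: "edge_vec (cfg f) e = (p, q)"
    using pq grid_shift[OF g, of a' "fst z" b' "snd z"]
    by (simp add: ez edge_vec_def cfg_def li lj x_def y_def)
  note o = grid_order[OF g v ne pq]
  have xy: "x = a + (x - a)" "y = b + (y - b)" by simp_all
  have "in_cone c (p, q)"
    using s
  proof (elim insertE emptyE)
    assume "(x - a, y - b, c) = (1, 0, cE)"
    then have "\<not> \<bar>p\<bar> \<le> q" "\<not> \<bar>p\<bar> \<le> - q" "\<not> \<bar>q\<bar> \<le> - p" "c = cE" using o(2,4,5) by auto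
    then show ?thesis by (simp add: in_cone_iff, linarith?)
  next
    assume "(x - a, y - b, c) = (0, 1, cN)"
    then have "\<not> \<bar>q\<bar> \<le> p" "\<not> \<bar>p\<bar> \<le> - q" "\<not> \<bar>q\<bar> \<le> - p" "c = cN" using o(3,4,5) by auto
    then show ?thesis by (simp add: in_cone_iff, linarith?)
  next
    assume "(x - a, y - b, c) = (1, 1, cNE)"
    then have "\<not> \<bar>p\<bar> \<le> - q" "\<not> \<bar>q\<bar> \<le> - p" "c = cNE" using o(4,5) by auto
    then show ?thesis by (simp add: in_cone_iff, linarith?)
  next
    assume "(x - a, y - b, c) = (-1, 1, cNW)"
    then have "\<not> \<bar>q\<bar> \<le> p" "\<not> \<bar>p\<bar> \<le> - q" "c = cNW" using o(3,4) by auto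
    then show ?thesis by (simp add: in_cone_iff, linarith?)
  qed
  then show ?thesis using o(1) ev by simp
qed

lemma cfg_sep: "grid f \<Longrightarrow> e \<in> set edges \<Longrightarrow> d0 \<le> norm (edge_vec (cfg f) e)"
proof -
  assume g: "grid f" and "e \<in> set edges"
  then obtain k where "k < length edges" "e = edges ! k" by (auto simp: in_set_conv_nth)
  then show ?thesis using list_all2_nthD[OF edges_ok] edge_ok_cone[OF g] by blast
qed

lemma holds_update:
  "holds p es cs \<Longrightarrow> in_cone c (edge_vec p (es ! k)) \<Longrightarrow> k < length es \<Longrightarrow> holds p es (cs[k := c])"
  unfolding holds_def by (auto simp: list_all2_conv_all_nth nth_list_update)

lemma start_update: "start se ne nw sw = (start cNE cNW cNE cNW)[3 := sw, 5 := se, 11 := nw, 12 := ne]"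
  by (simp add: start_def)

lemma holds_start:
  assumes g: "grid f" and t: "turns f i j k l"
  shows "holds (cfg f) edges (start (if i then cE else cN) (if j then cN else cW) (if k then cE else cN) (if l then cN else cW))"
proof -
  have 0: "holds (cfg f) edges (start cNE cNW cNE cNW)"
    unfolding holds_def using edges_ok edge_ok_cone[OF g] by (auto elim: list_all2_mono)
  have ed: "edges ! 3 = (1, 3, 0, 0)" "edges ! 5 = (1, 4, 0, 0)" "edges ! 11 = (3, 6, 0, 0)" "edges ! 12 = (4, 6, 0, 0)"
    "length edges = 28"
    by (simp_all add: edges_def)
  have ev: "edge_vec (cfg f) (a, b, 0, 0) = cfg f b - cfg f a" for a b
    by (simp add: edge_vec_def rv_Pair prod_eq_iff)
  have c: "in_cone c w \<longleftrightarrow> 0 \<le> of_int (fst (fst c)) * snd w - of_int (snd (fst c)) * fst w \<and>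
    0 \<le> fst w * of_int (snd (snd c)) - snd w * of_int (fst (snd c))" for c w
    by (simp add: in_cone_def crossr_def rv_def)
  have "in_cone (if i then cE else cN) (f 1 0 - f 0 (-1))" "in_cone (if k then cE else cN) (f 0 1 - f (-1) 0)"
    using t by (auto simp: turns_def corner_def c abs_le_iff)
  moreover have "in_cone (if j then cN else cW) (f 0 1 - f 1 0)" "in_cone (if l then cN else cW) (f (-1) 0 - f 0 (-1))"
    using t by (auto simp: turns_def corner_def quarter_def c abs_le_iff)
  ultimately show ?thesis
    by (subst start_update, intro holds_update 0) (simp_all add: ed ev cfg_def label_def)
qed

lemma short_start: "short_cones (start cE cN cE cN)" "short_cones (start cE cN cE cW)"
  "short_cones (start cE cN cN cW)" "short_cones (start cE cW cE cW)" "wf_edges edges"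
  by code_simp+

text \<open>A diagonal side lies in a half-plane made of two quarters, so flags exist for all four
  sides. After a symmetry four patterns remain; three are refuted by trees without an
  \<open>Opt\<close>.\<close>

lemma contact:
  assumes "grid f"
  obtains g where "sym_image f g" "grid g" "holds (cfg g) edges contact_cones"
proof -
  have c1: "\<exists>b. corner w b" if "0 \<le> fst w + snd w" for w
  proof (cases "\<bar>snd w\<bar> \<le> fst w")
    case True
    then have "corner w True" by (simp add: corner_def)
    then show ?thesis by blast
  next
    case False
    then have "\<bar>fst w\<bar> \<le> snd w" using that by linarith
    then have "corner w False" by (simp add: corner_def)
    then show ?thesis by blast
  qed
  have v: "valid 0 1" "valid 1 0" "valid (- 1) 0" "valid 0 (- 1)" by (simp_all add: valid_def)
  have up: "0 \<le> fst (f y z - f w x) + snd (f y z - f w x)"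
    if "valid w x" "valid y z" "w < y" "x < z" for w x y z
  proof -
    define p q where "p = fst (f y z - f w x)" and "q = snd (f y z - f w x)"
    have "(w, x) \<noteq> (y, z)" "f y z - f w x = (p, q)" using that by (auto simp: p_def q_def prod_eq_iff)
    from grid_order(4,5)[OF assms that(1,2) this] have "\<not> \<bar>p\<bar> \<le> - q" "\<not> \<bar>q\<bar> \<le> - p" using that by auto
    then show ?thesis unfolding p_def[symmetric] q_def[symmetric] by linarith
  qed
  have down: "0 \<le> fst (f w x - f y z) + snd (f y z - f w x)"
    if "valid w x" "valid y z" "y < w" "x < z" for w x y z
  proof -
    define p q where "p = fst (f y z - f w x)" and "q = snd (f y z - f w x)"
    have "(w, x) \<noteq> (y, z)" "f y z - f w x = (p, q)" using that by (auto simp: p_def q_def prod_eq_iff)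
    from grid_order(3,4)[OF assms that(1,2) this] have "\<not> \<bar>p\<bar> \<le> - q" "\<not> \<bar>q\<bar> \<le> p" using that by auto
    then have "0 \<le> q - p" by linarith
    then show ?thesis by (simp add: p_def q_def)
  qed
  have "\<exists>i. corner (f 1 0 - f 0 (-1)) i" "\<exists>k. corner (f 0 1 - f (-1) 0) k"
    using up[of 0 "-1" 1 0] up[of "-1" 0 0 1] v by (simp_all add: c1)
  moreover have "\<exists>j. corner (quarter (f 1 0 - f 0 1)) j" "\<exists>l. corner (quarter (f 0 (-1) - f (-1) 0)) l"
    using down[of 1 0 0 1] down[of 0 "-1" "-1" 0] v
    by (intro c1; simp add: quarter_def)+
  ultimately obtain i j k l where "turns f i j k l" unfolding turns_def by blast
  then obtain g where s: "sym_image f g" and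
    t: "turns g True False True False \<or> turns g True True False False \<or> turns g True True True False \<or> turns g True True True True"
    by (rule turns_cases)
  have g: "grid g" using s by induction (auto intro: assms grid_rot grid_refl)
  note cs = check_sound[OF _ _ _ short_start(5) cfg_sep[OF g]]
  have "holds (cfg g) edges contact_cones"
    using t
  proof (elim disjE)
    assume "turns g True False True False"
    from cs[OF check_1010 holds_start[OF g this, simplified] short_start(4)] show ?thesis by simp
  next
    assume "turns g True True False False"
    from cs[OF check_1100 holds_start[OF g this, simplified] short_start(3)] show ?thesis by simp
  next
    assume "turns g True True True False"
    from cs[OF check_1110 holds_start[OF g this, simplified] short_start(2)] show ?thesis by simp
  next
    assume "turns g True True True True"
    from cs[OF check_1111 holds_start[OF g this, simplified] short_start(1)] show ?thesis by simp
  qed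
  then show thesis using that s g by blast
qed

text \<open>The last assumptions make \<open>w\<close> and \<open>w'\<close> an orthonormal frame,
  along the short and the long diagonal of a rhombus in the applications. The boundary vectors of
  the sixteen cones for sides of rhombi all have height at least 218 in such a frame.\<close>

lemma side_of_cone:
  assumes "in_cone (A, B) (u, v)" "d0 \<le> norm (u, v)"
    and "0 < cross A B" "short A" "short B"
    and "0 \<le> dotp w A" "0 \<le> dotp w B" "218 \<le> dotp w' A" "218 \<le> dotp w' B"
    and "(fst w)\<^sup>2 + (fst w')\<^sup>2 = 1" "(snd w)\<^sup>2 + (snd w')\<^sup>2 = 1" "fst w * snd w + fst w' * snd w' = 0"
  shows "0 \<le> rv w \<bullet> (u, v) \<and> 218/908 \<le> rv w' \<bullet> (u, v) \<and> d0\<^sup>2 \<le> (rv w \<bullet> (u, v))\<^sup>2 + (rv w' \<bullet> (u, v))\<^sup>2"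
proof (intro conjI)
  have "of_int (min (dotp w A) (dotp w B)) \<le> 908 * (rv w \<bullet> (u, v))"
    using assms by (intro cone_bound) auto
  moreover have "0 \<le> real_of_int (min (dotp w A) (dotp w B))"
    using assms(6,7) by simp
  ultimately show "0 \<le> rv w \<bullet> (u, v)" by linarith
  have "of_int (min (dotp w' A) (dotp w' B)) \<le> 908 * (rv w' \<bullet> (u, v))"
    using assms by (intro cone_bound) auto
  moreover have "218 \<le> real_of_int (min (dotp w' A) (dotp w' B))"
    using assms(8,9) by simp
  ultimately show "218/908 \<le> rv w' \<bullet> (u, v)" by linarith
  obtain a b a' b' where w: "w = (a, b)" "w' = (a', b')" by (cases w; cases w')
  have r: "(real_of_int a)\<^sup>2 + (real_of_int a')\<^sup>2 = 1" "(real_of_int b)\<^sup>2 + (real_of_int b')\<^sup>2 = 1"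
    "real_of_int a * real_of_int b + real_of_int a' * real_of_int b' = 0"
    using assms(10-12) unfolding w fst_conv snd_conv
    by (metis of_int_1 of_int_add of_int_power, metis of_int_1 of_int_add of_int_power, metis of_int_0 of_int_add of_int_mult)
  have "(rv w \<bullet> (u, v))\<^sup>2 + (rv w' \<bullet> (u, v))\<^sup>2 =
    u\<^sup>2 * ((real_of_int a)\<^sup>2 + (real_of_int a')\<^sup>2) + v\<^sup>2 * ((real_of_int b)\<^sup>2 + (real_of_int b')\<^sup>2)
      + 2 * u * v * (real_of_int a * real_of_int b + real_of_int a' * real_of_int b')"
    by (simp add: w rv_Pair power2_eq_square algebra_simps)
  also have "\<dots> = (norm (u, v))\<^sup>2" unfolding r by (simp add: norm_Pair)
  finally show "d0\<^sup>2 \<le> (rv w \<bullet> (u, v))\<^sup>2 + (rv w' \<bullet> (u, v))\<^sup>2"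
    using assms(2) d0_pos by (simp add: power_mono)
qed

text \<open>0.271 lies slightly above 86/321, the tangent of the half-width of these cones.\<close>

lemma tilt_bound:
  assumes "in_cone c (u, v)"
  shows "c = ((321, -86), (321, 86)) \<Longrightarrow> \<bar>v\<bar> \<le> 271/1000 * u"
    "c = ((86, 321), (-86, 321)) \<Longrightarrow> \<bar>u\<bar> \<le> 271/1000 * v"
proof -
  assume "c = ((321, -86), (321, 86))"
  with assms have "0 \<le> 321 * v + 86 * u" "0 \<le> 86 * u - 321 * v" by (auto simp: in_cone_iff)
  then show "\<bar>v\<bar> \<le> 271/1000 * u" by linarith
next
  assume "c = ((86, 321), (-86, 321))"
  with assms have "0 \<le> 86 * v - 321 * u" "0 \<le> 321 * u + 86 * v" by (auto simp: in_cone_iff)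
  then show "\<bar>u\<bar> \<le> 271/1000 * v" by linarith
qed

text \<open>One lift of each point of the optimal configuration, numbered as in
  \<open>label\<close>.\<close>

definition ideal :: "int \<Rightarrow> real \<times> real" where
  "ideal v = (if v = 0 then (- d0 / 2, 0) else if v = 1 then (d0 / 2, 0) else if v = 2 then (1/2, - d0 / 2)
     else if v = 3 then (0, 1/2 - d0 / 2) else if v = 4 then (1/2, d0 / 2) else if v = 5 then (0, 1/2 + d0 / 2)
     else if v = 6 then (1/2 - d0 / 2, 1/2) else (1/2 + d0 / 2, 1/2))"

text \<open>The short diagonals of the four rhombi join 0 to 1, 3 to 5, 6 to 7 and 2 to 4. In the
  second and the fourth the two coordinates exchange their roles. Once all sides are known, the
  positions follow from that of point 0.\<close>

lemma cfg_ideal: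
  assumes g: "grid f" and h: "holds (cfg f) edges contact_cones"
  shows "\<exists>c. \<forall>v\<in>set verts. cfg f v = c + ideal v"
proof -
  define X Y where "X v = fst (cfg f v)" and "Y v = snd (cfg f v)" for v
  have ev: "edge_vec (cfg f) (i, j, x, y) = (X j + of_int x - X i, Y j + of_int y - Y i)" for i j x y
    by (simp add: edge_vec_def X_def Y_def rv_Pair prod_eq_iff)
  have len: "length edges = 28" by (simp add: edges_def)
  have c: "in_cone (fst (contact_cones ! k), snd (contact_cones ! k)) (fst (edge_vec (cfg f) (edges ! k)), snd (edge_vec (cfg f) (edges ! k)))"
    and n: "d0 \<le> norm (fst (edge_vec (cfg f) (edges ! k)), snd (edge_vec (cfg f) (edges ! k)))" if "k < 28" for k
    using h that cfg_sep[OF g, of "edges ! k"] by (auto simp: holds_def list_all2_conv_all_nth len)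
  have n2: "d0\<^sup>2 \<le> (fst (edge_vec (cfg f) (edges ! k)))\<^sup>2 + (snd (edge_vec (cfg f) (edges ! k)))\<^sup>2" if "k < 28" for k
    using n[OF that] d0_pos power_mono[of d0 "norm (edge_vec (cfg f) (edges ! k))" 2] by (simp add: norm_prod_def)
  note contact_nth = contact_cones_def and edges_nth = edges_def
  have s00: "0 \<le> - (X 3 - X 1) \<and> 218/908 \<le> (Y 3 - Y 1) \<and> d0\<^sup>2 \<le> (- (X 3 - X 1))\<^sup>2 + (Y 3 - Y 1)\<^sup>2"
    using side_of_cone[OF c[of 3] n[of 3], of "(-1, 0)" "(0, 1)"]
    by (simp add: ev contact_nth edges_nth short_def rv_Pair)
  have s01: "0 \<le> (X 3 - X 0) \<and> 218/908 \<le> (Y 3 - Y 0) \<and> d0\<^sup>2 \<le> (X 3 - X 0)\<^sup>2 + (Y 3 - Y 0)\<^sup>2"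
    using side_of_cone[OF c[of 1] n[of 1], of "(1, 0)" "(0, 1)"]
    by (simp add: ev contact_nth edges_nth short_def rv_Pair)
  have s02: "0 \<le> (X 1 - X 5) \<and> 218/908 \<le> (Y 1 + 1 - Y 5) \<and> d0\<^sup>2 \<le> (X 1 - X 5)\<^sup>2 + (Y 1 + 1 - Y 5)\<^sup>2"
    using side_of_cone[OF c[of 19] n[of 19], of "(1, 0)" "(0, 1)"]
    by (simp add: ev contact_nth edges_nth short_def rv_Pair)
  have s03: "0 \<le> - (X 0 - X 5) \<and> 218/908 \<le> (Y 0 + 1 - Y 5) \<and> d0\<^sup>2 \<le> (- (X 0 - X 5))\<^sup>2 + (Y 0 + 1 - Y 5)\<^sup>2"
    using side_of_cone[OF c[of 17] n[of 17], of "(-1, 0)" "(0, 1)"]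
    by (simp add: ev contact_nth edges_nth short_def rv_Pair)
  have s10: "0 \<le> - (Y 6 - Y 5) \<and> 218/908 \<le> (X 6 - X 5) \<and> d0\<^sup>2 \<le> (- (Y 6 - Y 5))\<^sup>2 + (X 6 - X 5)\<^sup>2"
    using side_of_cone[OF c[of 18] n[of 18], of "(0, -1)" "(1, 0)"]
    by (simp add: ev contact_nth edges_nth short_def rv_Pair)
  have s11: "0 \<le> (Y 6 - Y 3) \<and> 218/908 \<le> (X 6 - X 3) \<and> d0\<^sup>2 \<le> (Y 6 - Y 3)\<^sup>2 + (X 6 - X 3)\<^sup>2"
    using side_of_cone[OF c[of 11] n[of 11], of "(0, 1)" "(1, 0)"]
    by (simp add: ev contact_nth edges_nth short_def rv_Pair)
  have s12: "0 \<le> (Y 5 - Y 7) \<and> 218/908 \<le> (X 5 + 1 - X 7) \<and> d0\<^sup>2 \<le> (Y 5 - Y 7)\<^sup>2 + (X 5 + 1 - X 7)\<^sup>2"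
    using side_of_cone[OF c[of 26] n[of 26], of "(0, 1)" "(1, 0)"]
    by (simp add: ev contact_nth edges_nth short_def rv_Pair)
  have s13: "0 \<le> (Y 7 - Y 3) \<and> 218/908 \<le> - (X 7 - 1 - X 3) \<and> d0\<^sup>2 \<le> (Y 7 - Y 3)\<^sup>2 + (- (X 7 - 1 - X 3))\<^sup>2"
    using side_of_cone[OF c[of 9] n[of 9], of "(0, 1)" "(-1, 0)"]
    by (simp add: ev contact_nth edges_nth short_def rv_Pair)
  have s20: "0 \<le> - (X 2 - X 7) \<and> 218/908 \<le> (Y 2 + 1 - Y 7) \<and> d0\<^sup>2 \<le> (- (X 2 - X 7))\<^sup>2 + (Y 2 + 1 - Y 7)\<^sup>2"
    using side_of_cone[OF c[of 25] n[of 25], of "(-1, 0)" "(0, 1)"]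
    by (simp add: ev contact_nth edges_nth short_def rv_Pair)
  have s21: "0 \<le> (X 2 - X 6) \<and> 218/908 \<le> (Y 2 + 1 - Y 6) \<and> d0\<^sup>2 \<le> (X 2 - X 6)\<^sup>2 + (Y 2 + 1 - Y 6)\<^sup>2"
    using side_of_cone[OF c[of 23] n[of 23], of "(1, 0)" "(0, 1)"]
    by (simp add: ev contact_nth edges_nth short_def rv_Pair)
  have s22: "0 \<le> (X 7 - X 4) \<and> 218/908 \<le> (Y 7 - Y 4) \<and> d0\<^sup>2 \<le> (X 7 - X 4)\<^sup>2 + (Y 7 - Y 4)\<^sup>2"
    using side_of_cone[OF c[of 13] n[of 13], of "(1, 0)" "(0, 1)"]
    by (simp add: ev contact_nth edges_nth short_def rv_Pair)
  have s23: "0 \<le> - (X 6 - X 4) \<and> 218/908 \<le> (Y 6 - Y 4) \<and> d0\<^sup>2 \<le> (- (X 6 - X 4))\<^sup>2 + (Y 6 - Y 4)\<^sup>2"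
    using side_of_cone[OF c[of 12] n[of 12], of "(-1, 0)" "(0, 1)"]
    by (simp add: ev contact_nth edges_nth short_def rv_Pair)
  have s30: "0 \<le> (Y 4 - Y 0) \<and> 218/908 \<le> - (X 4 - 1 - X 0) \<and> d0\<^sup>2 \<le> (Y 4 - Y 0)\<^sup>2 + (- (X 4 - 1 - X 0))\<^sup>2"
    using side_of_cone[OF c[of 0] n[of 0], of "(0, 1)" "(-1, 0)"]
    by (simp add: ev contact_nth edges_nth short_def rv_Pair)
  have s31: "0 \<le> (Y 0 - Y 2) \<and> 218/908 \<le> (X 0 + 1 - X 2) \<and> d0\<^sup>2 \<le> (Y 0 - Y 2)\<^sup>2 + (X 0 + 1 - X 2)\<^sup>2"
    using side_of_cone[OF c[of 7] n[of 7], of "(0, 1)" "(1, 0)"]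
    by (simp add: ev contact_nth edges_nth short_def rv_Pair)
  have s32: "0 \<le> (Y 4 - Y 1) \<and> 218/908 \<le> (X 4 - X 1) \<and> d0\<^sup>2 \<le> (Y 4 - Y 1)\<^sup>2 + (X 4 - X 1)\<^sup>2"
    using side_of_cone[OF c[of 5] n[of 5], of "(0, 1)" "(1, 0)"]
    by (simp add: ev contact_nth edges_nth short_def rv_Pair)
  have s33: "0 \<le> - (Y 2 - Y 1) \<and> 218/908 \<le> (X 2 - X 1) \<and> d0\<^sup>2 \<le> (- (Y 2 - Y 1))\<^sup>2 + (X 2 - X 1)\<^sup>2"
    using side_of_cone[OF c[of 4] n[of 4], of "(0, -1)" "(1, 0)"]
    by (simp add: ev contact_nth edges_nth short_def rv_Pair)
  have t0: "d0\<^sup>2 \<le> (X 1 - X 0)\<^sup>2 + (Y 1 - Y 0)\<^sup>2 \<and> \<bar>(Y 1 - Y 0)\<bar> \<le> 271/1000 * (X 1 - X 0)"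
    using tilt_bound[OF c[of 2]] n2[of 2] by (simp add: ev contact_nth edges_nth add.commute)
  have t1: "d0\<^sup>2 \<le> (Y 5 - Y 3)\<^sup>2 + (X 5 - X 3)\<^sup>2 \<and> \<bar>(X 5 - X 3)\<bar> \<le> 271/1000 * (Y 5 - Y 3)"
    using tilt_bound[OF c[of 10]] n2[of 10] by (simp add: ev contact_nth edges_nth add.commute)
  have t2: "d0\<^sup>2 \<le> (X 7 - X 6)\<^sup>2 + (Y 7 - Y 6)\<^sup>2 \<and> \<bar>(Y 7 - Y 6)\<bar> \<le> 271/1000 * (X 7 - X 6)"
    using tilt_bound[OF c[of 22]] n2[of 22] by (simp add: ev contact_nth edges_nth add.commute)
  have t3: "d0\<^sup>2 \<le> (Y 4 - Y 2)\<^sup>2 + (X 4 - X 2)\<^sup>2 \<and> \<bar>(X 4 - X 2)\<bar> \<le> 271/1000 * (Y 4 - Y 2)"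
    using tilt_bound[OF c[of 6]] n2[of 6] by (simp add: ev contact_nth edges_nth add.commute)
  have R0: "rhombus (- (X 3 - X 1)) (Y 3 - Y 1) (X 3 - X 0) (Y 3 - Y 0) (X 1 - X 5) (Y 1 + 1 - Y 5)
      (- (X 0 - X 5)) (Y 0 + 1 - Y 5) (X 1 - X 0) (Y 1 - Y 0) (Y 5 - Y 3) (X 5 - X 3)"
    using s00 s01 s02 s03 by (intro rhombus.intro; elim conjE; (assumption | linarith))
  have R1: "rhombus (- (Y 6 - Y 5)) (X 6 - X 5) (Y 6 - Y 3) (X 6 - X 3) (Y 5 - Y 7) (X 5 + 1 - X 7)
      (Y 7 - Y 3) (- (X 7 - 1 - X 3)) (Y 5 - Y 3) (X 5 - X 3) (X 7 - X 6) (Y 7 - Y 6)"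
    using s10 s11 s12 s13 by (intro rhombus.intro; elim conjE; (assumption | linarith))
  have R2: "rhombus (- (X 2 - X 7)) (Y 2 + 1 - Y 7) (X 2 - X 6) (Y 2 + 1 - Y 6) (X 7 - X 4) (Y 7 - Y 4)
      (- (X 6 - X 4)) (Y 6 - Y 4) (X 7 - X 6) (Y 7 - Y 6) (Y 4 - Y 2) (X 4 - X 2)"
    using s20 s21 s22 s23 by (intro rhombus.intro; elim conjE; (assumption | linarith))
  have R3: "rhombus (Y 4 - Y 0) (- (X 4 - 1 - X 0)) (Y 0 - Y 2) (X 0 + 1 - X 2) (Y 4 - Y 1) (X 4 - X 1)
      (- (Y 2 - Y 1)) (X 2 - X 1) (Y 4 - Y 2) (X 4 - X 2) (X 1 - X 0) (Y 1 - Y 0)"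
    using s30 s31 s32 s33 by (intro rhombus.intro; elim conjE; (assumption | linarith))
  define a1 where "a1 k = (if k = 0 then - (X 3 - X 1) else if k = 1 then - (Y 6 - Y 5)
    else if k = 2 then - (X 2 - X 7) else (Y 4 - Y 0))" for k :: nat
  define b1 where "b1 k = (if k = 0 then (Y 3 - Y 1) else if k = 1 then (X 6 - X 5)
    else if k = 2 then (Y 2 + 1 - Y 7) else - (X 4 - 1 - X 0))" for k :: nat
  define a2 where "a2 k = (if k = 0 then (X 3 - X 0) else if k = 1 then (Y 6 - Y 3)
    else if k = 2 then (X 2 - X 6) else (Y 0 - Y 2))" for k :: nat
  define b2 where "b2 k = (if k = 0 then (Y 3 - Y 0) else if k = 1 then (X 6 - X 3)
    else if k = 2 then (Y 2 + 1 - Y 6) else (X 0 + 1 - X 2))" for k :: nat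
  define a3 where "a3 k = (if k = 0 then (X 1 - X 5) else if k = 1 then (Y 5 - Y 7)
    else if k = 2 then (X 7 - X 4) else (Y 4 - Y 1))" for k :: nat
  define b3 where "b3 k = (if k = 0 then (Y 1 + 1 - Y 5) else if k = 1 then (X 5 + 1 - X 7)
    else if k = 2 then (Y 7 - Y 4) else (X 4 - X 1))" for k :: nat
  define a4 where "a4 k = (if k = 0 then - (X 0 - X 5) else if k = 1 then (Y 7 - Y 3)
    else if k = 2 then - (X 6 - X 4) else - (Y 2 - Y 1))" for k :: nat
  define b4 where "b4 k = (if k = 0 then (Y 0 + 1 - Y 5) else if k = 1 then - (X 7 - 1 - X 3)
    else if k = 2 then (Y 6 - Y 4) else (X 2 - X 1))" for k :: nat
  define p where "p k = (if k = 0 then (X 1 - X 0) else if k = 1 then (Y 5 - Y 3)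
    else if k = 2 then (X 7 - X 6) else (Y 4 - Y 2))" for k :: nat
  define q where "q k = (if k = 0 then (Y 1 - Y 0) else if k = 1 then (X 5 - X 3)
    else if k = 2 then (Y 7 - Y 6) else (X 4 - X 2))" for k :: nat
  have R: "rhombus (a1 k) (b1 k) (a2 k) (b2 k) (a3 k) (b3 k) (a4 k) (b4 k) (p k) (q k) (p j) (q j)"
    if "(k, j) \<in> {(0, 1), (1, 2), (2, 3), (3, 0)}" for k j :: nat
  proof -
    have "k = 0 \<and> j = 1 \<or> k = 1 \<and> j = 2 \<or> k = 2 \<and> j = 3 \<or> k = 3 \<and> j = 0" using that by auto
    then show ?thesis
      using R0 R1 R2 R3 unfolding a1_def a2_def a3_def a4_def b1_def b2_def b3_def b4_def p_def q_def
      by (elim disjE conjE) simp_all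
  qed
  have D: "d0\<^sup>2 \<le> (p k)\<^sup>2 + (q k)\<^sup>2 \<and> \<bar>q k\<bar> \<le> 271/1000 * p k" if "k < 4" for k :: nat
  proof -
    have "k = 0 \<or> k = 1 \<or> k = 2 \<or> k = 3" using that by auto
    then show ?thesis using t0 t1 t2 t3 by (elim disjE) (simp_all add: p_def q_def)
  qed
  note Z = rhombus_cycle[of a1 b1 a2 b2 a3 b3 a4 b4 p q, OF R D]
  have Z0: "X 1 - X 0 = d0" "Y 1 - Y 0 = 0" "X 3 - X 0 = d0 / 2" "Y 3 - Y 0 = 1/2 - d0 / 2"
    using Z[of 0] by (simp_all add: a1_def a2_def b2_def p_def q_def)
  have Z1: "Y 5 - Y 3 = d0" "X 5 - X 3 = 0" "Y 6 - Y 3 = d0 / 2" "X 6 - X 3 = 1/2 - d0 / 2"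
    using Z[of 1] by (simp_all add: a1_def a2_def b2_def p_def q_def)
  have Z2: "X 7 - X 6 = d0" "Y 7 - Y 6 = 0" "X 4 - X 6 = d0 / 2" "Y 6 - Y 4 = 1/2 - d0 / 2"
    using Z[of 2] by (simp_all add: a4_def b4_def p_def q_def)
  have Z3: "Y 4 - Y 2 = d0" "X 4 - X 2 = 0"
    using Z[of 3] by (simp_all add: p_def q_def)
  \<comment> \<open>The origin of \<open>ideal\<close> is the midpoint of the points 0 and 1, half a
    diagonal to the right of point 0.\<close>
  have "\<forall>v\<in>set verts. cfg f v = cfg f 0 + (d0 / 2, 0) + ideal v"
    using Z0 Z1 Z2 Z3 by (auto simp: verts_def ideal_def prod_eq_iff X_def Y_def)
  then show ?thesis by blast
qed

subsection \<open>Isometries of the torus\<close>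

text \<open>Working with lifts avoids a quotient at every composition. Compatibility with the
  lattice is implied, as \<open>plane_dist\<close> vanishes exactly on congruent points.\<close>

definition torus_iso :: "(real \<times> real \<Rightarrow> real \<times> real) \<Rightarrow> bool" where
  "torus_iso G \<longleftrightarrow> bij G \<and> (\<forall>p q. plane_dist (G p) (G q) = plane_dist p q)"

lemma torus_isoI: "bij G \<Longrightarrow> (\<And>p q. plane_dist (G p) (G q) = plane_dist p q) \<Longrightarrow> torus_iso G"
  unfolding torus_iso_def by blast

lemma torus_isoD:
  assumes "torus_iso G"
  shows "bij G" "plane_dist (G p) (G q) = plane_dist p q"
  using assms unfolding torus_iso_def by blast+

lemma torus_iso_comp: "torus_iso G \<Longrightarrow> torus_iso H \<Longrightarrow> torus_iso (G \<circ> H)"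
  by (rule torus_isoI) (simp_all only: bij_comp torus_isoD comp_apply)

lemma torus_iso_inv:
  assumes "torus_iso G"
  shows "torus_iso (inv G)"
proof (rule torus_isoI)
  show "bij (inv G)" by (rule bij_imp_bij_inv[OF torus_isoD(1)[OF assms]])
  show "plane_dist (inv G p) (inv G q) = plane_dist p q" for p q
    using torus_isoD(2)[OF assms, of "inv G p" "inv G q"] torus_isoD(1)[OF assms]
    by (simp only: bij_is_surj surj_f_inv_f)
qed

lemma plane_dist_translate: "plane_dist (c + p) (c + q) = plane_dist p q"
  by (simp add: plane_dist_def)

lemma torus_iso_translate: "torus_iso ((+) c)"
proof (rule torus_isoI)
  show "bij ((+) c)"
    by (rule o_bij[of "(+) (- c)"]) (simp_all add: fun_eq_iff)
qed (rule plane_dist_translate)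

text \<open>The image of a minimizing lattice vector is a candidate on the other side. Equality will
  follow by iterating a map of finite order.\<close>

lemma plane_dist_le_linear:
  assumes "\<And>p q. G (p + q) = G p + G q" "\<And>p. norm (G p) = norm p" "\<And>z. z \<in> lattice \<Longrightarrow> G z \<in> lattice"
  shows "plane_dist (G p) (G q) \<le> plane_dist p q"
proof -
  have d: "G (p - q) = G p - G q" using assms(1)[of "p - q" q] by (simp add: algebra_simps)
  obtain z where z: "z \<in> lattice" "plane_dist p q = norm (p - q + z)"
    using plane_dist_attained by blast
  have "plane_dist (G p) (G q) \<le> norm (G p - G q + G z)"
    by (rule plane_dist_le[OF assms(3)[OF z(1)]])
  also have "\<dots> = norm (p - q + z)" by (simp only: d[symmetric] assms(1)[symmetric] assms(2))
  finally show ?thesis using z(2) by simp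
qed

lemma torus_iso_quarter: "torus_iso quarter" and torus_iso_mirror: "torus_iso mirror"
proof -
  have q4: "quarter (quarter (quarter (quarter p))) = p" and m2: "mirror (mirror p) = p" for p
    by (simp_all add: quarter_def mirror_def)
  have ql: "plane_dist (quarter p) (quarter q) \<le> plane_dist p q" for p q
    by (rule plane_dist_le_linear) (auto simp: quarter_def norm_prod_def add.commute)
  have ml: "plane_dist (mirror p) (mirror q) \<le> plane_dist p q" for p q
    by (rule plane_dist_le_linear) (auto simp: mirror_def norm_prod_def)
  have "plane_dist p q \<le> plane_dist (quarter p) (quarter q)" for p q
    using ql[of "quarter (quarter (quarter p))" "quarter (quarter (quarter q))"]
      ql[of "quarter (quarter p)" "quarter (quarter q)"] ql[of "quarter p" "quarter q"]
    by (simp add: q4)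
  moreover have "bij quarter" by (rule o_bij[of "quarter \<circ> quarter \<circ> quarter"]) (rule ext, simp only: comp_apply q4 id_apply)+
  ultimately show "torus_iso quarter" using ql by (intro torus_isoI antisym)
  have "plane_dist p q \<le> plane_dist (mirror p) (mirror q)" for p q
    using ml[of "mirror p" "mirror q"] by (simp add: m2)
  moreover have "bij mirror" by (rule o_bij[of mirror]) (rule ext, simp only: comp_apply m2 id_apply)+
  ultimately show "torus_iso mirror" using ml by (intro torus_isoI antisym)
qed

lemma dist_to_torus: "dist (to_torus p) (to_torus q) = plane_dist p q"
  by (rule dist_torus.abs_eq)

lemma to_torus_eq: "to_torus p = to_torus q \<longleftrightarrow> p - q \<in> lattice"
  by (rule torus.abs_eq_iff)

lemma torus_iso_lift:
  assumes "torus_iso G"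
  shows "\<exists>f :: torus \<Rightarrow> torus. isometry f \<and> (\<forall>p. f (to_torus p) = to_torus (G p))"
proof -
  define f where "f x = to_torus (G (rep_torus x))" for x
  have at: "to_torus (rep_torus x) = x" for x by (rule Quotient3_abs_rep[OF Quotient3_torus])
  have pd: "plane_dist (rep_torus x) (rep_torus y) = dist x y" for x y
    using dist_to_torus[of "rep_torus x" "rep_torus y"] by (simp add: at)
  have fd: "dist (f x) (f y) = dist x y" for x y
    by (simp only: f_def dist_to_torus torus_isoD(2)[OF assms] pd)
  have ft: "f (to_torus p) = to_torus (G p)" for p
  proof -
    have "dist (f (to_torus p)) (to_torus (G p)) = plane_dist (rep_torus (to_torus p)) p"
      by (simp only: f_def dist_to_torus torus_isoD(2)[OF assms])
    also have "\<dots> = dist (to_torus (rep_torus (to_torus p))) (to_torus p)" by (simp only: dist_to_torus)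
    finally show ?thesis by (simp add: at)
  qed
  have "inj f" by (rule injI) (metis fd dist_eq_0_iff)
  moreover have "surj f"
  proof (rule surjI)
    show "f (to_torus (inv G (rep_torus y))) = y" for y
      using torus_isoD(1)[OF assms] by (simp only: ft at bij_is_surj surj_f_inv_f)
  qed
  ultimately show ?thesis using fd ft by (auto simp: isometry_def bij_def)
qed

lemma sym_image_iso:
  assumes "sym_image f g"
  shows "\<exists>G. torus_iso G \<and> {g a b | a b. valid a b} = G ` {f a b | a b. valid a b}"
  using assms
proof induction
  case sym_id
  have "torus_iso id" by (rule torus_isoI) simp_all
  then have "torus_iso (\<lambda>p. p)" by (simp add: id_def)
  then show ?case by (intro exI[of _ "\<lambda>p. p"] conjI) simp_all
next
  case (sym_rot g)
  then obtain G where G: "torus_iso G" "{g a b | a b. valid a b} = G ` {f a b | a b. valid a b}" by blast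
  have "{rot g a b | a b. valid a b} = quarter ` {g a b | a b. valid a b}"
  proof (intro equalityI subsetI)
    fix p assume "p \<in> {rot g a b | a b. valid a b}"
    then obtain a b where "valid a b" "p = quarter (g b (- a))" by (auto simp: rot_def)
    then show "p \<in> quarter ` {g a b | a b. valid a b}" using valid_rot by blast
  next
    fix p assume "p \<in> quarter ` {g a b | a b. valid a b}"
    then obtain a b where v: "valid a b" "p = quarter (g a b)" by blast
    then have "p = rot g (- b) a" "valid (- b) a" using valid_rot[of a "- b"] by (simp_all add: rot_def)
    then show "p \<in> {rot g a b | a b. valid a b}" by blast
  qed
  then have "{rot g a b | a b. valid a b} = (quarter \<circ> G) ` {f a b | a b. valid a b}"
    by (simp only: G(2) image_comp)
  with torus_iso_comp[OF torus_iso_quarter G(1)] show ?case by (intro exI[of _ "quarter \<circ> G"] conjI)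
next
  case (sym_refl g)
  then obtain G where G: "torus_iso G" "{g a b | a b. valid a b} = G ` {f a b | a b. valid a b}" by blast
  have "{reflect g a b | a b. valid a b} = mirror ` {g a b | a b. valid a b}"
  proof (intro equalityI subsetI)
    fix p assume "p \<in> {reflect g a b | a b. valid a b}"
    then obtain a b where "valid a b" "p = mirror (g (- a) b)" by (auto simp: reflect_def)
    then show "p \<in> mirror ` {g a b | a b. valid a b}" using valid_refl by blast
  next
    fix p assume "p \<in> mirror ` {g a b | a b. valid a b}"
    then obtain a b where v: "valid a b" "p = mirror (g a b)" by blast
    then have "p = reflect g (- a) b" "valid (- a) b" by (simp_all add: reflect_def valid_refl)
    then show "p \<in> {reflect g a b | a b. valid a b}" by blast
  qed
  then have "{reflect g a b | a b. valid a b} = (mirror \<circ> G) ` {f a b | a b. valid a b}"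
    by (simp only: G(2) image_comp)
  with torus_iso_comp[OF torus_iso_mirror G(1)] show ?case by (intro exI[of _ "mirror \<circ> G"] conjI)
qed

lemma rv_lattice: "rv z \<in> lattice" and lattice_rv: "w \<in> lattice \<Longrightarrow> \<exists>z. w = rv z"
proof -
  show "rv z \<in> lattice" by (simp add: rv_def)
  show "\<exists>z. w = rv z" if "w \<in> lattice"
  proof -
    obtain a b where "fst w = of_int a" "snd w = of_int b"
      using \<open>w \<in> lattice\<close> by (cases w) (auto elim!: Ints_cases)
    then have "w = rv (a, b)" by (simp add: rv_Pair prod_eq_iff)
    then show ?thesis by blast
  qed
qed

lemma label_cover:
  assumes "valid a b"
  shows "\<exists>v\<in>set verts. \<exists>i j. a = fst (label v) + 3 * i \<and> b = snd (label v) + 3 * j"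
proof -
  \<comment> \<open>Shifting by 1 before and after the reduction gives the residues -1, 0, 1 used by
    \<open>label\<close>.\<close>
  define r s where "r = (a + 1) mod 3 - 1" and "s = (b + 1) mod 3 - 1"
  have rs: "r \<in> {-1, 0, 1}" "s \<in> {-1, 0, 1}" by (auto simp: r_def s_def)
  have ab: "a = r + 3 * ((a + 1) div 3)" "b = s + 3 * ((b + 1) div 3)"
    unfolding r_def s_def by presburger+
  have "(r, s) \<noteq> (0, 0)"
  proof
    assume "(r, s) = (0, 0)"
    then have "a = 3 * ((a + 1) div 3)" "b = 3 * ((b + 1) div 3)" using ab by auto
    then show False using assms unfolding valid_def by (metis dvd_triv_left)
  qed
  then have "\<exists>v\<in>set verts. label v = (r, s)"
    using rs by (auto simp: verts_def label_def)
  then show ?thesis using ab by (metis fst_conv snd_conv)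
qed

lemma label_valid: "v \<in> set verts \<Longrightarrow> valid (fst (label v)) (snd (label v))"
  by (auto simp: verts_def label_def valid_def)

lemma optimal_ideal: "optimal_config d0 = to_torus ` ideal ` set verts"
  by (auto simp: optimal_config_def verts_def ideal_def)

text \<open>Up to lattice translations, the image of the grid under a symmetry of the square is a
  translate of \<open>ideal\<close>; undoing the symmetry gives the claim for \<open>P\<close>
  itself.\<close>

lemma rigid_config:
  assumes "packing8 P B"
  shows "\<exists>G. torus_iso G \<and> to_torus ` P = to_torus ` G ` ideal ` set verts"
proof -
  interpret packing8 P B by fact
  obtain f where f: "grid f" "P = {f a b | a b. valid a b}" using ex_grid by blast
  obtain g where g: "sym_image f g" "grid g" "holds (cfg g) edges contact_cones" using contact[OF f(1)] .
  obtain c where c: "\<And>v. v \<in> set verts \<Longrightarrow> cfg g v = c + ideal v" using cfg_ideal[OF g(2,3)] by blast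
  obtain G where G: "torus_iso G" "{g a b | a b. valid a b} = G ` P" using sym_image_iso[OF g(1)] f(2) by blast
  have bij: "bij G" by (rule torus_isoD(1)[OF G(1)])
  have iG: "torus_iso (inv G \<circ> (+) c)"
    by (intro torus_iso_comp torus_iso_inv G torus_iso_translate)
  have eq: "to_torus (inv G p) = to_torus (inv G q)" if "to_torus p = to_torus q" for p q
    using that torus_isoD(2)[OF torus_iso_inv[OF G(1)]] by (metis dist_eq_0_iff dist_to_torus)
  have P: "P = inv G ` {g a b | a b. valid a b}"
    unfolding G(2) using bij by (simp add: image_comp inv_o_cancel bij_is_inj)
  have "to_torus ` P = to_torus ` inv G ` (\<lambda>v. c + ideal v) ` set verts"
  proof
    show "to_torus ` P \<subseteq> to_torus ` inv G ` (\<lambda>v. c + ideal v) ` set verts"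
    proof
      fix x assume "x \<in> to_torus ` P"
      then obtain a b where v: "valid a b" and x: "x = to_torus (inv G (g a b))" unfolding P by blast
      obtain v i j where v': "v \<in> set verts" and ab: "a = fst (label v) + 3 * i" "b = snd (label v) + 3 * j"
        using label_cover[OF v] by blast
      have "g a b = c + ideal v + rv (i, j)"
        using grid_shift[OF g(2), of "fst (label v)" i "snd (label v)" j] c[OF v'] by (simp add: ab cfg_def)
      then have "to_torus (g a b) = to_torus (c + ideal v)"
        unfolding to_torus_eq using rv_lattice by (simp only: add_diff_cancel_left')
      then show "x \<in> to_torus ` inv G ` (\<lambda>v. c + ideal v) ` set verts"
        unfolding x using eq v' by (metis imageI)
    qed
    show "to_torus ` inv G ` (\<lambda>v. c + ideal v) ` set verts \<subseteq> to_torus ` P"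
    proof (intro image_mono subsetI)
      fix x assume "x \<in> inv G ` (\<lambda>v. c + ideal v) ` set verts"
      then obtain v where v: "v \<in> set verts" "x = inv G (cfg g v)" using c by auto
      then show "x \<in> P" unfolding P cfg_def using label_valid by blast
    qed
  qed
  then have "to_torus ` P = to_torus ` (inv G \<circ> (+) c) ` ideal ` set verts"
    by (simp add: image_comp comp_def)
  with iG show ?thesis by (intro exI[of _ "inv G \<circ> (+) c"] conjI)
qed

section \<open>Sets on the torus and their lifts\<close>

lemma rv_norm_ge: "rv z \<noteq> 0 \<Longrightarrow> 1 \<le> norm (rv z)"
proof -
  assume "rv z \<noteq> 0"
  then have "fst z \<noteq> 0 \<or> snd z \<noteq> 0" by (auto simp: rv_def prod_eq_iff)
  then have "1 \<le> \<bar>real_of_int (fst z)\<bar> \<or> 1 \<le> \<bar>real_of_int (snd z)\<bar>" by linarith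
  moreover have "\<bar>real_of_int (fst z)\<bar> \<le> norm (rv z)" "\<bar>real_of_int (snd z)\<bar> \<le> norm (rv z)"
    using norm_fst_le[of "real_of_int (fst z)" "real_of_int (snd z)"]
      norm_snd_le[of "real_of_int (snd z)" "real_of_int (fst z)"] by (simp_all add: rv_def)
  ultimately show ?thesis by linarith
qed

lemma to_torus_rep: "to_torus (rep_torus x) = x"
  by (rule Quotient3_abs_rep[OF Quotient3_torus])

lemma to_torus_rv: "to_torus (p + rv z) = to_torus p"
  unfolding to_torus_eq using rv_lattice[of z] by (simp only: add_diff_cancel_left')

text \<open>Two lifts of one point differ by a lattice vector of length at least 1, which exceeds
  \<open>d0\<close>; lifts of different points are at least as far apart as the points on the
  torus.\<close>

lemma packing_of_set:
  fixes X :: "torus set"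
  assumes X: "card X = 8" and sep: "\<And>x y. x \<in> X \<Longrightarrow> y \<in> X \<Longrightarrow> x \<noteq> y \<Longrightarrow> d0 \<le> dist x y"
  shows "packing8 {p. to_torus p \<in> X} (rep_torus ` X)"
proof (intro packing8.intro packing.intro packing8_axioms.intro)
  show "p + rv z \<in> {p. to_torus p \<in> X}" if "p \<in> {p. to_torus p \<in> X}" for p z
    using that by (simp only: mem_Collect_eq to_torus_rv)
  show "d0 \<le> norm (q - p)"
    if P: "p \<in> {p. to_torus p \<in> X}" "q \<in> {p. to_torus p \<in> X}" and ne: "p \<noteq> q" for p q
  proof (cases "to_torus q = to_torus p")
    case True
    then have "q - p \<in> lattice" by (rule iffD1[OF to_torus_eq])
    from lattice_rv[OF this] obtain z where z: "q - p = rv z" by (elim exE)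
    then have "rv z \<noteq> 0" using ne by (metis right_minus_eq)
    from rv_norm_ge[OF this] show ?thesis unfolding z using d0_frac by linarith
  next
    case False
    then have "d0 \<le> dist (to_torus q) (to_torus p)" using sep P by blast
    also have "\<dots> = plane_dist q p" by (rule dist_to_torus)
    also have "\<dots> \<le> norm (q - p + 0)" by (rule plane_dist_le[OF lattice_zero])
    finally show ?thesis by (simp only: add_0_right)
  qed
  have "inj_on rep_torus X" by (rule inj_onI) (metis to_torus_rep)
  then show "card (rep_torus ` X) = 8" using X by (simp only: card_image)
  show "rep_torus ` X \<subseteq> {p. to_torus p \<in> X}" by (auto simp only: mem_Collect_eq to_torus_rep)
  show "\<exists>b\<in>rep_torus ` X. \<exists>z. p = b + rv z" if "p \<in> {p. to_torus p \<in> X}" for p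
  proof -
    have "to_torus p = to_torus (rep_torus (to_torus p))" by (simp only: to_torus_rep)
    then have "p - rep_torus (to_torus p) \<in> lattice" by (rule iffD1[OF to_torus_eq])
    from lattice_rv[OF this] obtain z where "p - rep_torus (to_torus p) = rv z" by (elim exE)
    then have "p = rep_torus (to_torus p) + rv z" by (metis add.commute diff_add_cancel)
    then show ?thesis using that by blast
  qed
  show "p = q" if pq: "p \<in> rep_torus ` X" "q \<in> rep_torus ` X" "p = q + rv z" for p q z
  proof -
    obtain x y where xy: "p = rep_torus x" "q = rep_torus y" using pq(1,2) by blast
    have "x = to_torus p" "y = to_torus q" by (simp_all only: xy to_torus_rep)
    moreover have "to_torus p = to_torus q" unfolding pq(3) by (rule to_torus_rv)
    ultimately show ?thesis using xy by simp
  qed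
qed

text \<open>A coordinate in the interval from -1/2 to 1/2 cannot be brought closer to 0 by adding an
  integer, so this difference is a shortest one.\<close>

lemma plane_dist_ge:
  assumes "p - q + rv z = (u, v)" "\<bar>u\<bar> \<le> 1/2" "\<bar>v\<bar> \<le> 1/2" "d0\<^sup>2 \<le> u\<^sup>2 + v\<^sup>2"
  shows "d0 \<le> plane_dist p q"
proof -
  obtain w where w: "w \<in> lattice" "plane_dist p q = norm (p - q + w)" using plane_dist_attained by blast
  obtain y where "w = rv y" using lattice_rv[OF w(1)] by blast
  then have e: "p - q + w = (u + of_int (fst y - fst z), v + of_int (snd y - snd z))"
    using assms(1) by (simp add: rv_def prod_eq_iff algebra_simps)
  have far: "x\<^sup>2 \<le> (x + of_int n)\<^sup>2" if "\<bar>x\<bar> \<le> 1/2" for x :: real and n :: int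
  proof (cases "n = 0")
    case False
    then have "1 \<le> \<bar>real_of_int n\<bar>" by linarith
    then have "\<bar>x\<bar> \<le> \<bar>x + of_int n\<bar>" using that by linarith
    then show ?thesis by (simp add: abs_le_square_iff)
  qed simp
  have "d0\<^sup>2 \<le> (u + of_int (fst y - fst z))\<^sup>2 + (v + of_int (snd y - snd z))\<^sup>2"
    using assms(4) far[OF assms(2)] far[OF assms(3)] by (meson add_mono order_trans)
  then have "d0 \<le> sqrt ((u + of_int (fst y - fst z))\<^sup>2 + (v + of_int (snd y - snd z))\<^sup>2)"
    by (rule real_le_rsqrt)
  then show ?thesis unfolding w(2) e norm_Pair real_norm_def power2_abs .
qed

text \<open>An expression linear in \<open>d0\<close> is tested at the ends of an interval around
  \<open>d0\<close>. At a contact it is exactly 0, and since \<open>d0\<close> is irrational both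
  coefficients vanish; so the coarse interval is good enough.\<close>

definition nonneg :: "int \<Rightarrow> int \<Rightarrow> bool" where
  "nonneg P Q \<longleftrightarrow> P = 0 \<and> Q = 0 \<or> 0 \<le> 100000 * P + 36602 * Q \<and> 0 \<le> 100000 * P + 36603 * Q"

lemma nonneg_sound:
  assumes "nonneg P Q"
  shows "0 \<le> of_int P + of_int Q * d0"
proof (cases "P = 0 \<and> Q = 0")
  case False
  then have i: "0 \<le> 100000 * P + 36602 * Q" "0 \<le> 100000 * P + 36603 * Q"
    using assms by (auto simp: nonneg_def)
  then have r: "0 \<le> real_of_int (100000 * P + 36602 * Q)" "0 \<le> real_of_int (100000 * P + 36603 * Q)"
    by (simp_all only: of_int_0_le_iff)
  show ?thesis
  proof (cases "0 \<le> Q")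
    case True
    then have "of_int Q * (36602/100000) \<le> of_int Q * d0"
      using d0_frac by (intro mult_left_mono) auto
    then show ?thesis using r(1) by simp
  next
    case False
    then have "of_int Q * (36603/100000) \<le> of_int Q * d0"
      using d0_frac by (intro mult_left_mono_neg) auto
    then show ?thesis using r(2) by simp
  qed
qed simp

text \<open>Twice the coordinates of \<^const>\<open>ideal\<close> as integer combinations of \<open>1\<close> and \<^const>\<open>d0\<close>.\<close>

definition half_coeffs :: "int \<Rightarrow> int \<times> int \<times> int \<times> int" where
  "half_coeffs v = (if v = 0 then (0, -1, 0, 0) else if v = 1 then (0, 1, 0, 0) else if v = 2 then (1, 0, 0, -1)
     else if v = 3 then (0, 0, 1, -1) else if v = 4 then (1, 0, 0, 1) else if v = 5 then (0, 0, 1, 1)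
     else if v = 6 then (1, -1, 1, 0) else (1, 1, 1, 0))"

text \<open>The first four tests put the difference, translated by \<open>(x, y)\<close>, into the
  square of side 1 around 0. The last one is eight times its squared length minus
  \<open>d0\<^sup>2\<close>, with \<open>d0\<^sup>2\<close> replaced by
  \<open>1/2 - d0\<close>.\<close>

fun apart :: "int \<times> int \<times> int \<times> int \<Rightarrow> int \<times> int \<times> int \<times> int \<Rightarrow> vec \<Rightarrow> bool" where
  "apart (a, b, c, e) (a', b', c', e') (x, y) \<longleftrightarrow>
    (let A = a - a' + 2 * x; B = b - b'; C = c - c' + 2 * y; E = e - e'; N = B * B + E * E - 4
     in nonneg (1 - A) (- B) \<and> nonneg (1 + A) B \<and> nonneg (1 - C) (- E) \<and> nonneg (1 + C) E \<and>
       nonneg (2 * A * A + 2 * C * C + N) (4 * A * B + 4 * C * E - 2 * N))"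

lemma apart_all:
  "list_all (\<lambda>v. list_all (\<lambda>w. v = w \<or>
     list_ex (apart (half_coeffs v) (half_coeffs w)) [(0, 0), (1, 0), (-1, 0), (0, 1), (0, -1), (1, 1), (1, -1), (-1, 1), (-1, -1)])
     verts) verts"
  by code_simp

lemma ideal_dist:
  assumes "v \<in> set verts" "w \<in> set verts" "v \<noteq> w"
  shows "d0 \<le> plane_dist (ideal v) (ideal w)"
proof -
  obtain z where "apart (half_coeffs v) (half_coeffs w) z"
    using apart_all assms unfolding list_all_iff list_ex_iff by blast
  then obtain x y where ap: "apart (half_coeffs v) (half_coeffs w) (x, y)" by (cases z) blast
  obtain a b c e where cv: "half_coeffs v = (a, b, c, e)" by (cases "half_coeffs v")
  obtain a' b' c' e' where cw: "half_coeffs w = (a', b', c', e')" by (cases "half_coeffs w")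
  have id: "ideal v = (of_int a / 2 + of_int b / 2 * d0, of_int c / 2 + of_int e / 2 * d0)"
    if "half_coeffs v = (a, b, c, e)" for v a b c e
    using that by (auto simp: half_coeffs_def ideal_def split: if_splits)
  define A B C E where "A = a - a' + 2 * x" and "B = b - b'" and "C = c - c' + 2 * y" and "E = e - e'"
  define u v' where "u = of_int A / 2 + of_int B / 2 * d0" and "v' = of_int C / 2 + of_int E / 2 * d0"
  define N where "N = B * B + E * E - 4"
  have n: "nonneg (1 - A) (- B)" "nonneg (1 + A) B" "nonneg (1 - C) (- E)" "nonneg (1 + C) E"
    "nonneg (2 * A * A + 2 * C * C + N) (4 * A * B + 4 * C * E - 2 * N)"
    using ap unfolding cv cw by (simp_all add: Let_def A_def B_def C_def E_def N_def)
  have "0 \<le> 1 - 2 * u" "0 \<le> 1 + 2 * u" "0 \<le> 1 - 2 * v'" "0 \<le> 1 + 2 * v'"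
    using n(1-4)[THEN nonneg_sound] by (simp_all add: u_def v'_def algebra_simps)
  then have uv: "\<bar>u\<bar> \<le> 1/2" "\<bar>v'\<bar> \<le> 1/2" by linarith+
  have dd: "d0 * d0 = 1/2 - d0" using d0_quad by (simp add: power2_eq_square)
  have "8 * (u\<^sup>2 + v'\<^sup>2 - d0\<^sup>2) = 2 * of_int A * of_int A + 2 * of_int C * of_int C
      + (4 * of_int A * of_int B + 4 * of_int C * of_int E) * d0
      + 2 * (of_int B * of_int B + of_int E * of_int E - 4) * (d0 * d0)"
    by (simp add: u_def v'_def power2_eq_square field_simps)
  also have "\<dots> = of_int (2 * A * A + 2 * C * C + N) + of_int (4 * A * B + 4 * C * E - 2 * N) * d0"
    unfolding dd by (simp add: N_def algebra_simps)
  also have "\<dots> \<ge> 0" by (rule nonneg_sound[OF n(5)])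
  finally have "d0\<^sup>2 \<le> u\<^sup>2 + v'\<^sup>2" by simp
  moreover have "ideal v - ideal w + rv (x, y) = (u, v')"
    unfolding id[OF cv] id[OF cw] by (simp add: rv_Pair u_def v'_def A_def B_def C_def E_def field_simps)
  ultimately show ?thesis using uv by (intro plane_dist_ge)
qed

section \<open>Minimal distances, optimality and uniqueness\<close>

lemma min_dist_props:
  fixes X :: "'a::metric_space set"
  assumes "card X = 8"
  shows "\<And>x y. x \<in> X \<Longrightarrow> y \<in> X \<Longrightarrow> x \<noteq> y \<Longrightarrow> min_dist X \<le> dist x y"
    and "(\<And>x y. x \<in> X \<Longrightarrow> y \<in> X \<Longrightarrow> x \<noteq> y \<Longrightarrow> r \<le> dist x y) \<Longrightarrow> r \<le> min_dist X"
proof -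
  let ?D = "{dist u v | u v. u \<in> X \<and> v \<in> X \<and> u \<noteq> v}"
  have "finite X" using assms by (simp add: card_ge_0_finite)
  have "?D \<subseteq> (\<lambda>(u, v). dist u v) ` (X \<times> X)" by auto
  then have fin: "finite ?D"
    using finite_subset finite_imageI[OF finite_cartesian_product[OF \<open>finite X\<close> \<open>finite X\<close>]] by blast
  show "min_dist X \<le> dist x y" if "x \<in> X" "y \<in> X" "x \<noteq> y" for x y
    unfolding min_dist_def using fin that by (intro Min_le) blast+
  obtain x where x: "x \<in> X" using assms by force
  have "X \<noteq> {x}" using assms by auto
  then obtain y where "y \<in> X" "x \<noteq> y" using x by blast
  then have ne: "?D \<noteq> {}" using x by blast
  assume "\<And>x y. x \<in> X \<Longrightarrow> y \<in> X \<Longrightarrow> x \<noteq> y \<Longrightarrow> r \<le> dist x y"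
  then show "r \<le> min_dist X"
    unfolding min_dist_def using fin ne by (subst Min_ge_iff) auto
qed

lemma isometry_image:
  fixes f :: "'a::metric_space \<Rightarrow> 'a"
  assumes "isometry f"
  shows "card (f ` X) = card X" "min_dist (f ` X) = min_dist X"
proof -
  have inj: "inj f" and d: "\<And>x y. dist (f x) (f y) = dist x y" using assms by (auto simp: isometry_def bij_is_inj)
  show "card (f ` X) = card X" using inj by (simp add: card_image inj_on_subset)
  have "{dist u v | u v. u \<in> f ` X \<and> v \<in> f ` X \<and> u \<noteq> v} = {dist u v | u v. u \<in> X \<and> v \<in> X \<and> u \<noteq> v}"
  proof (intro equalityI subsetI)
    fix r assume "r \<in> {dist u v | u v. u \<in> X \<and> v \<in> X \<and> u \<noteq> v}"
    then obtain u v where "u \<in> X" "v \<in> X" "u \<noteq> v" "r = dist (f u) (f v)" by (auto simp: d)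
    then show "r \<in> {dist u v | u v. u \<in> f ` X \<and> v \<in> f ` X \<and> u \<noteq> v}"
      using inj by (blast dest: injD)
  next
    fix r assume "r \<in> {dist u v | u v. u \<in> f ` X \<and> v \<in> f ` X \<and> u \<noteq> v}"
    then obtain u v where "u \<in> X" "v \<in> X" "f u \<noteq> f v" "r = dist (f u) (f v)" by blast
    then have "u \<noteq> v" "r = dist u v" by (auto simp: d)
    then show "r \<in> {dist u v | u v. u \<in> X \<and> v \<in> X \<and> u \<noteq> v}" using \<open>u \<in> X\<close> \<open>v \<in> X\<close> by blast
  qed
  then show "min_dist (f ` X) = min_dist X" by (simp add: min_dist_def)
qed

lemma optimal_config_props: "card (optimal_config d0) = 8" "min_dist (optimal_config d0) = d0"
proof -
  have inj: "inj_on (\<lambda>v. to_torus (ideal v)) (set verts)"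
  proof (rule inj_onI, rule ccontr)
    fix v w assume vw: "v \<in> set verts" "w \<in> set verts" "to_torus (ideal v) = to_torus (ideal w)" "v \<noteq> w"
    then have "d0 \<le> dist (to_torus (ideal v)) (to_torus (ideal w))"
      unfolding dist_to_torus by (intro ideal_dist)
    then show False using vw(3) d0_pos by simp
  qed
  have opt: "optimal_config d0 = (\<lambda>v. to_torus (ideal v)) ` set verts"
    by (simp add: optimal_ideal image_image)
  show c: "card (optimal_config d0) = 8"
    unfolding opt card_image[OF inj] by (simp add: verts_def)
  have "d0 \<le> min_dist (optimal_config d0)"
  proof (rule min_dist_props(2)[OF c])
    fix x y assume "x \<in> optimal_config d0" "y \<in> optimal_config d0" "x \<noteq> y"
    then obtain v w where "v \<in> set verts" "w \<in> set verts" "v \<noteq> w" "x = to_torus (ideal v)" "y = to_torus (ideal w)"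
      unfolding opt by blast
    then show "d0 \<le> dist x y" by (simp add: dist_to_torus ideal_dist)
  qed
  moreover have "min_dist (optimal_config d0) \<le> d0"
  proof -
    have v: "0 \<in> set verts" "1 \<in> set verts" by (simp_all add: verts_def)
    then have "min_dist (optimal_config d0) \<le> dist (to_torus (ideal 0)) (to_torus (ideal 1))"
      using inj_onD[OF inj, of 0 1] by (intro min_dist_props(1)[OF c]) (auto simp: opt)
    also have "\<dots> \<le> norm (ideal 0 - ideal 1 + 0)"
      unfolding dist_to_torus by (rule plane_dist_le[OF lattice_zero])
    also have "\<dots> = d0" using d0_pos by (simp add: ideal_def norm_Pair)
    finally show ?thesis .
  qed
  ultimately show "min_dist (optimal_config d0) = d0" by simp
qed

text \<open>Assuming only an inequality makes this statement give the upper bound as well as the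
  uniqueness.\<close>

lemma config_unique:
  fixes X :: "torus set"
  assumes X: "card X = 8" and m: "d0 \<le> min_dist X"
  shows "\<exists>f :: torus \<Rightarrow> torus. isometry f \<and> X = f ` optimal_config d0"
proof -
  have sep: "d0 \<le> dist x y" if "x \<in> X" "y \<in> X" "x \<noteq> y" for x y
    using min_dist_props(1)[OF X that] m by simp
  obtain G where G: "torus_iso G" "to_torus ` {p. to_torus p \<in> X} = to_torus ` G ` ideal ` set verts"
    using rigid_config[OF packing_of_set[OF X sep]] by blast
  obtain f :: "torus \<Rightarrow> torus" where f: "isometry f" "\<And>p. f (to_torus p) = to_torus (G p)"
    using torus_iso_lift[OF G(1)] by blast
  have "X = to_torus ` {p. to_torus p \<in> X}"
  proof (intro equalityI subsetI)
    fix x assume "x \<in> X"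
    moreover have "x = to_torus (rep_torus x)" by (rule Quotient3_abs_rep[OF Quotient3_torus, symmetric])
    ultimately show "x \<in> to_torus ` {p. to_torus p \<in> X}" by (metis (mono_tags) image_eqI mem_Collect_eq)
  qed auto
  also have "\<dots> = f ` optimal_config d0"
    unfolding G(2) optimal_ideal by (simp add: image_image f(2))
  finally show ?thesis using f(1) by blast
qed

theorem theorem3:
  fixes d :: real
  assumes "d = 1 / (1 + sqrt 3)"
  shows "\<bar>d - 0.3660\<bar> < 0.00005 \<and>
    (\<exists>X :: torus set. card X = 8 \<and> min_dist X = d) \<and>
    (\<forall>X :: torus set. card X = 8 \<longrightarrow> min_dist X \<le> d) \<and>
    (\<forall>X :: torus set. card X = 8 \<longrightarrow>
       (min_dist X = d \<longleftrightarrow> (\<exists>f :: torus \<Rightarrow> torus. isometry f \<and> X = f ` optimal_config d)))"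
proof -
  have d: "d = d0" by (simp add: assms d0_def)
  have u: "min_dist X = d0" if "isometry f" "X = f ` optimal_config d0" for f :: "torus \<Rightarrow> torus" and X
    using isometry_image(2)[OF that(1), of "optimal_config d0"] that(2) optimal_config_props(2) by simp
  show ?thesis
    unfolding d
  proof (intro conjI allI impI)
    show "\<bar>d0 - 0.3660\<bar> < 0.00005" using d0_bounds by (simp add: abs_less_iff)
    show "\<exists>X :: torus set. card X = 8 \<and> min_dist X = d0" using optimal_config_props by blast
    fix X :: "torus set" assume X: "card X = 8"
    show "min_dist X \<le> d0"
    proof (rule ccontr)
      assume "\<not> min_dist X \<le> d0"
      \<comment> \<open>A set with larger minimal distance would be a copy of the optimal
        configuration, whose minimal distance is \<open>d0\<close>.\<close>
      then show False using config_unique[OF X] u by fastforce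
    qed
    show "min_dist X = d0 \<longleftrightarrow> (\<exists>f :: torus \<Rightarrow> torus. isometry f \<and> X = f ` optimal_config d0)"
      using config_unique[OF X] u by fastforce
  qed
qed

end
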